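(* For all integers $k,r\ge 0$ and every partition $\lambda\in\mathcal P_r$, $$\big(\mathcal E(\mathbf z_k,\mathbf w_k^{-1})\Delta_\lambda(H_r)\big)[\mathbf b]^r_0=\prod_{j=1}^k\left(\frac{z_j}{w_j}\right)^{r-k}\Gamma(\mathbf z_k)\,\Gamma^*(\mathbf w_k)\,[\mathbf b]^r_\lambda .$$
   Context: All vector spaces are over $\mathbb Q$. $V=\bigoplus_{i\ge0}\mathbb Q b_i$, with the convention $b_i=0$ for $i<0$; its restricted dual is $V^*=\bigoplus_{j\ge0}\mathbb Q\beta_j$, $\beta_j(b_i)=\delta_{ij}$. $\mathcal P_r$ is the set of partitions $\lambda=(\lambda_1\ge\lambda_2\ge\cdots)$ of length at most $r$ (padded by zeros). For $\lambda\in\mathcal P_r$ put $[\mathbf b]^r_\lambda=b_{r-1+\lambda_1}\wedge b_{r-2+\lambda_2}\wedge\cdots\wedge b_{\lambda_r}\in\bigwedge^rV$ and $[\boldsymbol\beta]^r_\lambda=\beta_{r-1+\lambda_1}\wedge\cdots\wedge\beta_{\lambda_r}\in\bigwedge^rV^*$; the subscript $0$ denotes the empty partition, $\bigwedge^0V=\mathbb Q$ and $[\mathbf b]^0_0=1$; $\bigwedge^mV=0$ for $m<0$. $\bigwedge^rV^*$ pairs with $\bigwedge^rV$ by $(\alpha_1\wedge\cdots\wedge\alpha_r)(v_1\wedge\cdots\wedge v_r)=\det(\alpha_i(v_j))$. For $\alpha\in\bigwedge^kV^*$ and $u\in\bigwedge^rV$ the contraction $\alpha\lrcorner u\in\bigwedge^{r-k}V$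 is determined by $\eta(\alpha\lrcorner u)=(\alpha\wedge\eta)(u)$ for all $\eta\in\bigwedge^{r-k}V^*$ (and $\alpha\lrcorner u=0$ if $k>r$). $\mathbf z_k=(z_1,\dots,z_k)$, $\mathbf w_k=(w_1,\dots,w_k)$ are formal variables, and $\mathbf z_k^{-1},\mathbf w_k^{-1}$ the tuples of inverses. Schubert derivations. $\sigma_+(z),\overline\sigma_+(z):\bigwedge V\to\bigwedge V[[z]]$ and $\sigma_-(z),\overline\sigma_-(z):\bigwedge V\to\bigwedge V[z^{-1}]$ are the unique $\mathbb Q$-linear maps $D(z)$ with $D(z)1=1$ and $D(z)(u\wedge v)=D(z)u\wedge D(z)v$, such that for all $j\ge 0$: $\sigma_+(z)b_j=\sum_{i\ge0}b_{j+i}z^i$, $\overline\sigma_+(z)b_j=b_j-b_{j+1}z$, $\sigma_-(z)b_j=\sum_{i\ge0}b_{j-i}z^{-i}$, $\overline\sigma_-(z)b_j=b_j-b_{j-1}z^{-1}$. Put $\sigma_\pm(\mathbf z_k)=\sigma_\pm(z_1)\cdots\sigma_\pm(z_k)$, $\overline\sigma_\pm(\mathbf z_k)=\overline\sigma_\pm(z_1)\cdots\overline\sigma_\pm(z_k)$, all maps being extended linearly over power series/Laurent coefficients in other formal variables. The ring $B_m$. For $m\ge0$, $B_m=\mathbb Q[e_1,\dots,e_m]$, $E_m(z)=1-e_1z+\cdots+(-1)^me_mz^m$, and $H_m=(h_j)_{j\in\mathbb Z}$ is defined by $\sum_jh_jz^j=1/E_m(z)$ (so $h_0=1$, $h_j=0$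 for $j<0$). $\bigwedge^mV$ is a $B_m$-module where $e_i$ acts as $\overline\sigma_i$, with $\overline\sigma_+(z)=\sum_i(-1)^i\overline\sigma_iz^i$; thus $\overline\sigma_+(z)u=E_m(z)u$ and $\sigma_+(z)u=E_m(z)^{-1}u$ for $u\in\bigwedge^mV$. For a sequence $A=(a_j)_{j\in\mathbb Z}$ and $\lambda\in\mathcal P_r$, $\Delta_\lambda(A)=\det(a_{\lambda_j-j+i})_{1\le i,j\le r}$. The $\Delta_\lambda(H_r)$, $\lambda\in\mathcal P_r$, form a $\mathbb Q$-basis of $B_r$, and $\bigwedge^rV$ is free of rank one over $B_r$ with $\Delta_\lambda(H_r)[\mathbf b]^r_0=[\mathbf b]^r_\lambda$. Vertex operators. For $\lambda\in\mathcal P_r$, $$\Gamma(\mathbf z_k)[\mathbf b]^r_\lambda=\sigma_+(\mathbf z_k)\overline\sigma_-(\mathbf z_k)[\mathbf b]^{r+k}_\lambda,\qquad \Gamma^*(\mathbf w_k)[\mathbf b]^r_\lambda=\big(\overline\sigma_+(\mathbf w_k)\Delta_\lambda(\sigma_-(\mathbf w_k)H_{r-k})\big)[\mathbf b]^{r-k}_0 .$$ Here $\sigma_-(\mathbf w_k)H_{r-k}$ is the sequence obtained from $H_{r-k}$ (in $B_{r-k}$) by applying successively the substitutions $\sigma_-(w)h_j=\sum_{i\ge0}h_{j-i}w^{-i}$ for $w=w_1,\dots,w_k$; $\Delta_\lambda$ is the $r\times r$ determinant; and $\overline\sigma_+(\mathbf w_k)$ acts on $B_{r-k}$ as multiplication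 by $\prod_{j=1}^kE_{r-k}(w_j)$. If $k>r$, $\Gamma^*(\mathbf w_k)[\mathbf b]^r_\lambda=0$. Schur polynomials: for $\mu\in\mathcal P_k$, $s_\mu(\mathbf x_k)=\det\big(x_j^{\mu_{k-i+1}+i-1}\big)_{1\le i,j\le k}\big/\prod_{i<j}(x_j-x_i)$. The generating function $\mathcal E(\mathbf z_k,\mathbf w_k^{-1})=\sum_{\mu,\nu\in\mathcal P_k}([\mathbf b]^k_\mu\otimes[\boldsymbol\beta]^k_\nu)\,s_\mu(\mathbf z_k)s_\nu(\mathbf w_k^{-1})$ of the basis of $gl(\bigwedge^kV)=\bigwedge^kV\otimes\bigwedge^kV^*$ acts on $B_r$ by $$\big(\mathcal E(\mathbf z_k,\mathbf w_k^{-1})\Delta_\lambda(H_r)\big)[\mathbf b]^r_0=\sum_{\mu,\nu\in\mathcal P_k}s_\mu(\mathbf z_k)s_\nu(\mathbf w_k^{-1})\,[\mathbf b]^k_\mu\wedge\big([\boldsymbol\beta]^k_\nu\lrcorner[\mathbf b]^r_\lambda\big).$$ *)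

theory Defs
  imports
    "HOL-Library.Poly_Mapping"
    "HOL-Computational_Algebra.Formal_Power_Series"
    "Jordan_Normal_Form.Determinant"
begin

section \<open>The exterior algebra on countably many generators\<close>

text \<open>The vector space \<open>\<And>V\<close>, for V with basis \<open>b 0, b 1, \<dots>\<close>, has a basis indexed by the finite
  sets of naturals: the set \<open>{s\<^sub>1 > \<dots> > s\<^sub>r}\<close> stands for \<open>b s\<^sub>1 \<and> \<dots> \<and> b s\<^sub>r\<close>, factors in
  decreasing order (cf. \<open>egen_set\<close> below).  The type \<open>ext\<close> consists of the coefficient
  functions with respect to this basis, and the wedge product is its ring multiplication.
  The restricted dual of V has a basis \<open>\<beta> 0, \<beta> 1, \<dots>\<close> of the same kind, so
  the same type also serves for its exterior algebra.\<close>

typedef ext = "{f :: nat set \<Rightarrow> rat. finite {S. f S \<noteq> 0} \<and> (\<forall>S. f S \<noteq> 0 \<longrightarrow> finite S)}"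
  morphisms ecoeff Abs_ext
  by (rule exI[of _ "\<lambda>_. 0"]) simp

setup_lifting type_definition_ext

lemma finite_ecoeff: "finite {S. ecoeff u S \<noteq> 0}"
  using ecoeff[of u] by simp

lemma ecoeff_infinite: "infinite S \<Longrightarrow> ecoeff u S = 0"
  using ecoeff[of u] by auto

lemma ext_eqI: "(\<And>S. finite S \<Longrightarrow> ecoeff u S = ecoeff v S) \<Longrightarrow> u = v"
  by (metis (full_types) ecoeff_infinite ecoeff_inject ext)

text \<open>Sign of the shuffle sorting S followed by T (each decreasing) into decreasing order.\<close>

definition esgn :: "nat set \<Rightarrow> nat set \<Rightarrow> rat" where
  "esgn S T = (- 1) ^ card {(s, t). s \<in> S \<and> t \<in> T \<and> s < t}"

lemma finite_esgn_set: "finite S \<Longrightarrow> finite T \<Longrightarrow> finite {(s::nat, t::nat). s \<in> S \<and> t \<in> T \<and> s < t}"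
  by (rule finite_subset[of _ "S \<times> T"]) auto

lemma esgn_Un_left:
  assumes "finite S" "finite T" "finite W" "S \<inter> T = {}"
  shows "esgn (S \<union> T) W = esgn S W * esgn T W"
proof -
  have "{(s, t). s \<in> S \<union> T \<and> t \<in> W \<and> s < t} =
        {(s, t). s \<in> S \<and> t \<in> W \<and> s < t} \<union> {(s, t). s \<in> T \<and> t \<in> W \<and> s < t}" by auto
  moreover have "{(s, t). s \<in> S \<and> t \<in> W \<and> s < t} \<inter> {(s, t). s \<in> T \<and> t \<in> W \<and> s < t} = {}"
    using assms(4) by auto
  ultimately show ?thesis
    unfolding esgn_def using assms(1-3) by (simp add: card_Un_disjoint finite_esgn_set power_add)
qed

lemma esgn_Un_right:
  assumes "finite S" "finite T" "finite W" "S \<inter> T = {}"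
  shows "esgn W (S \<union> T) = esgn W S * esgn W T"
proof -
  have "{(s, t). s \<in> W \<and> t \<in> S \<union> T \<and> s < t} =
        {(s, t). s \<in> W \<and> t \<in> S \<and> s < t} \<union> {(s, t). s \<in> W \<and> t \<in> T \<and> s < t}" by auto
  moreover have "{(s, t). s \<in> W \<and> t \<in> S \<and> s < t} \<inter> {(s, t). s \<in> W \<and> t \<in> T \<and> s < t} = {}"
    using assms(4) by auto
  ultimately show ?thesis
    unfolding esgn_def using assms(1-3) by (simp add: card_Un_disjoint finite_esgn_set power_add)
qed

lemma esgn_empty [simp]: "esgn {} T = 1" "esgn S {} = 1"
  by (auto simp: esgn_def)

instantiation ext :: ring_1
begin

lift_definition zero_ext :: ext is "\<lambda>_. 0" by simp

lift_definition one_ext :: ext is "\<lambda>S. if S = {} then 1 else 0" by simp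

lift_definition uminus_ext :: "ext \<Rightarrow> ext" is "\<lambda>f S. - f S" by simp

lift_definition plus_ext :: "ext \<Rightarrow> ext \<Rightarrow> ext" is "\<lambda>f g S. f S + g S"
proof -
  fix f g :: "nat set \<Rightarrow> rat"
  assume *: "finite {S. f S \<noteq> 0} \<and> (\<forall>S. f S \<noteq> 0 \<longrightarrow> finite S)"
    "finite {S. g S \<noteq> 0} \<and> (\<forall>S. g S \<noteq> 0 \<longrightarrow> finite S)"
  have "finite {S. f S + g S \<noteq> 0}"
    by (rule finite_subset[of _ "{S. f S \<noteq> 0} \<union> {S. g S \<noteq> 0}"]) (use * in auto)
  moreover have "\<forall>S. f S + g S \<noteq> 0 \<longrightarrow> finite S"
    using * by (metis add.right_neutral)
  ultimately show "finite {S. f S + g S \<noteq> 0} \<and> (\<forall>S. f S + g S \<noteq> 0 \<longrightarrow> finite S)" by simp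
qed

definition minus_ext :: "ext \<Rightarrow> ext \<Rightarrow> ext" where "minus_ext u v = u + (- v)"

lift_definition times_ext :: "ext \<Rightarrow> ext \<Rightarrow> ext" is
  "\<lambda>f g U. \<Sum>S\<in>Pow U. esgn S (U - S) * f S * g (U - S)"
proof -
  fix f g :: "nat set \<Rightarrow> rat"
  assume *: "finite {S. f S \<noteq> 0} \<and> (\<forall>S. f S \<noteq> 0 \<longrightarrow> finite S)"
    "finite {S. g S \<noteq> 0} \<and> (\<forall>S. g S \<noteq> 0 \<longrightarrow> finite S)"
  let ?h = "\<lambda>U. \<Sum>S\<in>Pow U. esgn S (U - S) * f S * g (U - S)"
  have sub: "U \<in> (\<lambda>(S, T). S \<union> T) ` ({S. f S \<noteq> 0} \<times> {S. g S \<noteq> 0})" if h: "?h U \<noteq> 0" for U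
  proof -
    obtain S where "S \<subseteq> U" "f S \<noteq> 0" "g (U - S) \<noteq> 0"
      using sum.not_neutral_contains_not_neutral[OF h] by auto
    then show ?thesis by (intro image_eqI[of _ _ "(S, U - S)"]) auto
  qed
  have "finite {U. ?h U \<noteq> 0}"
    by (rule finite_subset[of _ "(\<lambda>(S, T). S \<union> T) ` ({S. f S \<noteq> 0} \<times> {S. g S \<noteq> 0})"])
       (use sub * in auto)
  moreover have "\<forall>U. ?h U \<noteq> 0 \<longrightarrow> finite U"
    using sub * by fastforce
  ultimately show "finite {U. ?h U \<noteq> 0} \<and> (\<forall>U. ?h U \<noteq> 0 \<longrightarrow> finite U)" by blast
qed

instance
proof
  fix a b c :: ext
  show "a + b + c = a + (b + c)" by transfer (simp add: add.assoc)
  show "a + b = b + a" by transfer (simp add: add.commute)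
  show "0 + a = a" by transfer simp
  show "- a + a = 0" by transfer simp
  show "a - b = a + - b" by (simp add: minus_ext_def)
  show "(a + b) * c = a * c + b * c"
    by transfer (simp add: algebra_simps sum.distrib)
  show "a * (b + c) = a * b + a * c"
    by transfer (simp add: algebra_simps sum.distrib)
  show "(0::ext) \<noteq> 1" by transfer (metis zero_neq_one)
  show "1 * a = a"
  proof (rule ext_eqI)
    fix U :: "nat set" assume U: "finite U"
    have "ecoeff (1 * a) U = (\<Sum>S\<in>Pow U. if S = {} then ecoeff a U else 0)"
      unfolding times_ext.rep_eq one_ext.rep_eq by (rule sum.cong) auto
    then show "ecoeff (1 * a) U = ecoeff a U" using U by simp
  qed
  show "a * 1 = a"
  proof (rule ext_eqI)
    fix U :: "nat set" assume U: "finite U"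
    have "ecoeff (a * 1) U = (\<Sum>S\<in>Pow U. if S = U then ecoeff a U else 0)"
      unfolding times_ext.rep_eq one_ext.rep_eq by (rule sum.cong) auto
    then show "ecoeff (a * 1) U = ecoeff a U" using U by simp
  qed
  show "a * b * c = a * (b * c)"
  proof (rule ext_eqI)
    fix U :: "nat set" assume U: "finite U"
    have fin: "finite A" if "A \<subseteq> U" for A using that U finite_subset by blast
    have "ecoeff (a * b * c) U = (\<Sum>A\<in>Pow U. \<Sum>S\<in>Pow A.
        esgn A (U - A) * (esgn S (A - S) * ecoeff a S * ecoeff b (A - S)) * ecoeff c (U - A))"
      unfolding times_ext.rep_eq by (simp add: sum_distrib_left sum_distrib_right)
    also have "\<dots> = (\<Sum>(A, S)\<in>(SIGMA A:Pow U. Pow A).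
        esgn A (U - A) * (esgn S (A - S) * ecoeff a S * ecoeff b (A - S)) * ecoeff c (U - A))"
      by (rule sum.Sigma) (use U fin in auto)
    also have "\<dots> = (\<Sum>(S, T)\<in>(SIGMA S:Pow U. Pow (U - S)).
        esgn S (U - S) * ecoeff a S * (esgn T (U - S - T) * ecoeff b T * ecoeff c (U - S - T)))"
    proof (rule sum.reindex_bij_witness[of _ "\<lambda>(S, T). (S \<union> T, S)" "\<lambda>(A, S). (S, A - S)"])
      fix p assume "p \<in> (SIGMA A:Pow U. Pow A)"
      then obtain A S where p: "p = (A, S)" "A \<subseteq> U" "S \<subseteq> A" by auto
      have 1: "esgn A (U - A) = esgn S (U - A) * esgn (A - S) (U - A)"
        using esgn_Un_left[of S "A - S" "U - A"] fin p U
        by (metis Diff_disjoint Diff_partition Diff_subset order_trans finite_Diff)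
      have 2: "esgn S (U - S) = esgn S (A - S) * esgn S (U - A)"
      proof -
        have "U - S = (A - S) \<union> (U - A)" using p by auto
        moreover have "(A - S) \<inter> (U - A) = {}" by auto
        ultimately show ?thesis
          using esgn_Un_right[of "A - S" "U - A" S] fin p U by (metis finite_Diff order_trans)
      qed
      have 3: "U - S - (A - S) = U - A" using p by auto
      show "(case (case p of (A, S) \<Rightarrow> (S, A - S)) of (S, T) \<Rightarrow>
          esgn S (U - S) * ecoeff a S * (esgn T (U - S - T) * ecoeff b T * ecoeff c (U - S - T))) =
        (case p of (A, S) \<Rightarrow>
          esgn A (U - A) * (esgn S (A - S) * ecoeff a S * ecoeff b (A - S)) * ecoeff c (U - A))"
        unfolding p by (simp add: 1 2 3)
    qed auto
    also have "\<dots> = (\<Sum>S\<in>Pow U. \<Sum>T\<in>Pow (U - S).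
        esgn S (U - S) * ecoeff a S * (esgn T (U - S - T) * ecoeff b T * ecoeff c (U - S - T)))"
      by (rule sum.Sigma[symmetric]) (use U fin in auto)
    also have "\<dots> = ecoeff (a * (b * c)) U"
      unfolding times_ext.rep_eq by (simp add: sum_distrib_left sum_distrib_right)
    finally show "ecoeff (a * b * c) U = ecoeff (a * (b * c)) U" .
  qed
qed

end

lift_definition scaleQ :: "rat \<Rightarrow> ext \<Rightarrow> ext"  (infixr \<open>*\<^sub>Q\<close> 75) is "\<lambda>c f S. c * f S"
proof -
  fix c :: rat and f :: "nat set \<Rightarrow> rat"
  assume "finite {S. f S \<noteq> 0} \<and> (\<forall>S. f S \<noteq> 0 \<longrightarrow> finite S)"
  moreover have "{S. c * f S \<noteq> 0} \<subseteq> {S. f S \<noteq> 0}" by auto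
  ultimately show "finite {S. c * f S \<noteq> 0} \<and> (\<forall>S. c * f S \<noteq> 0 \<longrightarrow> finite S)"
    by (auto intro: finite_subset)
qed

lift_definition egen :: "nat \<Rightarrow> ext" is "\<lambda>i S. if S = {i} then 1 else 0" by auto

definition desc_list :: "nat set \<Rightarrow> nat list" where
  "desc_list S = rev (sorted_list_of_set S)"

definition egen_set :: "nat set \<Rightarrow> ext" where
  "egen_set S = prod_list (map egen (desc_list S))"

lemma ecoeff_simps [simp]:
  "ecoeff 0 S = 0" "ecoeff (u + v) S = ecoeff u S + ecoeff v S" "ecoeff (- u) S = - ecoeff u S"
  "ecoeff (u - v) S = ecoeff u S - ecoeff v S" "ecoeff (c *\<^sub>Q u) S = c * ecoeff u S"
  "ecoeff 1 S = (if S = {} then 1 else 0)"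
  by (simp_all add: zero_ext.rep_eq plus_ext.rep_eq uminus_ext.rep_eq scaleQ.rep_eq
      one_ext.rep_eq diff_conv_add_uminus[of u v] del: add_uminus_conv_diff)

lemma ecoeff_sum: "ecoeff (sum f A) S = (\<Sum>a\<in>A. ecoeff (f a) S)"
  by (induction A rule: infinite_finite_induct) auto

lemma scaleQ_mult_left [simp]: "(c *\<^sub>Q u) * v = c *\<^sub>Q (u * v)"
  by (rule ext_eqI) (simp add: times_ext.rep_eq sum_distrib_left mult_ac)

lemma scaleQ_mult_right [simp]: "u * (c *\<^sub>Q v) = c *\<^sub>Q (u * v)"
  by (rule ext_eqI) (simp add: times_ext.rep_eq sum_distrib_left mult_ac)

lemma scaleQ_scaleQ [simp]: "a *\<^sub>Q b *\<^sub>Q u = (a * b) *\<^sub>Q u"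
  by (rule ext_eqI) simp

lemma scaleQ_simps [simp]: "1 *\<^sub>Q u = u" "0 *\<^sub>Q u = 0" "(-1) *\<^sub>Q u = - u"
  by (rule ext_eqI, simp)+

lemma scaleQ_add_left: "(a + b) *\<^sub>Q u = a *\<^sub>Q u + b *\<^sub>Q u"
  by (rule ext_eqI) (simp add: algebra_simps)

lemma scaleQ_sum_right: "c *\<^sub>Q sum f A = (\<Sum>a\<in>A. c *\<^sub>Q f a)"
  by (rule ext_eqI) (simp add: ecoeff_sum sum_distrib_left)

lemma desc_list_insert_max:
  assumes "finite A" "\<forall>a\<in>A. a < m"
  shows "desc_list (insert m A) = m # desc_list A"
proof -
  have "sorted_list_of_set (insert m A) = sorted_list_of_set A @ [m]"
    by (rule sorted_distinct_set_unique)
       (use assms in \<open>auto simp: sorted_append less_imp_le simp del: sorted_list_of_set_insert_remove\<close>)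
  then show ?thesis by (simp add: desc_list_def)
qed

lemma desc_list_empty [simp]: "desc_list {} = []"
  by (simp add: desc_list_def)

lemma desc_list_singleton [simp]: "desc_list {i} = [i]"
  by (simp add: desc_list_def)

lemma desc_list_set [simp]: "finite S \<Longrightarrow> set (desc_list S) = S"
  and desc_list_distinct [simp]: "distinct (desc_list S)"
  and desc_list_length [simp]: "length (desc_list S) = card S"
  by (auto simp: desc_list_def)

lemma ecoeff_egen: "ecoeff (egen i) S = (if S = {i} then 1 else 0)"
  by (simp add: egen.rep_eq)

lemma ecoeff_egen_times:
  assumes "finite U"
  shows "ecoeff (egen i * u) U = (if i \<in> U then esgn {i} (U - {i}) * ecoeff u (U - {i}) else 0)"
proof -
  have "ecoeff (egen i * u) U =
      (\<Sum>S\<in>Pow U. if S = {i} then esgn {i} (U - {i}) * ecoeff u (U - {i}) else 0)"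
    unfolding times_ext.rep_eq ecoeff_egen by (rule sum.cong) auto
  then show ?thesis using assms by (simp add: sum.delta)
qed

text \<open>The elements \<open>egen_set S\<close> form the basis underlying the representation.\<close>

lemma ecoeff_egen_set:
  assumes "finite S"
  shows "ecoeff (egen_set S) T = (if T = S then 1 else 0)"
proof (cases "finite T")
  case False
  then show ?thesis using assms ecoeff_infinite by auto
next
  case True
  show ?thesis using assms True
  proof (induction S arbitrary: T rule: finite_linorder_max_induct)
    case empty
    then show ?case by (simp add: egen_set_def)
  next
    case (insert m A)
    have "egen_set (insert m A) = egen m * egen_set A"
      using insert.hyps by (simp add: egen_set_def desc_list_insert_max)
    moreover have "esgn {m} A = 1"
      unfolding esgn_def using insert.hyps
      by (metis (no_types, lifting) Collect_empty_eq card.empty case_prodE order_less_asym power_0 singletonD)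
    moreover have "m \<notin> A" using insert.hyps by blast
    ultimately show ?case
      using insert by (auto simp: ecoeff_egen_times)
  qed
qed

lemma ext_expansion:
  assumes "finite K" "{S. ecoeff u S \<noteq> 0} \<subseteq> K" "\<forall>S\<in>K. finite S"
  shows "u = (\<Sum>S\<in>K. ecoeff u S *\<^sub>Q egen_set S)"
proof (rule ext_eqI)
  fix T :: "nat set" assume "finite T"
  have "ecoeff (\<Sum>S\<in>K. ecoeff u S *\<^sub>Q egen_set S) T = (\<Sum>S\<in>K. if T = S then ecoeff u S else 0)"
    unfolding ecoeff_sum using assms(3) by (intro sum.cong) (auto simp: ecoeff_egen_set)
  also have "\<dots> = ecoeff u T" using assms by (auto simp: sum.delta')
  finally show "ecoeff u T = ecoeff (\<Sum>S\<in>K. ecoeff u S *\<^sub>Q egen_set S) T" by simp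
qed

text \<open>Products of anticommuting elements of square zero multiply like the basis of \<open>\<And>V\<close>.\<close>

lemma anticomm_insert:
  fixes f :: "nat \<Rightarrow> 'a::ring_1"
  assumes f: "\<And>i j. f i * f j = - (f j * f i)" "\<And>i. f i * f i = 0" and "finite T"
  shows "f i * prod_list (map f (desc_list T)) =
    (if i \<in> T then 0 else (- 1) ^ card {t\<in>T. i < t} * prod_list (map f (desc_list (insert i T))))"
  using \<open>finite T\<close>
proof (induction T rule: finite_linorder_max_induct)
  case empty
  then show ?case by simp
next
  case (insert m A)
  have mA: "m \<notin> A" using insert.hyps by blast
  have D: "desc_list (insert m A) = m # desc_list A"
    using insert.hyps by (simp add: desc_list_insert_max)
  consider "i = m" | "i > m" | "i < m" by linarith
  then show ?case
  proof cases
    case 1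
    then show ?thesis by (simp add: D f(2) mult.assoc[symmetric])
  next
    case 2
    have "{t \<in> insert m A. i < t} = {}" using 2 insert.hyps by auto
    then have c: "card {t \<in> insert m A. i < t} = 0" by (simp only: card.empty)
    have "i \<notin> insert m A" using 2 insert.hyps by auto
    moreover have "desc_list (insert i (insert m A)) = i # desc_list (insert m A)"
      by (rule desc_list_insert_max) (use 2 insert.hyps in auto)
    ultimately show ?thesis unfolding c by simp
  next
    case 3
    have "f i * prod_list (map f (desc_list (insert m A))) =
        - (f m * (f i * prod_list (map f (desc_list A))))"
      unfolding D by (simp add: mult.assoc[symmetric] f(1)[of i m])
    also have "\<dots> = (if i \<in> A then 0 else
        - (f m * ((- 1) ^ card {t\<in>A. i < t} * prod_list (map f (desc_list (insert i A))))))"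
      using insert.IH by auto
    also have "\<dots> = (if i \<in> A then 0 else
        - ((- 1) ^ card {t\<in>A. i < t} * (f m * prod_list (map f (desc_list (insert i A))))))"
      by (cases "even (card {t\<in>A. i < t})") auto
    also have "\<dots> = (if i \<in> insert m A then 0 else
        (- 1) ^ card {t\<in>insert m A. i < t} * prod_list (map f (desc_list (insert i (insert m A)))))"
    proof (cases "i \<in> A")
      case False
      have "desc_list (insert m (insert i A)) = m # desc_list (insert i A)"
        by (rule desc_list_insert_max) (use 3 insert.hyps in auto)
      moreover have "{t\<in>insert m A. i < t} = insert m {t\<in>A. i < t}" using 3 by auto
      moreover have "card (insert m {t\<in>A. i < t}) = Suc (card {t\<in>A. i < t})"
        using insert.hyps mA by simp
      ultimately show ?thesis using False 3 by (simp add: insert_commute)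
    qed auto
    finally show ?thesis .
  qed
qed

lemma anticomm_Un:
  fixes f :: "nat \<Rightarrow> 'a::ring_1"
  assumes f: "\<And>i j. f i * f j = - (f j * f i)" "\<And>i. f i * f i = 0"
    and "finite S" and T: "finite T"
  shows "prod_list (map f (desc_list S)) * prod_list (map f (desc_list T)) =
    (if S \<inter> T = {} then (- 1) ^ card {(s, t). s \<in> S \<and> t \<in> T \<and> s < t} *
       prod_list (map f (desc_list (S \<union> T))) else 0)"
  using \<open>finite S\<close>
proof (induction S rule: finite_linorder_max_induct)
  case empty
  then show ?case by simp
next
  case (insert m A)
  let ?P = "\<lambda>S. prod_list (map f (desc_list S))"
  let ?n = "\<lambda>S. card {(s, t). s \<in> S \<and> t \<in> T \<and> s < t}"
  have mA: "m \<notin> A" using insert.hyps by blast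
  have D: "desc_list (insert m A) = m # desc_list A"
    using insert.hyps by (simp add: desc_list_insert_max)
  have comm: "f m * ((- 1) ^ n * x) = (- 1) ^ n * (f m * x)" for n x
    by (cases "even n") auto
  have "?P (insert m A) * ?P T = f m * (?P A * ?P T)"
    by (simp add: D mult.assoc)
  also have "\<dots> = (if A \<inter> T = {} then (- 1) ^ ?n A * (f m * ?P (A \<union> T)) else 0)"
    using insert.IH comm by simp
  also have "\<dots> = (if A \<inter> T = {} \<and> m \<notin> T then
      (- 1) ^ ?n A * ((- 1) ^ card {t\<in>A \<union> T. m < t} * ?P (insert m (A \<union> T))) else 0)"
    using anticomm_insert[of f "A \<union> T" m, OF f] insert.hyps T mA by auto
  also have "{t\<in>A \<union> T. m < t} = {t\<in>T. m < t}" using insert.hyps by auto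
  also have "(if A \<inter> T = {} \<and> m \<notin> T then
      (- 1) ^ ?n A * ((- 1) ^ card {t\<in>T. m < t} * ?P (insert m (A \<union> T))) else 0) =
    (if insert m A \<inter> T = {} then (- 1) ^ ?n (insert m A) * ?P (insert m A \<union> T) else 0)"
  proof -
    have "{(s, t). s \<in> insert m A \<and> t \<in> T \<and> s < t} =
        {(s, t). s \<in> A \<and> t \<in> T \<and> s < t} \<union> Pair m ` {t\<in>T. m < t}" by auto
    then have "?n (insert m A) = ?n A + card (Pair m ` {t\<in>T. m < t})"
      using mA insert.hyps T by (simp, subst card_Un_disjoint) (auto intro: finite_esgn_set)
    also have "card (Pair m ` {t\<in>T. m < t}) = card {t\<in>T. m < t}"
      by (rule card_image) (auto simp: inj_on_def)
    finally show ?thesis by (simp add: power_add mult.assoc)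
  qed
  finally show ?case .
qed

lemma egen_times_egen: "egen i * egen j = - (egen j * egen i)" "egen i * egen i = 0"
proof -
  have *: "ecoeff (egen i * egen j) U = (if i \<noteq> j \<and> U = {i, j} then esgn {i} {j} else 0)"
    if "finite U" for U i j
    using that by (auto simp: ecoeff_egen_times ecoeff_egen insert_Diff_if)
  have s: "esgn {i} {j} = - esgn {j} {i}" if "i \<noteq> j" for i j
  proof -
    have "{(s, t). s \<in> {i} \<and> t \<in> {j} \<and> s < t} = (if i < j then {(i, j)} else {})" for i j :: nat
      by auto
    then show ?thesis using that unfolding esgn_def by auto
  qed
  show "egen i * egen j = - (egen j * egen i)"
    by (rule ext_eqI) (use s[of i j] in \<open>auto simp: * insert_commute\<close>)
  show "egen i * egen i = 0"
    by (rule ext_eqI) (simp add: *)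
qed

lemma egen_set_times:
  assumes "finite S" "finite T"
  shows "egen_set S * egen_set T = (if S \<inter> T = {} then esgn S T *\<^sub>Q egen_set (S \<union> T) else 0)"
proof -
  have "(- 1) ^ n * u = ((- 1) ^ n) *\<^sub>Q u" for n and u :: ext
    by (cases "even n") auto
  then show ?thesis
    unfolding egen_set_def anticomm_Un[of egen, OF egen_times_egen assms] esgn_def by simp
qed

abbreviation bV :: "nat \<Rightarrow> ext" where "bV \<equiv> egen"

abbreviation betaV :: "nat \<Rightarrow> ext" where "betaV \<equiv> egen"

text \<open>The convention \<open>b i = 0\<close> for \<open>i < 0\<close>.\<close>

definition bZ :: "int \<Rightarrow> ext" where
  "bZ i = (if i < 0 then 0 else bV (nat i))"

subsection \<open>Duality and contraction\<close>

definition beta_b :: "nat \<Rightarrow> nat \<Rightarrow> rat" where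
  "beta_b i j = (if i = j then 1 else 0)"

text \<open>The pairing \<open>(\<alpha>\<^sub>1 \<and> \<dots> \<and> \<alpha>\<^sub>r)(v\<^sub>1 \<and> \<dots> \<and> v\<^sub>r) = det (\<alpha>\<^sub>i (v\<^sub>j))\<close> is determined by its values on
  the products of basis vectors; components of different degrees pair to zero.\<close>

definition epair_basis :: "nat list \<Rightarrow> nat list \<Rightarrow> rat" where
  "epair_basis is js = (if length is = length js
     then det (mat (length is) (length is) (\<lambda>(p, q). beta_b (is ! p) (js ! q))) else 0)"

definition epair :: "ext \<Rightarrow> ext \<Rightarrow> rat" where
  "epair \<alpha> u = (\<Sum>S | ecoeff \<alpha> S \<noteq> 0. \<Sum>T | ecoeff u T \<noteq> 0.
     ecoeff \<alpha> S * ecoeff u T * epair_basis (desc_list S) (desc_list T))"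

definition ext_deg :: "nat \<Rightarrow> ext set" where
  "ext_deg r = {u. \<forall>S. ecoeff u S \<noteq> 0 \<longrightarrow> card S = r}"

definition contract :: "nat \<Rightarrow> nat \<Rightarrow> ext \<Rightarrow> ext \<Rightarrow> ext" where
  "contract k r \<alpha> u = (if k > r then 0 else
     (THE x. x \<in> ext_deg (r - k) \<and> (\<forall>\<eta>\<in>ext_deg (r - k). epair \<eta> x = epair (\<alpha> * \<eta>) u)))"

text \<open>Existence and uniqueness behind the description of \<open>contract\<close>.\<close>

lemma epair_basis_desc_list:
  assumes "finite S" "finite T"
  shows "epair_basis (desc_list S) (desc_list T) = (if S = T then 1 else 0)"
proof (cases "card S = card T")
  case False
  then show ?thesis by (auto simp: epair_basis_def)
next
  case True
  let ?n = "card S"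
  let ?A = "mat ?n ?n (\<lambda>(p, q). beta_b (desc_list S ! p) (desc_list T ! q))"
  have eq: "epair_basis (desc_list S) (desc_list T) = det ?A"
    using True by (simp add: epair_basis_def)
  show ?thesis
  proof (cases "S = T")
    case True
    have "?A = 1\<^sub>m ?n"
      by (rule eq_matI) (auto simp: True beta_b_def nth_eq_iff_index_eq)
    then show ?thesis using eq True by simp
  next
    case False
    then have "\<not> S \<subseteq> T" using card_subset_eq[of T S] assms True by auto
    then obtain s where s: "s \<in> S" "s \<notin> T" by auto
    then obtain p where p: "p < ?n" "desc_list S ! p = s"
      using assms by (metis desc_list_length desc_list_set in_set_conv_nth)
    have "(\<Prod>i=0..<?n. ?A $$ (i, \<pi> i)) = 0" if "\<pi> permutes {0..<?n}" for \<pi>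
    proof (rule prod_zero)
      have "\<pi> p < ?n" using that p by (metis atLeastLessThan_iff permutes_in_image zero_le)
      moreover from this have "desc_list T ! \<pi> p \<in> T"
        using assms True by (metis desc_list_length desc_list_set nth_mem)
      ultimately show "\<exists>i\<in>{0..<?n}. ?A $$ (i, \<pi> i) = 0"
        using p s by (intro bexI[of _ p]) (auto simp: beta_b_def)
    qed simp
    then have "det ?A = 0"
      by (simp add: Determinant.det_def del: prod_zero_iff index_mat)
    then show ?thesis using eq False by simp
  qed
qed

lemma epair_eq:
  assumes "finite K" "{S. ecoeff \<alpha> S \<noteq> 0} \<inter> {S. ecoeff u S \<noteq> 0} \<subseteq> K"
  shows "epair \<alpha> u = (\<Sum>S\<in>K. ecoeff \<alpha> S * ecoeff u S)"
proof -
  have "epair \<alpha> u = (\<Sum>S | ecoeff \<alpha> S \<noteq> 0. \<Sum>T | ecoeff u T \<noteq> 0.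
      if S = T then ecoeff \<alpha> S * ecoeff u S else 0)"
    unfolding epair_def
  proof (intro sum.cong refl)
    fix S T assume "S \<in> {S. ecoeff \<alpha> S \<noteq> 0}" "T \<in> {T. ecoeff u T \<noteq> 0}"
    then have "finite S" "finite T" using ecoeff_infinite by blast+
    then show "ecoeff \<alpha> S * ecoeff u T * epair_basis (desc_list S) (desc_list T) =
        (if S = T then ecoeff \<alpha> S * ecoeff u S else 0)"
      by (simp add: epair_basis_desc_list)
  qed
  also have "\<dots> = (\<Sum>S | ecoeff \<alpha> S \<noteq> 0. ecoeff \<alpha> S * ecoeff u S)"
    by (intro sum.cong refl) (simp add: sum.delta' finite_ecoeff)
  also have "\<dots> = (\<Sum>S\<in>{S. ecoeff \<alpha> S \<noteq> 0} \<union> K. ecoeff \<alpha> S * ecoeff u S)"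
    by (rule sum.mono_neutral_left) (use assms in \<open>auto simp: finite_ecoeff\<close>)
  also have "\<dots> = (\<Sum>S\<in>K. ecoeff \<alpha> S * ecoeff u S)"
    by (rule sum.mono_neutral_right) (use assms in \<open>auto simp: finite_ecoeff\<close>)
  finally show ?thesis .
qed

lemma epair_eq_right: "epair \<alpha> u = (\<Sum>S | ecoeff u S \<noteq> 0. ecoeff \<alpha> S * ecoeff u S)"
  by (rule epair_eq) (auto simp: finite_ecoeff)

lemma epair_linear_left:
  "epair (\<Sum>a\<in>A. c a *\<^sub>Q f a) u = (\<Sum>a\<in>A. c a * epair (f a) u)"
proof -
  have "epair (\<Sum>a\<in>A. c a *\<^sub>Q f a) u =
      (\<Sum>S | ecoeff u S \<noteq> 0. \<Sum>a\<in>A. c a * ecoeff (f a) S * ecoeff u S)"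
    unfolding epair_eq_right by (simp add: ecoeff_sum sum_distrib_right)
  also have "\<dots> = (\<Sum>a\<in>A. \<Sum>S | ecoeff u S \<noteq> 0. c a * ecoeff (f a) S * ecoeff u S)"
    by (rule sum.swap)
  also have "\<dots> = (\<Sum>a\<in>A. c a * epair (f a) u)"
    unfolding epair_eq_right by (simp add: sum_distrib_left mult.assoc)
  finally show ?thesis .
qed

lemma epair_egen_set:
  assumes "finite S"
  shows "epair (egen_set S) u = ecoeff u S"
  by (subst epair_eq[of "{S}"]) (use assms in \<open>auto simp: ecoeff_egen_set split: if_splits\<close>)

lemma egen_set_in_ext_deg: "finite S \<Longrightarrow> egen_set S \<in> ext_deg (card S)"
  by (auto simp: ext_deg_def ecoeff_egen_set split: if_splits)

lemma contract_ex1: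
  "\<exists>!x. x \<in> ext_deg m \<and> (\<forall>\<eta>\<in>ext_deg m. epair \<eta> x = epair (\<alpha> * \<eta>) u)"
proof (rule ex_ex1I)
  define B where "B = \<Union> {S. ecoeff u S \<noteq> 0}"
  have B: "finite B"
    unfolding B_def using finite_ecoeff[of u] ecoeff_infinite by blast
  define K where "K = {T. T \<subseteq> B \<and> card T = m}"
  have K: "finite K" "\<And>T. T \<in> K \<Longrightarrow> finite T"
    unfolding K_def using B finite_subset by auto
  define x where "x = (\<Sum>T\<in>K. epair (\<alpha> * egen_set T) u *\<^sub>Q egen_set T)"
  have x: "ecoeff x T = (if T \<in> K then epair (\<alpha> * egen_set T) u else 0)" for T
  proof -
    have "ecoeff x T = (\<Sum>T'\<in>K. if T' = T then epair (\<alpha> * egen_set T') u else 0)"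
      unfolding x_def ecoeff_sum using K by (intro sum.cong) (auto simp: ecoeff_egen_set)
    then show ?thesis using K by (simp add: sum.delta)
  qed
  have "x \<in> ext_deg m"
    by (auto simp: ext_deg_def x K_def)
  moreover have "epair \<eta> x = epair (\<alpha> * \<eta>) u" if \<eta>: "\<eta> \<in> ext_deg m" for \<eta>
  proof -
    let ?L = "{T. ecoeff \<eta> T \<noteq> 0}"
    have L: "finite ?L" "\<forall>T\<in>?L. finite T" using finite_ecoeff ecoeff_infinite by auto
    have out: "epair (\<alpha> * egen_set T) u = 0" if "finite T" "\<not> T \<subseteq> B" for T
    proof -
      have "ecoeff (\<alpha> * egen_set T) U = 0" if U: "ecoeff u U \<noteq> 0" for U
      proof -
        have "U \<subseteq> B" using U by (auto simp: B_def)
        then have "ecoeff (egen_set T) (U - S) = 0" for S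
          using \<open>\<not> T \<subseteq> B\<close> by (auto simp: ecoeff_egen_set \<open>finite T\<close>)
        then show ?thesis by (simp add: times_ext.rep_eq)
      qed
      then show ?thesis unfolding epair_eq_right by simp
    qed
    have "\<alpha> * \<eta> = (\<Sum>T\<in>?L. ecoeff \<eta> T *\<^sub>Q (\<alpha> * egen_set T))"
      by (subst ext_expansion[OF L(1) subset_refl L(2)]) (simp add: sum_distrib_left)
    then have "epair (\<alpha> * \<eta>) u = (\<Sum>T\<in>?L. ecoeff \<eta> T * epair (\<alpha> * egen_set T) u)"
      by (simp only: epair_linear_left)
    also have "\<dots> = (\<Sum>T\<in>?L. ecoeff \<eta> T * ecoeff x T)"
    proof (intro sum.cong refl)
      fix T assume T: "T \<in> ?L"
      then have "card T = m" using \<eta> by (auto simp: ext_deg_def)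
      then show "ecoeff \<eta> T * epair (\<alpha> * egen_set T) u = ecoeff \<eta> T * ecoeff x T"
        using out[of T] T L by (auto simp: x K_def)
    qed
    also have "\<dots> = epair \<eta> x"
      by (rule epair_eq[symmetric]) (use L in auto)
    finally show ?thesis by simp
  qed
  ultimately show "\<exists>x. x \<in> ext_deg m \<and> (\<forall>\<eta>\<in>ext_deg m. epair \<eta> x = epair (\<alpha> * \<eta>) u)" by blast
next
  fix x y
  assume x: "x \<in> ext_deg m \<and> (\<forall>\<eta>\<in>ext_deg m. epair \<eta> x = epair (\<alpha> * \<eta>) u)"
    and y: "y \<in> ext_deg m \<and> (\<forall>\<eta>\<in>ext_deg m. epair \<eta> y = epair (\<alpha> * \<eta>) u)"
  show "x = y"
  proof (rule ext_eqI)
    fix S :: "nat set" assume S: "finite S"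
    show "ecoeff x S = ecoeff y S"
    proof (cases "card S = m")
      case True
      then have "egen_set S \<in> ext_deg m" using egen_set_in_ext_deg[OF S] by simp
      then show ?thesis using x y epair_egen_set[OF S] by metis
    next
      case False
      then have "ecoeff x S = 0" "ecoeff y S = 0"
        using x y unfolding ext_deg_def by blast+
      then show ?thesis by simp
    qed
  qed
qed

subsection \<open>Schubert derivations\<close>

text \<open>The multiplicative extension of \<open>b j \<mapsto> d j\<close> to a linear map from \<open>\<And>V\<close> to \<open>\<And>V[[t]]\<close>.\<close>

definition mult_ext :: "(nat \<Rightarrow> ext fps) \<Rightarrow> ext \<Rightarrow> ext fps" where
  "mult_ext d u = (\<Sum>S | ecoeff u S \<noteq> 0.
     fps_const (ecoeff u S *\<^sub>Q 1) * prod_list (map d (desc_list S)))"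

text \<open>The power series variable is z for the first two maps and \<open>z\<^sup>-\<^sup>1\<close> for the last one.\<close>

definition sigma_plus :: "ext \<Rightarrow> ext fps" where
  "sigma_plus = mult_ext (\<lambda>j. Abs_fps (\<lambda>i. bZ (int j + int i)))"

definition sigma_bar_plus :: "ext \<Rightarrow> ext fps" where
  "sigma_bar_plus = mult_ext (\<lambda>j. fps_const (bZ (int j)) - fps_const (bZ (int j + 1)) * fps_X)"

definition sigma_bar_minus :: "ext \<Rightarrow> ext fps" where
  "sigma_bar_minus = mult_ext (\<lambda>j. fps_const (bZ (int j)) - fps_const (bZ (int j - 1)) * fps_X)"

text \<open>These maps are multiplicative, as required; with the value 1 at 1 and the values on the
  \<open>b j\<close> this determines them as linear maps.\<close>

lemma mult_ext_superset:
  assumes "finite K" "{S. ecoeff u S \<noteq> 0} \<subseteq> K"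
  shows "mult_ext d u = (\<Sum>S\<in>K. fps_const (ecoeff u S *\<^sub>Q 1) * prod_list (map d (desc_list S)))"
  unfolding mult_ext_def by (rule sum.mono_neutral_left) (use assms in auto)

lemma mult_ext_add: "mult_ext d (u + v) = mult_ext d u + mult_ext d v"
proof -
  let ?K = "{S. ecoeff u S \<noteq> 0} \<union> {S. ecoeff v S \<noteq> 0}"
  have K: "finite ?K" by (simp add: finite_ecoeff)
  show ?thesis
    by (subst (1 2 3) mult_ext_superset[OF K])
       (auto simp: sum.distrib[symmetric] scaleQ_add_left fps_const_add[symmetric] algebra_simps
             simp del: fps_const_add)
qed

lemma mult_ext_scaleQ: "mult_ext d (c *\<^sub>Q u) = fps_const (c *\<^sub>Q 1) * mult_ext d u"
proof -
  have K: "finite {S. ecoeff u S \<noteq> 0}" by (simp add: finite_ecoeff)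
  show ?thesis
    by (subst (1 2) mult_ext_superset[OF K])
       (auto simp: sum_distrib_left mult.assoc[symmetric] mult.commute[of c])
qed

lemma mult_ext_0 [simp]: "mult_ext d 0 = 0"
  by (simp add: mult_ext_def)

lemma mult_ext_sum: "mult_ext d (sum f A) = (\<Sum>a\<in>A. mult_ext d (f a))"
  by (induction A rule: infinite_finite_induct) (auto simp: mult_ext_add)

lemma mult_ext_egen_set:
  assumes "finite S"
  shows "mult_ext d (egen_set S) = prod_list (map d (desc_list S))"
  by (subst mult_ext_superset[of "{S}"]) (use assms in \<open>auto simp: ecoeff_egen_set split: if_splits\<close>)

lemma mult_ext_one: "mult_ext d 1 = 1"
  using mult_ext_egen_set[of "{}" d] by (simp add: egen_set_def)

lemma mult_ext_egen: "mult_ext d (egen j) = d j"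
  using mult_ext_egen_set[of "{j}" d] by (simp add: egen_set_def)

lemma scaleQ_central: "fps_const (c *\<^sub>Q 1) * F = F * fps_const (c *\<^sub>Q 1)"
  by (rule fps_ext) simp

lemma mult_ext_mult:
  assumes d: "\<And>i j. d i * d j = - (d j * d i)" "\<And>i. d i * d i = 0"
  shows "mult_ext d (u * v) = mult_ext d u * mult_ext d v"
proof -
  define K where "K u = {S. ecoeff u S \<noteq> 0}" for u
  have K: "finite (K u)" "\<forall>S\<in>K u. finite S" for u
    using finite_ecoeff ecoeff_infinite by (auto simp: K_def)
  have e: "u = (\<Sum>S\<in>K u. ecoeff u S *\<^sub>Q egen_set S)" for u
    by (rule ext_expansion) (use K in \<open>auto simp: K_def\<close>)
  have eu: "mult_ext d u = (\<Sum>S\<in>K u. mult_ext d (ecoeff u S *\<^sub>Q egen_set S))" for u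
    using arg_cong[OF e[of u], of "mult_ext d"] by (simp only: mult_ext_sum)
  have base: "mult_ext d (egen_set S * egen_set T) = mult_ext d (egen_set S) * mult_ext d (egen_set T)"
    if "finite S" "finite T" for S T
  proof -
    have "fps_const ((- 1) ^ n *\<^sub>Q 1) * F = (- 1) ^ n * F" for n and F :: "ext fps"
      by (cases "even n") (auto simp: fps_const_neg[symmetric] simp del: fps_const_neg)
    then show ?thesis
      using that anticomm_Un[of d S T, OF d]
      by (simp add: egen_set_times mult_ext_scaleQ mult_ext_egen_set esgn_def)
  qed
  have "mult_ext d (u * v) = (\<Sum>S\<in>K u. \<Sum>T\<in>K v. mult_ext d
      ((ecoeff u S * ecoeff v T) *\<^sub>Q (egen_set S * egen_set T)))"
  proof -
    have "u * v = (\<Sum>S\<in>K u. \<Sum>T\<in>K v. (ecoeff u S *\<^sub>Q egen_set S) * (ecoeff v T *\<^sub>Q egen_set T))"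
      using arg_cong2[OF e[of u] e[of v], of "(*)"] by (simp only: sum_product)
    then have "mult_ext d (u * v) = (\<Sum>S\<in>K u. \<Sum>T\<in>K v. mult_ext d
        ((ecoeff u S *\<^sub>Q egen_set S) * (ecoeff v T *\<^sub>Q egen_set T)))"
      by (simp only: mult_ext_sum)
    then show ?thesis by (simp add: mult.commute)
  qed
  also have "\<dots> = (\<Sum>S\<in>K u. \<Sum>T\<in>K v. mult_ext d (ecoeff u S *\<^sub>Q egen_set S) *
      mult_ext d (ecoeff v T *\<^sub>Q egen_set T))"
  proof (intro sum.cong refl)
    fix S T assume "S \<in> K u" "T \<in> K v"
    then have fin: "finite S" "finite T" using K by auto
    have "fps_const (ecoeff u S *\<^sub>Q 1) * X * (fps_const (ecoeff v T *\<^sub>Q 1) * Y) =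
        fps_const ((ecoeff u S * ecoeff v T) *\<^sub>Q 1) * (X * Y)" for X Y
    proof -
      have "fps_const (ecoeff u S *\<^sub>Q 1) * X * (fps_const (ecoeff v T *\<^sub>Q 1) * Y) =
          fps_const (ecoeff u S *\<^sub>Q 1) * (X * fps_const (ecoeff v T *\<^sub>Q 1)) * Y"
        by (simp add: mult.assoc)
      also have "\<dots> = fps_const (ecoeff u S *\<^sub>Q 1) * fps_const (ecoeff v T *\<^sub>Q 1) * (X * Y)"
        by (subst scaleQ_central[symmetric]) (simp only: mult.assoc)
      finally show ?thesis by (simp add: mult.commute)
    qed
    then show "mult_ext d ((ecoeff u S * ecoeff v T) *\<^sub>Q (egen_set S * egen_set T)) =
        mult_ext d (ecoeff u S *\<^sub>Q egen_set S) * mult_ext d (ecoeff v T *\<^sub>Q egen_set T)"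
      using base[OF fin] by (simp add: mult_ext_scaleQ)
  qed
  also have "\<dots> = mult_ext d u * mult_ext d v"
    unfolding eu[of u] eu[of v] by (rule sum_product[symmetric])
  finally show ?thesis .
qed

lemma bZ_times_bZ: "bZ i * bZ j = - (bZ j * bZ i)"
  by (simp add: bZ_def egen_times_egen(1)[of "nat i" "nat j"])

lemma vector_series_anticommute:
  fixes F G :: "ext fps"
  assumes F: "\<And>n. \<exists>c i. fps_nth F n = c *\<^sub>Q bZ i" and G: "\<And>n. \<exists>c i. fps_nth G n = c *\<^sub>Q bZ i"
  shows "F * G = - (G * F)"
proof (rule fps_ext)
  fix n
  have "fps_nth F p * fps_nth G q = - (fps_nth G q * fps_nth F p)" for p q
  proof -
    obtain a i b j where "fps_nth F p = a *\<^sub>Q bZ i" "fps_nth G q = b *\<^sub>Q bZ j"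
      using F[of p] G[of q] by blast
    moreover have "(a * b) *\<^sub>Q (- x) = - ((a * b) *\<^sub>Q x)" for x
      by (rule ext_eqI) simp
    ultimately show ?thesis
      using bZ_times_bZ[of i j] by (simp add: mult.commute[of b a])
  qed
  then have "fps_nth (F * G) n = (\<Sum>i=0..n. - (fps_nth G (n - i) * fps_nth F i))"
    by (simp add: fps_mult_nth)
  also have "\<dots> = (\<Sum>i=0..n. - (fps_nth G i * fps_nth F (n - i)))"
    by (rule sum.reindex_bij_witness[of _ "\<lambda>i. n - i" "\<lambda>i. n - i"]) auto
  finally show "fps_nth (F * G) n = fps_nth (- (G * F)) n"
    by (simp add: fps_mult_nth sum_negf)
qed

lemma ext_fps_self_neg: "F = - F \<Longrightarrow> F = (0 :: ext fps)"
proof (rule fps_ext)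
  fix n assume "F = - F"
  then have "fps_nth F n = - fps_nth F n" by (metis fps_neg_nth)
  then have "ecoeff (fps_nth F n) S = - ecoeff (fps_nth F n) S" for S
    by (metis ecoeff_simps(3))
  then show "fps_nth F n = fps_nth 0 n"
    by (intro ext_eqI) (simp add: equal_neg_zero)
qed

lemma mult_ext_mult_vector_series:
  assumes "\<And>j n. \<exists>c i. fps_nth (d j) n = c *\<^sub>Q bZ i"
  shows "mult_ext d (u * v) = mult_ext d u * mult_ext d v"
  using vector_series_anticommute assms ext_fps_self_neg by (intro mult_ext_mult) blast+

lemma binomial_series_coeff:
  "\<exists>c k. fps_nth (fps_const (bZ i) - fps_const (bZ j) * fps_X) n = c *\<^sub>Q bZ k"
proof -
  consider "n = 0" | "n = 1" | "n > 1" by linarith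
  then show ?thesis
  proof cases
    case 1
    then show ?thesis by (intro exI[of _ 1] exI[of _ i]) simp
  next
    case 2
    then show ?thesis by (intro exI[of _ "-1"] exI[of _ j]) simp
  next
    case 3
    then show ?thesis by (intro exI[of _ 0]) simp
  qed
qed

lemma schubert_mult:
  "sigma_plus (u * v) = sigma_plus u * sigma_plus v"
  "sigma_bar_plus (u * v) = sigma_bar_plus u * sigma_bar_plus v"
  "sigma_bar_minus (u * v) = sigma_bar_minus u * sigma_bar_minus v"
  unfolding sigma_plus_def sigma_bar_plus_def sigma_bar_minus_def
  by (rule mult_ext_mult_vector_series, (rule binomial_series_coeff | simp, metis scaleQ_simps(1)))+

lemma schubert_one:
  "sigma_plus 1 = 1" "sigma_bar_plus 1 = 1" "sigma_bar_minus 1 = 1"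
  by (simp_all add: sigma_plus_def sigma_bar_plus_def sigma_bar_minus_def mult_ext_one)


lemma schubert_bV:
  "sigma_plus (bV j) = Abs_fps (\<lambda>i. bZ (int j + int i))"
  "sigma_bar_plus (bV j) = fps_const (bZ (int j)) - fps_const (bZ (int j + 1)) * fps_X"
  "sigma_bar_minus (bV j) = fps_const (bZ (int j)) - fps_const (bZ (int j - 1)) * fps_X"
  by (simp_all add: sigma_plus_def sigma_bar_plus_def sigma_bar_minus_def mult_ext_egen)

section \<open>Formal series in \<open>z\<^sub>1, z\<^sub>2, \<dots>, w\<^sub>1, w\<^sub>2, \<dots>\<close>\<close>

datatype var = Zv nat | Wv nat

type_synonym expo = "var \<Rightarrow>\<^sub>0 int"

type_synonym laurent = "expo \<Rightarrow>\<^sub>0 rat"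

text \<open>A formal series with coefficients in \<open>'a\<close>, infinite in all directions, is its coefficient
  function.  All sums of series below are taken coefficientwise with \<open>Sum_any\<close>; where they
  are used, only finitely many terms contribute to each coefficient.\<close>

type_synonym 'a series = "expo \<Rightarrow> 'a"

definition const_series :: "ext \<Rightarrow> ext series" where
  "const_series u e = (if e = 0 then u else 0)"

definition laurent_mult :: "laurent \<Rightarrow> ext series \<Rightarrow> ext series" where
  "laurent_mult P F e =
     (\<Sum>a\<in>Poly_Mapping.keys P. Poly_Mapping.lookup P a *\<^sub>Q F (e - a))"

text \<open>A linear map \<open>D(t)\<close> from \<open>\<And>V\<close> to \<open>\<And>V[[t]]\<close>, with \<open>t = x\<^sup>s\<close> for a variable x and
  \<open>s = \<plusminus>1\<close>, extended linearly over the series coefficients.\<close>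

definition series_op :: "(ext \<Rightarrow> ext fps) \<Rightarrow> var \<Rightarrow> int \<Rightarrow> ext series \<Rightarrow> ext series" where
  "series_op D x s F e =
     Sum_any (\<lambda>i. fps_nth (D (F (e - Poly_Mapping.single x (s * int i)))) i)"

definition sigma_plus_z :: "nat \<Rightarrow> ext series \<Rightarrow> ext series" where
  "sigma_plus_z k = foldr (\<lambda>j. series_op sigma_plus (Zv j) 1) [1..<Suc k]"

definition sigma_bar_minus_z :: "nat \<Rightarrow> ext series \<Rightarrow> ext series" where
  "sigma_bar_minus_z k = foldr (\<lambda>j. series_op sigma_bar_minus (Zv j) (- 1)) [1..<Suc k]"

section \<open>Partitions and Schur polynomials\<close>

text \<open>Partitions and all matrices are indexed from 0: \<open>lam i\<close> is the part \<open>\<lambda>\<^sub>i\<^sub>+\<^sub>1\<close>.\<close>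

definition Par :: "nat \<Rightarrow> (nat \<Rightarrow> nat) set" where
  "Par r = {lam. (\<forall>i j. i \<le> j \<longrightarrow> lam j \<le> lam i) \<and> (\<forall>i\<ge>r. lam i = 0)}"

abbreviation empty_par :: "nat \<Rightarrow> nat" where "empty_par \<equiv> (\<lambda>_. 0)"

definition b_par :: "nat \<Rightarrow> (nat \<Rightarrow> nat) \<Rightarrow> ext" where
  "b_par r lam = prod_list (map (\<lambda>i. bV (r - 1 - i + lam i)) [0..<r])"

definition beta_par :: "nat \<Rightarrow> (nat \<Rightarrow> nat) \<Rightarrow> ext" where
  "beta_par r lam = prod_list (map (\<lambda>i. betaV (r - 1 - i + lam i)) [0..<r])"

definition Delta :: "nat \<Rightarrow> (nat \<Rightarrow> nat) \<Rightarrow> (int \<Rightarrow> 'a::comm_ring_1) \<Rightarrow> 'a" where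
  "Delta r lam A = det (mat r r (\<lambda>(i, j). A (int (lam j) - int j + int i)))"

text \<open>The quotient is exact and unique, Laurent polynomials forming an integral domain.\<close>

definition schur_poly :: "nat \<Rightarrow> (nat \<Rightarrow> nat) \<Rightarrow> (nat \<Rightarrow> laurent) \<Rightarrow> laurent" where
  "schur_poly k \<mu> x = (THE s. s * (\<Prod>j\<in>{1..k}. \<Prod>i\<in>{1..<j}. x j - x i) =
     det (mat k k (\<lambda>(i, j). x (Suc j) ^ (\<mu> (k - 1 - i) + i))))"

definition z_pow :: "nat \<Rightarrow> int \<Rightarrow> laurent" where
  "z_pow j n = Poly_Mapping.single (Poly_Mapping.single (Zv j) n) 1"

definition w_pow :: "nat \<Rightarrow> int \<Rightarrow> laurent" where
  "w_pow j n = Poly_Mapping.single (Poly_Mapping.single (Wv j) n) 1"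

section \<open>The rings \<open>B\<^sub>m\<close>\<close>

text \<open>Rational polynomials in variables indexed by naturals; \<open>B_ring m\<close> uses \<open>e\<^sub>1, \<dots>, e\<^sub>m\<close> only.\<close>

type_synonym bpoly = "(nat \<Rightarrow>\<^sub>0 nat) \<Rightarrow>\<^sub>0 rat"

definition B_ring :: "nat \<Rightarrow> bpoly set" where
  "B_ring m = {p. \<forall>a\<in>Poly_Mapping.keys p. Poly_Mapping.keys a \<subseteq> {1..m}}"

definition e_var :: "nat \<Rightarrow> bpoly" where
  "e_var i = (if i = 0 then 1 else Poly_Mapping.single (Poly_Mapping.single i 1) 1)"

definition E_ser :: "nat \<Rightarrow> bpoly fps" where
  "E_ser m = Abs_fps (\<lambda>i. if i \<le> m then (- 1) ^ i * e_var i else 0)"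

definition H_seq :: "nat \<Rightarrow> int \<Rightarrow> bpoly" where
  "H_seq m j = (if j < 0 then 0 else fps_nth (fps_right_inverse (E_ser m) 1) (nat j))"

lemma E_ser_inverse: "E_ser m * Abs_fps (\<lambda>j. H_seq m (int j)) = 1"
proof -
  have "Abs_fps (\<lambda>j. H_seq m (int j)) = fps_right_inverse (E_ser m) 1"
    by (rule fps_ext) (simp add: H_seq_def)
  then show ?thesis
    using fps_right_inverse[of "E_ser m" 1] by (simp add: E_ser_def e_var_def)
qed

text \<open>The action of \<open>B_ring m\<close> on \<open>\<And>\<^sup>mV\<close>, where \<open>e\<^sub>i\<close> acts as \<open>sigma_bar i\<close>.\<close>

definition sigma_bar :: "nat \<Rightarrow> ext \<Rightarrow> ext" where
  "sigma_bar i u = (- 1) ^ i *\<^sub>Q fps_nth (sigma_bar_plus u) i"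

definition B_act_mono :: "nat \<Rightarrow> (nat \<Rightarrow>\<^sub>0 nat) \<Rightarrow> ext \<Rightarrow> ext" where
  "B_act_mono m a = foldr (\<lambda>i. sigma_bar i ^^ Poly_Mapping.lookup a i) [1..<Suc m]"

definition B_act :: "nat \<Rightarrow> bpoly \<Rightarrow> ext \<Rightarrow> ext" where
  "B_act m p u = (\<Sum>a\<in>Poly_Mapping.keys p. Poly_Mapping.lookup p a *\<^sub>Q B_act_mono m a u)"

definition B_act_series :: "nat \<Rightarrow> bpoly series \<Rightarrow> ext \<Rightarrow> ext series" where
  "B_act_series m P u e = B_act m (P e) u"

section \<open>Vertex operators\<close>

definition par_set :: "nat \<Rightarrow> (nat \<Rightarrow> nat) \<Rightarrow> nat set" where
  "par_set r lam = (\<lambda>i. r - 1 - i + lam i) ` {0..<r}"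

lemma b_par_eq_egen_set:
  assumes "lam \<in> Par r"
  shows "b_par r lam = egen_set (par_set r lam)"
proof -
  let ?g = "\<lambda>i. r - 1 - i + lam i"
  have g: "?g j < ?g i" if "i < j" "j < r" for i j
  proof -
    have "lam j \<le> lam i" using assms that by (simp add: Par_def)
    then show ?thesis using that by linarith
  qed
  have "sorted (rev (map ?g [0..<r]))"
    unfolding sorted_rev_iff_nth_mono using g by (fastforce simp: order_le_less)
  moreover have "distinct (map ?g [0..<r])"
    unfolding distinct_conv_nth
  proof (intro allI impI)
    fix i j assume "i < length (map ?g [0..<r])" "j < length (map ?g [0..<r])" "i \<noteq> j"
    then show "map ?g [0..<r] ! i \<noteq> map ?g [0..<r] ! j"
      using g[of i j] g[of j i] by (cases "i < j") auto
  qed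
  ultimately have "sorted_list_of_set (par_set r lam) = rev (map ?g [0..<r])"
    by (intro sorted_distinct_set_unique) (auto simp: par_set_def)
  then show ?thesis by (simp add: b_par_def egen_set_def desc_list_def comp_def)
qed

text \<open>The linear extension to \<open>\<And>\<^sup>rV\<close> of a map given on the basis vectors \<open>b_par r lam\<close>; the coefficient
  of \<open>b_par r lam\<close> in u is \<open>ecoeff u (par_set r lam)\<close>.\<close>

definition lin_par :: "nat \<Rightarrow> ((nat \<Rightarrow> nat) \<Rightarrow> ext series) \<Rightarrow> ext \<Rightarrow> ext series" where
  "lin_par r f u e =
     Sum_any (\<lambda>lam. if lam \<in> Par r then ecoeff u (par_set r lam) *\<^sub>Q f lam e else 0)"

definition Gamma_basis :: "nat \<Rightarrow> nat \<Rightarrow> (nat \<Rightarrow> nat) \<Rightarrow> ext series" where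
  "Gamma_basis k r lam =
     sigma_plus_z k (sigma_bar_minus_z k (const_series (b_par (r + k) lam)))"

text \<open>\<open>\<Gamma>(z\<^sub>k)\<close> on \<open>\<And>\<^sup>rV\<close>, extended linearly over series coefficients.\<close>

definition Gamma_op :: "nat \<Rightarrow> nat \<Rightarrow> ext series \<Rightarrow> ext series" where
  "Gamma_op k r F e = Sum_any (\<lambda>a. lin_par r (Gamma_basis k r) (F a) (e - a))"

type_synonym blaurent = "expo \<Rightarrow>\<^sub>0 bpoly"

definition E_at_w :: "nat \<Rightarrow> nat \<Rightarrow> blaurent" where
  "E_at_w m j = (\<Sum>i\<le>m. Poly_Mapping.single (Poly_Mapping.single (Wv j) (int i))
     (fps_nth (E_ser m) i))"

definition H_const :: "nat \<Rightarrow> int \<Rightarrow> blaurent" where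
  "H_const m j = Poly_Mapping.single 0 (H_seq m j)"

definition sigma_minus_seq :: "nat \<Rightarrow> (int \<Rightarrow> blaurent) \<Rightarrow> int \<Rightarrow> blaurent" where
  "sigma_minus_seq l A j =
     Sum_any (\<lambda>i. Poly_Mapping.single (Poly_Mapping.single (Wv l) (- int i)) 1 * A (j - int i))"

definition Gamma_star_poly :: "nat \<Rightarrow> nat \<Rightarrow> (nat \<Rightarrow> nat) \<Rightarrow> blaurent" where
  "Gamma_star_poly k r lam = (\<Prod>j\<in>{1..k}. E_at_w (r - k) j) *
     Delta r lam (foldr sigma_minus_seq [1..<Suc k] (H_const (r - k)))"

definition Gamma_star_basis :: "nat \<Rightarrow> nat \<Rightarrow> (nat \<Rightarrow> nat) \<Rightarrow> ext series" where
  "Gamma_star_basis k r lam = (if k > r then (\<lambda>_. 0) else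
     B_act_series (r - k) (Poly_Mapping.lookup (Gamma_star_poly k r lam)) (b_par (r - k) empty_par))"

definition Gamma_star_op :: "nat \<Rightarrow> nat \<Rightarrow> ext \<Rightarrow> ext series" where
  "Gamma_star_op k r = lin_par r (Gamma_star_basis k r)"

section \<open>The action of the generating function on \<open>B\<^sub>r\<close>\<close>

definition E_ext :: "nat \<Rightarrow> nat \<Rightarrow> ext \<Rightarrow> ext series" where
  "E_ext k r u e = Sum_any (\<lambda>(\<mu>, \<nu>). if \<mu> \<in> Par k \<and> \<nu> \<in> Par k
     then Poly_Mapping.lookup (schur_poly k \<mu> (\<lambda>j. z_pow j 1) * schur_poly k \<nu> (\<lambda>j. w_pow j (- 1))) e *\<^sub>Q
       (b_par k \<mu> * contract k r (beta_par k \<nu>) u)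
     else 0)"

text \<open>Transport to \<open>B_ring r\<close> along the isomorphism \<open>q \<mapsto> B_act r q (b_par r empty_par)\<close> onto \<open>\<And>\<^sup>rV\<close>.\<close>

definition E_B :: "nat \<Rightarrow> nat \<Rightarrow> bpoly \<Rightarrow> bpoly series" where
  "E_B k r p e = inv_into (B_ring r) (\<lambda>q. B_act r q (b_par r empty_par))
     (E_ext k r (B_act r p (b_par r empty_par)) e)"

end

theory Submission
  imports Defs
begin

text \<open>
  The coefficients of a wedge product of vectors \<open>\<Sum>\<^sub>t f t b\<^sub>t\<close> are determinants of values of the
  functions f.  Reading \<open>b\<^sub>t\<close> as the t-th power of a variable X turns each f into a power series, on
  which \<open>\<sigma>\<^sub>+(z)\<close> is multiplication by \<open>1/(1 - z X)\<close>, whereas \<open>\<sigma>\<close>-bar-minus sends \<open>X G\<close> to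
  \<open>- z\<^sup>-\<^sup>1 (1 - z X) G\<close>.  Hence \<open>\<Gamma>(z\<^sub>k)\<close> turns the first m factors of \<open>[b]\<^sup>m\<^sup>+\<^sup>k\<close> into those of \<open>[b]\<^sup>m\<close>, up to
  the factor \<open>(-1)\<^sup>k / (z\<^sub>1 \<dots> z\<^sub>k)\<close> each, while the last k factors produce the Jacobi-Trudi
  determinants of the Schur polynomials in \<open>z\<^sub>1, \<dots>, z\<^sub>k\<close>.

  For \<open>\<Gamma>\<^sup>*(w\<^sub>k)\<close> put \<open>m = r - k\<close> and \<open>x\<^sub>j = 1/w\<^sub>j\<close>.  Its determinant is the Jacobi-Trudi determinant of the
  \<open>x\<^sub>j\<close> together with the roots of \<open>E\<^sub>m\<close>.  Up to a resultant times a Vandermonde determinant it equals the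
  determinant with k rows of powers of the \<open>x\<^sub>j\<close> and m rows of the \<open>h\<^sub>n\<close>, since all these rows obey the
  same linear recurrence of order r.  Laplace expansion along the first k rows produces Schur
  polynomials in the \<open>x\<^sub>j\<close> and, by Giambelli's formula in \<open>\<And>\<^sup>mV\<close>, the contractions of \<open>[b]\<^sup>r\<close>.
\<close>

section \<open>Determinants indexed by finite sets of columns\<close>

text \<open>Put m = r - k and let L be the index set of [b]_lambda. Both sides become sums over the
  k-subsets A of L. Gamma-star yields the product of the w_j^m times the sum of s_A(1/w) (beta_A
  contracted with b_L), and Gamma sends u of degree m to the product of the z_j^(-m) times the sum
  of s_M(z) b_M wedge u; the prefactor of the claim removes exactly these powers. The sign (-1)^(km)
  left by the m shifted factors in Gamma is the one of moving m vectors past k vectors. The roots of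
  E_m are never adjoined: a row obeys the recurrence when its series times the characteristic series
  is a polynomial of degree less than r, and E_m enters through E_m H_m = 1 and its degree bound.
  Partitions are replaced by sets of indices, since then Laplace expansion, wedge product and
  contraction all carry the same sign \<open>sg\<close>. Vandermonde factors are cancelled in rings
  of Laurent polynomials, which are integral domains.\<close>

definition sg :: "nat set \<Rightarrow> nat set \<Rightarrow> 'a::comm_ring_1" where
  "sg S T = (- 1) ^ card {(s, t). s \<in> S \<and> t \<in> T \<and> s < t}"

text \<open>\<open>sg\<close> repeats \<open>esgn\<close> over an arbitrary commutative ring, as the
  determinants below also have entries in polynomial and Laurent polynomial rings.\<close>

lemma esgn_eq_sg: "esgn S T = sg S T"
  by (simp add: esgn_def sg_def)

lemma sg_Un_left:
  assumes "finite S" "finite T" "finite W" "S \<inter> T = {}"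
  shows "sg (S \<union> T) W = sg S W * sg T W"
proof -
  have "{(s, t). s \<in> S \<union> T \<and> t \<in> W \<and> s < t} =
        {(s, t). s \<in> S \<and> t \<in> W \<and> s < t} \<union> {(s, t). s \<in> T \<and> t \<in> W \<and> s < t}" by auto
  moreover have "{(s, t). s \<in> S \<and> t \<in> W \<and> s < t} \<inter> {(s, t). s \<in> T \<and> t \<in> W \<and> s < t} = {}"
    using assms(4) by auto
  ultimately show ?thesis
    unfolding sg_def using assms(1-3) by (simp add: card_Un_disjoint finite_esgn_set power_add)
qed

lemma sg_Un_right:
  assumes "finite S" "finite T" "finite W" "S \<inter> T = {}"
  shows "sg W (S \<union> T) = sg W S * sg W T"
proof -
  have "{(s, t). s \<in> W \<and> t \<in> S \<union> T \<and> s < t} =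
        {(s, t). s \<in> W \<and> t \<in> S \<and> s < t} \<union> {(s, t). s \<in> W \<and> t \<in> T \<and> s < t}" by auto
  moreover have "{(s, t). s \<in> W \<and> t \<in> S \<and> s < t} \<inter> {(s, t). s \<in> W \<and> t \<in> T \<and> s < t} = {}"
    using assms(4) by auto
  ultimately show ?thesis
    unfolding sg_def using assms(1-3) by (simp add: card_Un_disjoint finite_esgn_set power_add)
qed

lemma sg_empty [simp]: "sg {} T = 1" "sg S {} = 1"
  by (auto simp: sg_def)

lemma sg_square [simp]: "sg S T * sg S T = 1" "sg S T * (sg S T * x) = x"
  by (simp_all add: sg_def)

lemma sg_one: "(\<And>s t. s \<in> S \<Longrightarrow> t \<in> T \<Longrightarrow> t \<le> s) \<Longrightarrow> sg S T = 1"
proof -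
  assume "\<And>s t. s \<in> S \<Longrightarrow> t \<in> T \<Longrightarrow> t \<le> s"
  then have *: "{(s, t). s \<in> S \<and> t \<in> T \<and> s < t} = {}" by (auto simp: not_less)
  show ?thesis unfolding sg_def * by simp
qed

text \<open>Each pair in \<open>S \<times> T\<close> is an inversion for exactly one of the two
  orders.\<close>

lemma sg_commute:
  assumes "finite S" "finite T" "S \<inter> T = {}"
  shows "sg S T = (- 1) ^ (card S * card T) * sg T S"
proof -
  let ?A = "{(s, t). s \<in> S \<and> t \<in> T \<and> s < t}" and ?B = "{(t, s). t \<in> T \<and> s \<in> S \<and> t < s}"
  have "S \<times> T = ?A \<union> prod.swap ` ?B"
    using assms(3) by (auto simp: image_iff)
  moreover have "?A \<inter> prod.swap ` ?B = {}" by auto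
  moreover have "finite ?A" "finite ?B" using assms by (auto intro: finite_esgn_set)
  ultimately have "card (S \<times> T) = card ?A + card (prod.swap ` ?B)"
    by (simp only: card_Un_disjoint finite_imageI)
  also have "card (prod.swap ` ?B) = card ?B" by (rule card_image) (auto simp: inj_on_def)
  finally have "card S * card T = card ?A + card ?B" by (simp add: card_cartesian_product)
  then show ?thesis
    by (simp add: sg_def power_add mult.assoc)
qed

lemma sg_singleton_commute: "s \<noteq> t \<Longrightarrow> sg {s} {t} = - sg {t} {s}"
  using sg_commute[of "{s}" "{t}"] by simp

text \<open>\<open>wd fs T\<close> is the determinant of the values of the functions fs at the elements of T, taken
  in decreasing order, expanded along the first row (see \<open>wd_det\<close>).  It is the coefficient of
  \<open>egen_set T\<close> in the wedge product of the vectors \<open>\<Sum>\<^sub>t f t b\<^sub>t\<close>, f in fs.\<close>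

primrec wd :: "(nat \<Rightarrow> 'a::comm_ring_1) list \<Rightarrow> nat set \<Rightarrow> 'a" where
  "wd [] T = (if T = {} then 1 else 0)"
| "wd (f # fs) T = (\<Sum>s\<in>T. sg {s} (T - {s}) * f s * wd fs (T - {s}))"

text \<open>Each row uses up one column, and sums over infinite sets are 0 by default. This discards
  the terms of wrong size in sums over all subsets.\<close>

lemma wd_card:
  assumes "wd fs T \<noteq> 0"
  shows "finite T \<and> card T = length fs"
  using assms
proof (induction fs arbitrary: T)
  case Nil
  then show ?case by (simp split: if_splits)
next
  case (Cons f fs)
  then obtain s where "s \<in> T" "wd fs (T - {s}) \<noteq> 0"
    by (metis (no_types, lifting) mult_zero_right sum.not_neutral_contains_not_neutral wd.simps(2))
  with Cons.IH[of "T - {s}"] show ?case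
    by (simp add: card_Suc_Diff1[symmetric] del: card_Diff_insert)

qed

section \<open>Comparison with determinants of matrices\<close>

lemma sorted_wrt_desc_list: "finite T \<Longrightarrow> sorted_wrt (>) (desc_list T)"
  using strict_sorted_list_of_set[of T] by (simp add: desc_list_def sorted_wrt_rev)

lemma desc_list_unique: "sorted_wrt (>) xs \<Longrightarrow> desc_list (set xs) = xs"
proof -
  assume "sorted_wrt (>) xs"
  then have "sorted_wrt (<) (rev xs)" by (simp add: sorted_wrt_rev)
  then have "sorted_list_of_set (set (rev xs)) = rev xs"
    by (metis finite_set strict_sorted_iff sorted_list_of_set.idem_if_sorted_distinct)
  then show ?thesis by (simp add: desc_list_def)
qed

lemma desc_list_nth_less:
  "finite T \<Longrightarrow> i < j \<Longrightarrow> j < card T \<Longrightarrow> desc_list T ! j < desc_list T ! i"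
  using sorted_wrt_nth_less[OF sorted_wrt_desc_list] by auto

lemma desc_list_delete:
  assumes "finite T" "j < card T"
  shows "desc_list (T - {desc_list T ! j}) = take j (desc_list T) @ drop (Suc j) (desc_list T)"
proof -
  let ?d = "desc_list T"
  have d: "?d = take j ?d @ ?d ! j # drop (Suc j) ?d"
    using assms by (simp add: id_take_nth_drop)
  have "sorted_wrt (>) (take j ?d @ ?d ! j # drop (Suc j) ?d)"
    using sorted_wrt_desc_list[OF assms(1)] d by simp
  then have s: "sorted_wrt (>) (take j ?d @ drop (Suc j) ?d)"
    by (auto simp: sorted_wrt_append)
  have "distinct (take j ?d @ ?d ! j # drop (Suc j) ?d)" using d by simp
  then have "?d ! j \<notin> set (take j ?d @ drop (Suc j) ?d)" by auto
  moreover have "T = set (take j ?d @ ?d ! j # drop (Suc j) ?d)" using assms d by simp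
  ultimately have "set (take j ?d @ drop (Suc j) ?d) = T - {?d ! j}" by auto
  then show ?thesis using desc_list_unique[OF s] by simp
qed

text \<open>Exactly the j elements listed before it are larger, so \<open>sg\<close> is the cofactor
  sign of the first row.\<close>

lemma sg_nth_desc_list:
  assumes "finite T" "j < card T"
  shows "sg {desc_list T ! j} (T - {desc_list T ! j}) = (- 1) ^ j"
proof -
  let ?d = "desc_list T"
  have "{(s, t). s \<in> {?d ! j} \<and> t \<in> T - {?d ! j} \<and> s < t} = (\<lambda>i. (?d ! j, ?d ! i)) ` {..<j}"
  proof (intro equalityI subsetI)
    fix p assume "p \<in> {(s, t). s \<in> {?d ! j} \<and> t \<in> T - {?d ! j} \<and> s < t}"
    then obtain t where t: "p = (?d ! j, t)" "t \<in> T" "?d ! j < t" by auto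
    then obtain i where i: "i < card T" "t = ?d ! i"
      using assms by (metis desc_list_length desc_list_set in_set_conv_nth)
    have "i < j" using desc_list_nth_less[of T j i] i t assms
      by (metis less_irrefl linorder_neqE_nat order_less_asym)
    then show "p \<in> (\<lambda>i. (?d ! j, ?d ! i)) ` {..<j}" using t i by auto
  next
    fix p assume "p \<in> (\<lambda>i. (?d ! j, ?d ! i)) ` {..<j}"
    then obtain i where i: "i < j" "p = (?d ! j, ?d ! i)" by auto
    moreover have "?d ! i \<in> T" using i assms
      by (metis desc_list_length desc_list_set nth_mem order_less_trans)
    ultimately show "p \<in> {(s, t). s \<in> {?d ! j} \<and> t \<in> T - {?d ! j} \<and> s < t}"
      using desc_list_nth_less[of T i j] assms by auto
  qed
  moreover have "inj_on (\<lambda>i. (?d ! j, ?d ! i)) {..<j}"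
    using assms by (auto simp: inj_on_def nth_eq_iff_index_eq)
  ultimately show ?thesis by (simp add: sg_def card_image)
qed

lemma wd_det:
  fixes fs :: "(nat \<Rightarrow> 'a::comm_ring_1) list"
  assumes "finite T" "card T = length fs"
  shows "wd fs T = det (mat (length fs) (length fs) (\<lambda>(i, j). (fs ! i) (desc_list T ! j)))"
  using assms
proof (induction fs arbitrary: T)
  case Nil
  then show ?case by simp
next
  case (Cons f fs)
  let ?n = "length fs" and ?d = "desc_list T"
  let ?M = "mat (Suc ?n) (Suc ?n) (\<lambda>(i, j). ((f # fs) ! i) (?d ! j))"
  have bij: "bij_betw (\<lambda>j. ?d ! j) {..<Suc ?n} T"
    using bij_betw_nth[of ?d "{..<Suc ?n}" T] Cons.prems by simp
  have "wd (f # fs) T = (\<Sum>j<Suc ?n. sg {?d ! j} (T - {?d ! j}) * f (?d ! j) * wd fs (T - {?d ! j}))"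
    unfolding wd.simps by (rule sum.reindex_bij_betw[OF bij, symmetric])
  also have "\<dots> = (\<Sum>j<Suc ?n. ?M $$ (0, j) * cofactor ?M 0 j)"
  proof (rule sum.cong[OF refl])
    fix j assume j: "j \<in> {..<Suc ?n}"
    then have jT: "j < card T" using Cons.prems by simp
    then have mem: "?d ! j \<in> T" using Cons.prems by (metis desc_list_length desc_list_set nth_mem)
    have "wd fs (T - {?d ! j}) =
        det (mat ?n ?n (\<lambda>(i, l). (fs ! i) (desc_list (T - {?d ! j}) ! l)))"
      using Cons.prems mem by (intro Cons.IH) auto
    also have "mat ?n ?n (\<lambda>(i, l). (fs ! i) (desc_list (T - {?d ! j}) ! l)) = mat_delete ?M 0 j"
      using j jT Cons.prems
      by (intro eq_matI) (auto simp: mat_delete_def desc_list_delete nth_append min_def)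
    finally have "wd fs (T - {?d ! j}) = det (mat_delete ?M 0 j)" .
    moreover have "sg {?d ! j} (T - {?d ! j}) = ((- 1) ^ j :: 'a)"
      by (rule sg_nth_desc_list[OF Cons.prems(1) jT])
    ultimately show "sg {?d ! j} (T - {?d ! j}) * f (?d ! j) * wd fs (T - {?d ! j}) =
        ?M $$ (0, j) * cofactor ?M 0 j"
      using j by (simp add: cofactor_def mult_ac)
  qed
  also have "\<dots> = det ?M"
    by (rule laplace_expansion_row[symmetric]) auto
  finally show ?case by simp
qed

text \<open>Expanding two rows gives a sum over ordered pairs of columns; exchanging the pair only
  changes the sign of sorting s against t.\<close>

lemma wd_swap:
  fixes f g :: "nat \<Rightarrow> 'a::comm_ring_1"
  shows "wd (f # g # fs) T = - wd (g # f # fs) T"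
proof (cases "finite T")
  case False
  then show ?thesis by simp
next
  case True
  have e: "wd (f # g # fs) T = (\<Sum>s\<in>T. \<Sum>t\<in>T. if s = t then 0 else
      sg {s} (T - {s}) * sg {t} (T - {s, t}) * f s * g t * wd fs (T - {s, t}))" for f g
  proof -
    have "(\<Sum>t\<in>T. if s = t then 0 else
        sg {s} (T - {s}) * sg {t} (T - {s, t}) * f s * g t * wd fs (T - {s, t})) =
      sg {s} (T - {s}) * f s * wd (g # fs) (T - {s})" if "s \<in> T" for s
    proof -
      have "(\<Sum>t\<in>T. if s = t then 0 else
          sg {s} (T - {s}) * sg {t} (T - {s, t}) * f s * g t * wd fs (T - {s, t})) =
        (\<Sum>t\<in>T - {s}. sg {s} (T - {s}) * sg {t} (T - {s, t}) * f s * g t * wd fs (T - {s, t}))"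
        using True by (intro sum.mono_neutral_cong_right) auto
      also have "\<dots> = sg {s} (T - {s}) * f s * wd (g # fs) (T - {s})"
        by (auto simp: sum_distrib_left Diff_insert2[symmetric] mult_ac intro!: sum.cong)
      finally show ?thesis .
    qed
    then show ?thesis by simp
  qed
  have s: "sg {s} (T - {s}) * sg {t} (T - {s, t}) = - (sg {t} (T - {t}) * sg {s} (T - {t, s}) :: 'a)"
    if "s \<in> T" "t \<in> T" "s \<noteq> t" for s t
  proof -
    have *: "sg {s} (T - {s}) = sg {s} {t} * (sg {s} (T - {s, t}) :: 'a)" if "s \<noteq> t" "t \<in> T" for s t
    proof -
      have "T - {s} = {t} \<union> (T - {s, t})" using that by auto
      then show ?thesis using sg_Un_right[of "{t}" "T - {s, t}" "{s}"] True by simp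
    qed
    show ?thesis
      using that by (simp add: *[of s t] *[of t s] sg_singleton_commute[of s t] insert_commute mult_ac)
  qed
  have "wd (f # g # fs) T = (\<Sum>s\<in>T. \<Sum>t\<in>T. - (if t = s then 0 else
      sg {t} (T - {t}) * sg {s} (T - {t, s}) * g t * f s * wd fs (T - {t, s})))"
    unfolding e
  proof (intro sum.cong refl)
    fix s t assume "s \<in> T" "t \<in> T"
    then show "(if s = t then 0 else
        sg {s} (T - {s}) * sg {t} (T - {s, t}) * f s * g t * wd fs (T - {s, t})) =
      - (if t = s then 0 else
        sg {t} (T - {t}) * sg {s} (T - {t, s}) * g t * f s * wd fs (T - {t, s}))"
      using s[of s t] by (auto simp: insert_commute mult_ac)
  qed
  also have "\<dots> = - wd (g # f # fs) T"
    unfolding e by (subst sum.swap) (simp add: sum_negf)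
  finally show ?thesis .
qed

text \<open>Antisymmetry only shows that twice the value is 0, and 2 may be a zero divisor in the
  ring; hence the passage to matrices.\<close>

lemma wd_dup: "wd (f # f # fs) T = 0"
proof (cases "finite T \<and> card T = length (f # f # fs)")
  case False
  then show ?thesis using wd_card by blast
next
  case True
  let ?n = "length (f # f # fs)"
  let ?M = "mat ?n ?n (\<lambda>(i, j). ((f # f # fs) ! i) (desc_list T ! j))"
  have "det ?M = 0"
    by (rule det_identical_rows[of ?M ?n 0 1]) (auto intro!: eq_vecI)
  then show ?thesis using wd_det[of T "f # f # fs"] True by simp
qed

lemma wd_Cons_cmult:
  "(\<And>S. wd fs S = c * wd gs S) \<Longrightarrow> wd (f # fs) T = c * wd (f # gs) T"
  by (simp add: sum_distrib_left mult_ac)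

text \<open>The row \<open>D a\<close> moves down to its place by adjacent swaps, one sign for each
  larger element of A.\<close>

lemma wd_insert:
  fixes D :: "nat \<Rightarrow> nat \<Rightarrow> 'a::comm_ring_1"
  assumes "finite A"
  shows "wd (D a # map D (desc_list A)) T =
    (if a \<in> A then 0 else sg {a} A * wd (map D (desc_list (insert a A))) T)"
  using assms
proof (induction A arbitrary: T rule: finite_linorder_max_induct)
  case empty
  then show ?case by simp
next
  case (insert m A)
  have mA: "m \<notin> A" using insert.hyps by blast
  have D: "desc_list (insert m A) = m # desc_list A"
    using insert.hyps by (simp add: desc_list_insert_max)
  consider "a = m" | "a > m" | "a < m" by linarith
  then show ?case
  proof cases
    case 1
    then show ?thesis using D wd_dup by simp
  next
    case 2
    have "desc_list (insert a (insert m A)) = a # desc_list (insert m A)"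
      by (rule desc_list_insert_max) (use 2 insert.hyps in auto)
    moreover have "a \<notin> insert m A" using 2 insert.hyps by auto
    moreover have "sg {a} (insert m A) = (1::'a)"
      by (rule sg_one) (use 2 insert.hyps in \<open>auto intro: less_imp_le\<close>)
    ultimately show ?thesis by simp
  next
    case 3
    have "wd (D a # map D (desc_list (insert m A))) T = - wd (D m # D a # map D (desc_list A)) T"
      unfolding D by (simp only: list.map wd_swap[of "D a"])
    also have "\<dots> = (if a \<in> A then 0 else
        - (sg {a} A * wd (D m # map D (desc_list (insert a A))) T))"
    proof (cases "a \<in> A")
      case True
      then have "wd (D a # map D (desc_list A)) S = 0 * wd [] S" for S using insert.IH by simp
      from wd_Cons_cmult[OF this, of "D m" T] show ?thesis using True by simp
    next
      case False
      then have "wd (D a # map D (desc_list A)) S = sg {a} A * wd (map D (desc_list (insert a A))) S"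
        for S using insert.IH by simp
      from wd_Cons_cmult[OF this, of "D m" T] show ?thesis using False by simp
    qed
    also have "\<dots> = (if a \<in> insert m A then 0 else
        sg {a} (insert m A) * wd (map D (desc_list (insert a (insert m A)))) T)"
    proof (cases "a \<in> A")
      case False
      have "desc_list (insert m (insert a A)) = m # desc_list (insert a A)"
        by (rule desc_list_insert_max) (use 3 insert.hyps in auto)
      moreover have "sg {a} (insert m A) = - (sg {a} A :: 'a)"
      proof -
        have "{(s, t). s \<in> {a} \<and> t \<in> {m} \<and> s < t} = {(a, m)}" using 3 by auto
        then have "sg {a} {m} = (- 1 :: 'a)" by (simp add: sg_def)
        then show ?thesis
          using sg_Un_right[of "{m}" A "{a}", where 'a='a] insert.hyps mA by simp
      qed
      ultimately show ?thesis using False 3 by (simp add: insert_commute)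
    qed auto
    finally show ?thesis .
  qed
qed

text \<open>Laplace expansion along the block \<open>fs\<close>. A column s for the first row and a
  column set A for the rest of the block are regrouped as the set \<open>insert s A\<close> with
  marked element s; the sign rules for unions make both signs agree.\<close>

lemma wd_append:
  fixes fs gs :: "(nat \<Rightarrow> 'a::comm_ring_1) list"
  assumes "finite T"
  shows "wd (fs @ gs) T = (\<Sum>A\<in>Pow T. sg A (T - A) * wd fs A * wd gs (T - A))"
  using assms
proof (induction fs arbitrary: T)
  case Nil
  have "(\<Sum>A\<in>Pow T. sg A (T - A) * wd [] A * wd gs (T - A)) =
      (\<Sum>A\<in>Pow T. if A = {} then wd gs T else 0)"
    by (rule sum.cong) auto
  then show ?case using Nil by simp
next
  case (Cons f fs)
  let ?T = "\<lambda>s A. sg {s} (T - {s}) * f s * (sg A (T - {s} - A) * wd fs A * wd gs (T - {s} - A))"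
  let ?U = "\<lambda>B s. sg B (T - B) * (sg {s} (B - {s}) * f s * wd fs (B - {s})) * wd gs (T - B)"
  have fin: "finite A" if "A \<subseteq> T" for A using that Cons.prems finite_subset by blast
  have "wd ((f # fs) @ gs) T = (\<Sum>s\<in>T. \<Sum>A\<in>Pow (T - {s}). ?T s A)"
    using Cons by (simp add: sum_distrib_left)
  also have "\<dots> = (\<Sum>(s, A)\<in>(SIGMA s:T. Pow (T - {s})). ?T s A)"
    by (rule sum.Sigma) (use Cons.prems in auto)
  also have "\<dots> = (\<Sum>(B, s)\<in>(SIGMA B:Pow T. B). ?U B s)"
  proof (rule sum.reindex_bij_witness[of _ "\<lambda>(B, s). (s, B - {s})" "\<lambda>(s, A). (insert s A, s)"])
    fix p assume "p \<in> (SIGMA s:T. Pow (T - {s}))"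
    then obtain s A where p: "p = (s, A)" "s \<in> T" "A \<subseteq> T - {s}" by auto
    have sA: "s \<notin> A" "A \<subseteq> T" using p by auto
    have 1: "T - insert s A = T - {s} - A" by auto
    have 2: "sg (insert s A) (T - {s} - A) = sg {s} (T - {s} - A) * (sg A (T - {s} - A) :: 'a)"
      using sg_Un_left[of "{s}" A "T - {s} - A"] sA fin Cons.prems by simp
    have 3: "sg {s} (T - {s}) = sg {s} A * (sg {s} (T - {s} - A) :: 'a)"
    proof -
      have "T - {s} = A \<union> (T - {s} - A)" using p by auto
      then show ?thesis using sg_Un_right[of A "T - {s} - A" "{s}"] sA fin Cons.prems
        by (metis Diff_disjoint finite.emptyI finite.insertI finite_Diff)
    qed
    show "(case (case p of (s, A) \<Rightarrow> (insert s A, s)) of (B, s) \<Rightarrow> ?U B s) = (case p of (s, A) \<Rightarrow> ?T s A)"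
      unfolding p using sA by (simp add: 1 2 3 mult_ac)
  qed auto
  also have "\<dots> = (\<Sum>B\<in>Pow T. \<Sum>s\<in>B. ?U B s)"
    by (rule sum.Sigma[symmetric]) (use Cons.prems fin in auto)
  also have "\<dots> = (\<Sum>B\<in>Pow T. sg B (T - B) * wd (f # fs) B * wd gs (T - B))"
    by (simp add: sum_distrib_left sum_distrib_right)
  finally show ?case .
qed

text \<open>Cauchy-Binet for the product of the rows with the matrix D. Linearity in the first row
  puts \<open>D a\<close> in front of the rows indexed by S; \<open>wd_insert\<close> sorts it in,
  and the pair (a, S) becomes a set with a marked element.\<close>

lemma wd_cauchy_binet:
  fixes fs :: "(nat \<Rightarrow> 'a::comm_ring_1) list"
  assumes "finite A"
  shows "wd (map (\<lambda>f t. \<Sum>a\<in>A. f a * D a t) fs) T =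
    (\<Sum>S\<in>Pow A. wd fs S * wd (map D (desc_list S)) T)"
proof (induction fs arbitrary: T)
  case Nil
  have "(\<Sum>S\<in>Pow A. wd [] S * wd (map D (desc_list S)) T) =
      (\<Sum>S\<in>Pow A. if S = {} then wd [] T else 0)"
    by (rule sum.cong) auto
  then show ?case using assms by simp
next
  case (Cons f fs)
  have fin: "finite S" if "S \<subseteq> A" for S using that assms finite_subset by blast
  let ?T = "\<lambda>a S. f a * wd fs S * (sg {a} S * wd (map D (desc_list (insert a S))) T)"
  let ?U = "\<lambda>S a. sg {a} (S - {a}) * f a * wd fs (S - {a}) * wd (map D (desc_list S)) T"
  have "wd (map (\<lambda>f t. \<Sum>a\<in>A. f a * D a t) (f # fs)) T =
      (\<Sum>t\<in>T. \<Sum>a\<in>A. \<Sum>S\<in>Pow A. f a * wd fs S *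
        (sg {t} (T - {t}) * D a t * wd (map D (desc_list S)) (T - {t})))"
  proof -
    have "sg {t} (T - {t}) * (\<Sum>a\<in>A. f a * D a t) *
        (\<Sum>S\<in>Pow A. wd fs S * wd (map D (desc_list S)) (T - {t})) =
      (\<Sum>a\<in>A. \<Sum>S\<in>Pow A. f a * wd fs S *
        (sg {t} (T - {t}) * D a t * wd (map D (desc_list S)) (T - {t})))" for t
      unfolding mult.assoc sum_product by (simp only: sum_distrib_left mult_ac)
    then show ?thesis by (simp add: Cons)
  qed
  also have "\<dots> = (\<Sum>a\<in>A. \<Sum>S\<in>Pow A. \<Sum>t\<in>T. f a * wd fs S *
        (sg {t} (T - {t}) * D a t * wd (map D (desc_list S)) (T - {t})))"
    by (subst sum.swap, intro sum.cong refl, rule sum.swap)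
  also have "\<dots> = (\<Sum>a\<in>A. \<Sum>S\<in>Pow A. f a * wd fs S * wd (D a # map D (desc_list S)) T)"
    by (simp add: sum_distrib_left)
  also have "\<dots> = (\<Sum>a\<in>A. \<Sum>S\<in>Pow (A - {a}). ?T a S)"
  proof (rule sum.cong[OF refl])
    fix a assume a: "a \<in> A"
    show "(\<Sum>S\<in>Pow A. f a * wd fs S * wd (D a # map D (desc_list S)) T) =
        (\<Sum>S\<in>Pow (A - {a}). ?T a S)"
    proof (rule sum.mono_neutral_cong_right)
      show "\<forall>S\<in>Pow A - Pow (A - {a}). f a * wd fs S * wd (D a # map D (desc_list S)) T = 0"
        using fin by (auto simp: wd_insert simp del: wd.simps)
      fix S assume "S \<in> Pow (A - {a})"
      then have "finite S" "a \<notin> S" using fin[of S] by auto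
      then show "f a * wd fs S * wd (D a # map D (desc_list S)) T = ?T a S"
        by (simp add: wd_insert del: wd.simps)
    qed (use assms in auto)
  qed
  also have "\<dots> = (\<Sum>(a, S)\<in>(SIGMA a:A. Pow (A - {a})). ?T a S)"
    by (rule sum.Sigma) (use assms in auto)
  also have "\<dots> = (\<Sum>(S, a)\<in>(SIGMA S:Pow A. S). ?U S a)"
    by (rule sum.reindex_bij_witness[of _ "\<lambda>(S, a). (a, S - {a})" "\<lambda>(a, S). (insert a S, a)"])
       (auto simp: mult_ac dest!: subset_Diff_insert[THEN iffD1])
  also have "\<dots> = (\<Sum>S\<in>Pow A. \<Sum>a\<in>S. ?U S a)"
    by (rule sum.Sigma[symmetric]) (use assms fin in auto)
  also have "\<dots> = (\<Sum>S\<in>Pow A. wd (f # fs) S * wd (map D (desc_list S)) T)"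
    by (simp add: sum_distrib_right)
  finally show ?case .
qed

text \<open>The same determinant with the values at s as an additional first column.\<close>

definition wdc :: "(nat \<Rightarrow> 'a::comm_ring_1) list \<Rightarrow> nat set \<Rightarrow> nat \<Rightarrow> 'a" where
  "wdc fs S s = (if s \<in> S then 0 else sg {s} S * wd fs (insert s S))"

text \<open>Expansion along the row f, the extra column contributing the first term. For s in S the
  column is repeated: on the right only t = s survives in the sum and cancels that term.\<close>

lemma wdc_Cons:
  fixes fs :: "(nat \<Rightarrow> 'a::comm_ring_1) list"
  assumes S: "finite S"
  shows "wdc (f # fs) S s = f s * wd fs S - (\<Sum>t\<in>S. sg {t} (S - {t}) * f t * wdc fs (S - {t}) s)"
proof (cases "s \<in> S")
  case True
  have "(\<Sum>t\<in>S. sg {t} (S - {t}) * f t * wdc fs (S - {t}) s) =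
      (\<Sum>t\<in>S. if t = s then f s * wd fs S else 0)"
    by (rule sum.cong) (use True in \<open>auto simp: wdc_def insert_absorb mult_ac\<close>)
  then show ?thesis using True S by (simp add: wdc_def)
next
  case False
  have "sg {s} S * (sg {t} (insert s S - {t}) * f t * wd fs (insert s S - {t})) =
      - (sg {t} (S - {t}) * f t * wdc fs (S - {t}) s)" if "t \<in> S" for t
  proof -
    have st: "s \<noteq> t" using that False by auto
    have "S = {t} \<union> (S - {t})" using that by auto
    then have 1: "sg {s} S = sg {s} {t} * (sg {s} (S - {t}) :: 'a)"
      using sg_Un_right[of "{t}" "S - {t}" "{s}"] S
      by (metis Diff_disjoint finite.emptyI finite.insertI finite_Diff)
    have i: "insert s S - {t} = insert s (S - {t})" using st by auto
    have 2: "sg {t} (insert s (S - {t})) = sg {t} {s} * (sg {t} (S - {t}) :: 'a)"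
      using sg_Un_right[of "{s}" "S - {t}" "{t}"] S False by simp
    have "sg {s} {t} * sg {t} {s} = (- 1 :: 'a)"
      using sg_singleton_commute[of s t, where 'a='a] st by simp
    moreover have "sg {s} {t} * sg {s} (S - {t}) * (sg {t} {s} * sg {t} (S - {t}) * x) =
        (sg {s} {t} * sg {t} {s}) * (sg {t} (S - {t}) * (sg {s} (S - {t}) * x))" for x :: 'a
      by (simp add: mult_ac)
    ultimately show ?thesis unfolding i using False st
      by (simp add: 1 2 wdc_def mult.assoc)
  qed
  then have "sg {s} S * (\<Sum>t\<in>S. sg {t} (insert s S - {t}) * f t * wd fs (insert s S - {t})) =
      - (\<Sum>t\<in>S. sg {t} (S - {t}) * f t * wdc fs (S - {t}) s)"
    by (simp add: sum_distrib_left sum_negf[symmetric])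
  moreover have "insert s S - {s} = S" using False by auto
  ultimately show ?thesis
    using False S by (simp add: wdc_def distrib_left mult.assoc)
qed

text \<open>For fixed S the determinant is linear in its extra column, so a relation between columns
  that holds in every row passes to the determinants.\<close>

lemma wdc_linear_relation:
  assumes "finite S" "\<And>f. f \<in> set fs \<Longrightarrow> (\<Sum>a\<in>I. c a * f (p a)) = 0"
  shows "(\<Sum>a\<in>I. c a * wdc fs S (p a)) = 0"
  using assms
proof (induction fs arbitrary: S)
  case Nil
  then show ?case by (intro sum.neutral) (simp add: wdc_def)
next
  case (Cons f fs)
  have "(\<Sum>a\<in>I. c a * wdc (f # fs) S (p a)) = (\<Sum>a\<in>I. c a * f (p a)) * wd fs S -
      (\<Sum>t\<in>S. sg {t} (S - {t}) * f t * (\<Sum>a\<in>I. c a * wdc fs (S - {t}) (p a)))"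
  proof -
    have "(\<Sum>a\<in>I. c a * (\<Sum>t\<in>S. sg {t} (S - {t}) * f t * wdc fs (S - {t}) (p a))) =
        (\<Sum>t\<in>S. sg {t} (S - {t}) * f t * (\<Sum>a\<in>I. c a * wdc fs (S - {t}) (p a)))"
      unfolding sum_distrib_left by (subst sum.swap) (simp only: mult_ac)
    then show ?thesis
      unfolding wdc_Cons[OF Cons.prems(1)] right_diff_distrib sum_subtractf
      by (simp only: sum_distrib_right mult.assoc[symmetric])
  qed
  then show ?case using Cons by simp
qed

lemma sg_shift: "sg ((+) m ` S) ((+) m ` T) = sg S T"
proof -
  have "{(s, t). s \<in> (+) m ` S \<and> t \<in> (+) m ` T \<and> s < t} =
      (\<lambda>(s, t). (m + s, m + t)) ` {(s, t). s \<in> S \<and> t \<in> T \<and> s < t}" by auto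
  moreover have "inj_on (\<lambda>(s, t). (m + s, m + t)) X" for X by (auto simp: inj_on_def)
  ultimately show ?thesis by (simp add: sg_def card_image)
qed

lemma wd_shift:
  fixes fs :: "(nat \<Rightarrow> 'a::comm_ring_1) list"
  shows "wd fs ((+) m ` T) = wd (map (\<lambda>f n. f (m + n)) fs) T"
proof (induction fs arbitrary: T)
  case Nil
  then show ?case by simp
next
  case (Cons f fs)
  have "(+) m ` T - {m + s} = (+) m ` (T - {s})" for s by auto
  moreover have "sg {m + s} ((+) m ` (T - {s})) = (sg {s} (T - {s}) :: 'a)" for s
    using sg_shift[of m "{s}" "T - {s}"] by simp
  ultimately show ?case by (simp add: sum.reindex Cons)
qed

lemma wd_scale:
  "wd (map (\<lambda>i n. c i * f i n) xs) T = prod_list (map c xs) * wd (map f xs) T"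
  by (induction xs arbitrary: T) (simp_all add: sum_distrib_left mult_ac)

lemma wd_row_cong:
  assumes "length fs = length gs" "\<And>i t. i < length fs \<Longrightarrow> t \<in> T \<Longrightarrow> (fs ! i) t = (gs ! i) t"
  shows "wd fs T = wd gs T"
  using assms
proof (induction fs gs arbitrary: T rule: list_induct2)
  case (Cons f fs g gs)
  have "wd fs (T - {s}) = wd gs (T - {s})" for s
    by (rule Cons.IH) (use Cons.prems[of "Suc _"] in auto)
  moreover have "f s = g s" if "s \<in> T" for s using Cons.prems[of 0] that by simp
  ultimately show ?case by (simp cong: sum.cong)
qed simp

section \<open>Rows given by power series\<close>

lemma desc_list_atLeast0LessThan: "desc_list {0..<r} = rev [0..<r]"
  by (simp add: desc_list_def)

text \<open>With as many rows as middle indices, only S = A has the right size in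
  Cauchy-Binet.\<close>

lemma wd_square:
  assumes "finite A" "card A = length fs"
  shows "wd (map (\<lambda>f t. \<Sum>a\<in>A. f a * D a t) fs) T = wd fs A * wd (map D (desc_list A)) T"
proof -
  have "wd fs S * wd (map D (desc_list S)) T = 0" if "S \<in> Pow A" "S \<noteq> A" for S
  proof -
    have "card S < card A" using that assms by (intro psubset_card_mono) auto
    then have "wd fs S = 0" using wd_card[of fs S] assms by auto
    then show ?thesis by simp
  qed
  then have "(\<Sum>S\<in>Pow A. wd fs S * wd (map D (desc_list S)) T) =
      (\<Sum>S\<in>{A}. wd fs S * wd (map D (desc_list S)) T)"
    using assms by (intro sum.mono_neutral_right) auto
  then show ?thesis using wd_cauchy_binet[OF assms(1), where fs = fs and D = D and T = T] by simp
qed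

lemma wd_unitriangular:
  assumes "\<And>a. a < r \<Longrightarrow> D a a = 1" "\<And>a t. t < a \<Longrightarrow> a < r \<Longrightarrow> D a t = 0"
  shows "wd (map D (rev [0..<r])) {0..<r} = 1"
  using assms
proof (induction r)
  case 0
  then show ?case by simp
next
  case (Suc r)
  have "wd (map D (rev [0..<Suc r])) {0..<Suc r} =
      (\<Sum>s\<in>{0..<Suc r}. if s = r then 1 else 0)"
    unfolding upt_Suc rev_append
  proof (simp del: sum.delta sum.delta' sum.op_ivl_Suc, rule sum.cong[OF refl])
    fix s assume s: "s \<in> {0..<Suc r}"
    show "sg {s} ({0..<Suc r} - {s}) * D r s * wd (map D (rev [0..<r])) ({0..<Suc r} - {s}) =
        (if s = r then 1 else 0)"
    proof (cases "s = r")
      case True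
      have "{0..<Suc r} - {r} = {0..<r}" by auto
      moreover have "sg {r} {0..<r} = (1::'a)" by (rule sg_one) auto
      ultimately show ?thesis using True Suc by simp
    next
      case False
      then have "s < r" using s by auto
      then show ?thesis using Suc.prems(2)[of s r] by simp
    qed
  qed
  then show ?case by simp
qed

text \<open>For \<open>G = \<Sum>\<^sub>n h\<^sub>n t\<^sup>n\<close> and \<open>T = par_set r lam\<close>, the value \<open>jt G r T\<close> is the Jacobi-Trudi determinant of
  the \<open>h\<^sub>n\<close> for lam.\<close>

definition rho :: "'a::comm_ring_1 fps \<Rightarrow> nat \<Rightarrow> nat \<Rightarrow> 'a" where
  "rho G a t = (if a \<le> t then fps_nth G (t - a) else 0)"

definition jt :: "'a::comm_ring_1 fps \<Rightarrow> nat \<Rightarrow> nat set \<Rightarrow> 'a" where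
  "jt G r T = wd (map (rho G) (rev [0..<r])) T"

lemma jt_card: "jt G r T \<noteq> 0 \<Longrightarrow> finite T \<and> card T = r"
  using wd_card[of "map (rho G) (rev [0..<r])" T] by (simp add: jt_def)

lemma jt_initial: "fps_nth G 0 = 1 \<Longrightarrow> jt G r {0..<r} = 1"
  unfolding jt_def by (rule wd_unitriangular) (simp_all add: rho_def)

text \<open>Multiplying a series by G multiplies its coefficient row by the matrix
  \<open>rho G\<close>, which turns products of series into instances of Cauchy-Binet. A may exceed
  t because \<open>rho\<close> vanishes there.\<close>

lemma fps_mult_nth_rho:
  assumes "finite A" "\<And>a. a \<le> t \<Longrightarrow> a \<notin> A \<Longrightarrow> fps_nth F a = 0"
  shows "fps_nth (F * G) t = (\<Sum>a\<in>A. fps_nth F a * rho G a t)"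
proof -
  have "fps_nth (F * G) t = (\<Sum>a\<in>{0..t}. fps_nth F a * rho G a t)"
    by (simp add: fps_mult_nth rho_def)
  also have "\<dots> = (\<Sum>a\<in>{0..t} \<union> A. fps_nth F a * rho G a t)"
    by (rule sum.mono_neutral_left) (use assms in \<open>auto simp: rho_def\<close>)
  also have "\<dots> = (\<Sum>a\<in>A. fps_nth F a * rho G a t)"
    by (rule sum.mono_neutral_right) (use assms in auto)
  finally show ?thesis .
qed

text \<open>The first coefficients of \<open>F * E\<close> arise from those of F by a unitriangular
  matrix.\<close>

lemma wd_fps_mult_initial:
  assumes "fps_nth E 0 = 1"
  shows "wd (map (\<lambda>F. fps_nth (F * E)) Fs) {0..<length Fs} = wd (map fps_nth Fs) {0..<length Fs}"
proof -
  let ?A = "{0..<length Fs}"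
  have "wd (map (\<lambda>F. fps_nth (F * E)) Fs) ?A =
      wd (map (\<lambda>f t. \<Sum>a\<in>?A. f a * rho E a t) (map fps_nth Fs)) ?A"
    by (rule wd_row_cong) (auto intro!: fps_mult_nth_rho)
  also have "\<dots> = wd (map fps_nth Fs) ?A * jt E (length Fs) ?A"
    by (subst wd_square) (simp_all add: desc_list_atLeast0LessThan jt_def)
  finally show ?thesis using jt_initial[OF assms] by simp
qed

text \<open>The last hypothesis says that the rows obey the linear recurrence of order r with
  characteristic series E.\<close>

lemma wd_recurrent:
  assumes E: "fps_nth E 0 = 1" "E * G = 1" and r: "length Fs = r"
    and Fs: "\<And>F n. F \<in> set Fs \<Longrightarrow> r \<le> n \<Longrightarrow> fps_nth (F * E) n = 0"
  shows "wd (map fps_nth Fs) T = wd (map fps_nth Fs) {0..<r} * jt G r T"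
proof -
  let ?A = "{0..<r}"
  have "wd (map fps_nth Fs) T =
      wd (map (\<lambda>f t. \<Sum>a\<in>?A. f a * rho G a t) (map (\<lambda>F. fps_nth (F * E)) Fs)) T"
  proof (rule wd_row_cong)
    fix i t assume "i < length (map fps_nth Fs)"
    then have i: "i < length Fs" by simp
    \<comment> \<open>\<open>Fs ! i * E\<close> is a polynomial of degree less than r, so
      \<open>F = (F * E) * G\<close> combines just r rows of \<open>rho G\<close>.\<close>
    have "fps_nth (Fs ! i * E * G) t = (\<Sum>a\<in>?A. fps_nth (Fs ! i * E) a * rho G a t)"
      by (rule fps_mult_nth_rho) (use Fs i in auto)
    moreover have "Fs ! i * E * G = Fs ! i" using E(2) by (simp add: mult.assoc)
    ultimately show "(map fps_nth Fs ! i) t =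
        (map (\<lambda>f t. \<Sum>a\<in>?A. f a * rho G a t) (map (\<lambda>F. fps_nth (F * E)) Fs) ! i) t"
      using i by simp
  qed simp
  also have "\<dots> = wd (map (\<lambda>F. fps_nth (F * E)) Fs) ?A * jt G r T"
    by (subst wd_square) (simp_all add: r desc_list_atLeast0LessThan jt_def)
  also have "wd (map (\<lambda>F. fps_nth (F * E)) Fs) ?A = wd (map fps_nth Fs) ?A"
    using wd_fps_mult_initial[OF E(1), of Fs] r by simp
  finally show ?thesis .
qed

section \<open>Geometric series, Vandermonde and Jacobi-Trudi determinants\<close>

definition lin :: "'a::comm_ring_1 \<Rightarrow> 'a fps" where
  "lin x = 1 - fps_const x * fps_X"

definition geo :: "'a::comm_ring_1 \<Rightarrow> 'a fps" where
  "geo x = Abs_fps (\<lambda>n. x ^ n)"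

lemma geo_nth [simp]: "fps_nth (geo x) n = x ^ n"
  by (simp add: geo_def)

lemma lin_nth_0 [simp]: "fps_nth (lin x) 0 = 1"
  by (simp add: lin_def)

lemma mult_lin_nth: "fps_nth (F * lin x) n = fps_nth F n - (if n = 0 then 0 else x * fps_nth F (n - 1))"
proof -
  have "F * lin x = F - fps_X * (fps_const x * F)" by (simp add: lin_def algebra_simps)
  then show ?thesis by (cases n) (simp_all add: fps_X_mult_nth)
qed

lemma geo_mult_lin: "geo x * lin x = 1"
proof (rule fps_ext)
  fix n show "fps_nth (geo x * lin x) n = fps_nth 1 n"
    by (cases n) (simp_all add: mult_lin_nth)
qed

lemma geo_mult_lin_nth_Suc: "fps_nth (geo y * lin x) (Suc n) = (y - x) * y ^ n"
  by (simp add: mult_lin_nth algebra_simps)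

lemma fps_prod_nth_0: "(\<And>i. i \<in> A \<Longrightarrow> fps_nth (f i) 0 = 1) \<Longrightarrow> fps_nth (prod f A) 0 = 1"
  by (induction A rule: infinite_finite_induct) auto

lemma prod_lin_mult_prod_geo: "(\<Prod>j\<in>A. lin (x j)) * (\<Prod>j\<in>A. geo (x j)) = 1"
  by (simp add: prod.distrib[symmetric] geo_mult_lin mult.commute[of "lin _"])

lemma fps_mult_nth_beyond:
  fixes F G :: "'a::ring_1 fps"
  assumes "\<And>n. p < n \<Longrightarrow> fps_nth F n = 0" "\<And>n. q < n \<Longrightarrow> fps_nth G n = 0" "p + q < n"
  shows "fps_nth (F * G) n = 0"
  unfolding fps_mult_nth
proof (rule sum.neutral, rule ballI)
  fix i assume "i \<in> {0..n}"
  then have "p < i \<or> q < n - i" using assms(3) by auto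
  then show "fps_nth F i * fps_nth G (n - i) = 0" using assms by auto
qed

lemma prod_lin_nth_beyond:
  assumes "finite A"
  shows "card A < n \<Longrightarrow> fps_nth (\<Prod>j\<in>A. lin (x j)) n = 0"
  using assms
proof (induction A arbitrary: n rule: finite_induct)
  case empty
  then show ?case by simp
next
  case (insert a A)
  have "fps_nth (lin (x a)) n = 0" if "1 < n" for n
    using that by (simp add: lin_def)
  then show ?case using insert by (auto intro: fps_mult_nth_beyond[of 1 _ "card A"])
qed

text \<open>Multiplying all rows by \<open>lin x\<close> turns the row of x into the unit vector at
  column 0 and the row of y, from column 1 on, into (y - x) times the powers of y.\<close>

lemma wd_powers_Cons:
  fixes x :: "'a::comm_ring_1"
  shows "wd (map (\<lambda>y n. y ^ n) (x # ys)) {0..<Suc (length ys)} =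
    prod_list (map (\<lambda>y. x - y) ys) * wd (map (\<lambda>y n. y ^ n) ys) {0..<length ys}"
proof -
  let ?k = "length ys" and ?r = "\<lambda>y. fps_nth (geo y * lin x)"
  have "wd (map (\<lambda>y n. y ^ n) (x # ys)) {0..<Suc ?k} = wd (map fps_nth (map geo (x # ys))) {0..<Suc ?k}"
    by (rule wd_row_cong) (auto simp: nth_Cons split: nat.splits)
  also have "\<dots> = wd (map ?r (x # ys)) {0..<Suc ?k}"
    using wd_fps_mult_initial[of "lin x" "map geo (x # ys)"] by (simp add: comp_def del: wd.simps)
  also have "\<dots> = (\<Sum>s\<in>{0..<Suc ?k}. if s = 0 then sg {0} ({0..<Suc ?k} - {0}) * wd (map ?r ys) ({0..<Suc ?k} - {0}) else 0)"
    by (simp add: geo_mult_lin del: sum.op_ivl_Suc sum.delta sum.delta') (intro sum.cong, auto)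
  also have "\<dots> = sg {0} ({0..<Suc ?k} - {0}) * wd (map ?r ys) ({0..<Suc ?k} - {0})"
    by simp
  also have "{0..<Suc ?k} - {0} = (+) 1 ` {0..<?k}" by auto
  \<comment> \<open>Column 0 is the last one in decreasing order; the resulting sign turns the
    factors y - x into x - y.\<close>
  also have "sg {0} ((+) 1 ` {0..<?k}) = ((- 1) ^ ?k :: 'a)"
  proof -
    have "{(s, t). s \<in> {0::nat} \<and> t \<in> (+) 1 ` {0..<?k} \<and> s < t} = (\<lambda>i. (0, Suc i)) ` {0..<?k}"
      by (auto simp: image_iff Bex_def gr0_conv_Suc)
    then show ?thesis by (simp add: sg_def card_image inj_on_def)
  qed
  also have "wd (map ?r ys) ((+) 1 ` {0..<?k}) = wd (map (\<lambda>y n. (y - x) * y ^ n) ys) {0..<?k}"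
    unfolding wd_shift by (simp add: comp_def geo_mult_lin_nth_Suc)
  also have "\<dots> = prod_list (map (\<lambda>y. y - x) ys) * wd (map (\<lambda>y n. y ^ n) ys) {0..<?k}"
    by (rule wd_scale)
  also have "(- 1) ^ ?k * (prod_list (map (\<lambda>y. y - x) ys) * c) = prod_list (map (\<lambda>y. x - y) ys) * c" for c
  proof -
    have "(- 1) ^ ?k * prod_list (map (\<lambda>y. y - x) ys) = prod_list (map (\<lambda>y. x - y) ys)"
    proof (induction ys)
      case (Cons y ys)
      have "(- 1) ^ length (y # ys) * prod_list (map (\<lambda>y. y - x) (y # ys)) =
          (x - y) * ((- 1) ^ length ys * prod_list (map (\<lambda>y. y - x) ys))"
        by (simp add: algebra_simps)
      then show ?case by (simp only: Cons.IH list.map prod_list.Cons)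
    qed simp
    then show ?thesis by (simp only: mult.assoc[symmetric])
  qed
  finally show ?thesis .
qed

definition vand :: "nat \<Rightarrow> (nat \<Rightarrow> 'a::comm_ring_1) \<Rightarrow> 'a" where
  "vand k x = (\<Prod>j\<in>{1..k}. \<Prod>i\<in>{1..<j}. x j - x i)"

text \<open>Variables and exponents both run downwards, so no sign appears.\<close>

lemma wd_vandermonde:
  "wd (map (\<lambda>j n. x j ^ n) (rev [1..<Suc k])) {0..<k} = vand k x"
proof (induction k)
  case 0
  then show ?case by (simp add: vand_def)
next
  case (Suc k)
  have "wd (map (\<lambda>j n. x j ^ n) (rev [1..<Suc (Suc k)])) {0..<Suc k} =
      wd (map (\<lambda>y n. y ^ n) (x (Suc k) # map x (rev [1..<Suc k]))) {0..<Suc k}"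
    by (simp add: comp_def del: wd.simps)
  also have "\<dots> = prod_list (map (\<lambda>i. x (Suc k) - x i) (rev [1..<Suc k])) * vand k x"
    using wd_powers_Cons[of "x (Suc k)" "map x (rev [1..<Suc k])"] Suc
    by (simp add: comp_def del: wd.simps upt_Suc)
  also have "prod_list (map (\<lambda>i. x (Suc k) - x i) (rev [1..<Suc k])) = (\<Prod>i\<in>{1..<Suc k}. x (Suc k) - x i)"
    by (simp only: prod.distinct_set_conv_list[symmetric] distinct_rev distinct_upt set_rev set_upt)
  also have "\<dots> * vand k x = vand (Suc k) x"
    by (simp add: vand_def mult.commute)
  finally show ?case .
qed

text \<open>The product of the \<open>geo (x j)\<close> generates the complete homogeneous
  polynomials. Each row of powers obeys the recurrence with characteristic series the product of the
  \<open>lin (x j)\<close>: its own factor cancels and leaves degree at most k - 1.\<close>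

lemma jacobi_trudi:
  "wd (map (\<lambda>j n. x j ^ n) (rev [1..<Suc k])) T = vand k x * jt (\<Prod>j\<in>{1..k}. geo (x j)) k T"
proof -
  let ?F = "map (\<lambda>j. geo (x j)) (rev [1..<Suc k])"
  have *: "map fps_nth ?F = map (\<lambda>j n. x j ^ n) (rev [1..<Suc k])"
    by (simp only: map_map comp_def) (rule map_cong[OF refl], simp add: fun_eq_iff)
  have "wd (map fps_nth ?F) T = wd (map fps_nth ?F) {0..<k} * jt (\<Prod>j\<in>{1..k}. geo (x j)) k T"
  proof (rule wd_recurrent[where E = "\<Prod>j\<in>{1..k}. lin (x j)"])
    fix F n assume F: "F \<in> set ?F" and n: "k \<le> n"
    then obtain j where j: "j \<in> {1..k}" "F = geo (x j)" by force
    have "F * (\<Prod>j\<in>{1..k}. lin (x j)) = (geo (x j) * lin (x j)) * (\<Prod>j\<in>{1..k} - {j}. lin (x j))"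
      using j by (subst prod.remove[of _ j]) (auto simp: mult.assoc)
    also have "\<dots> = (\<Prod>j\<in>{1..k} - {j}. lin (x j))" by (simp add: geo_mult_lin)
    finally show "fps_nth (F * (\<Prod>j\<in>{1..k}. lin (x j))) n = 0"
      using j n by (simp only:) (rule prod_lin_nth_beyond, auto)
  qed (auto simp: fps_prod_nth_0 prod_lin_mult_prod_geo)
  then show ?thesis unfolding * wd_vandermonde .
qed

section \<open>Giambelli's formula\<close>

lemma scaleQ_add_right: "c *\<^sub>Q (u + v) = c *\<^sub>Q u + c *\<^sub>Q v"
  by (rule ext_eqI) (simp add: algebra_simps)

lemma scaleQ_zero_right [simp]: "c *\<^sub>Q 0 = 0"
  by (rule ext_eqI) simp

lemma scaleQ_sum_left: "sum c A *\<^sub>Q u = (\<Sum>a\<in>A. c a *\<^sub>Q u)"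
  by (induction A rule: infinite_finite_induct) (simp_all add: scaleQ_add_left)

text \<open>Words in the \<open>bV n\<close>, sorted or not, are built up one letter at a time,
  which keeps signs out of the inductions.\<close>

lemma ext_induct [case_names one gen scale add]:
  assumes "P 1" "\<And>n u. P u \<Longrightarrow> P (bV n * u)" "\<And>c u. P u \<Longrightarrow> P (c *\<^sub>Q u)"
    "\<And>u v. P u \<Longrightarrow> P v \<Longrightarrow> P (u + v)"
  shows "P u"
proof -
  have P0: "P 0" using assms(3)[OF assms(1), of 0] by simp
  have "P (prod_list (map bV ns))" for ns
    by (induction ns) (use assms in auto)
  then have "P (egen_set S)" for S by (simp add: egen_set_def)
  then have "P (\<Sum>S\<in>K. ecoeff u S *\<^sub>Q egen_set S)" for K
    by (induction K rule: infinite_finite_induct) (use assms(3,4) P0 in auto)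
  moreover have "u = (\<Sum>S | ecoeff u S \<noteq> 0. ecoeff u S *\<^sub>Q egen_set S)"
    using finite_ecoeff ecoeff_infinite by (intro ext_expansion) auto
  ultimately show ?thesis by metis
qed

lemma bV_mult_egen_set:
  assumes "finite S"
  shows "bV n * egen_set S = (if n \<in> S then 0 else sg {n} S *\<^sub>Q egen_set (insert n S))"
  using egen_set_times[of "{n}" S] assms by (simp add: esgn_eq_sg egen_set_def)

text \<open>The coefficient without the sign (-1)^i that \<open>sigma_bar\<close> carries; it is the
  action of the i-th coefficient of E_m, see \<open>B_act_E_ser\<close>.\<close>

definition sb :: "nat \<Rightarrow> ext \<Rightarrow> ext" where
  "sb i u = fps_nth (sigma_bar_plus u) i"

lemma sb_add: "sb i (u + v) = sb i u + sb i v"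
  by (simp add: sb_def sigma_bar_plus_def mult_ext_add)

lemma sb_scaleQ: "sb i (c *\<^sub>Q u) = c *\<^sub>Q sb i u"
  by (simp add: sb_def sigma_bar_plus_def mult_ext_scaleQ)

lemma sb_zero [simp]: "sb i 0 = 0"
  using sb_scaleQ[of i 0 0] by simp

lemma sb_uminus: "sb i (- u) = - sb i u"
  using sb_scaleQ[of i "-1" u] by simp

lemma sb_diff: "sb i (u - v) = sb i u - sb i v"
  using sb_add[of i u "- v"] by (simp add: sb_uminus)

lemma sb_one: "sb i 1 = (if i = 0 then 1 else 0)"
  by (simp add: sb_def schubert_one)

lemma sb_bV_mult:
  "sb 0 (bV n * u) = bV n * sb 0 u"
  "sb (Suc i) (bV n * u) = bV n * sb (Suc i) u - bV (Suc n) * sb i u"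
proof -
  have "sigma_bar_plus (bV n * u) = fps_const (bV n) * sigma_bar_plus u -
      fps_const (bV (Suc n)) * (fps_X * sigma_bar_plus u)"
    by (simp add: schubert_mult schubert_bV bZ_def nat_add_distrib algebra_simps)
  then show "sb 0 (bV n * u) = bV n * sb 0 u"
    "sb (Suc i) (bV n * u) = bV n * sb (Suc i) u - bV (Suc n) * sb i u"
    by (simp_all add: sb_def)
qed

lemma sb_0 [simp]: "sb 0 u = u"
  by (induction u rule: ext_induct) (simp_all add: sb_one sb_bV_mult sb_scaleQ sb_add)

lemma sb_commute: "sb i (sb j u) = sb j (sb i u)"
proof (induction u arbitrary: i j rule: ext_induct)
  case (gen n u)
  show ?case
    using gen by (cases i; cases j) (simp_all add: sb_bV_mult sb_diff algebra_simps)
qed (simp_all add: sb_one sb_scaleQ sb_add)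

lemma sb_beyond_degree: "length ns < i \<Longrightarrow> sb i (prod_list (map bV ns)) = 0"
proof (induction ns arbitrary: i)
  case Nil
  then show ?case by (simp add: sb_one)
next
  case (Cons n ns)
  then show ?case by (cases i) (simp_all add: sb_bV_mult)
qed

text \<open>The sum telescopes since \<open>sb a (b\<^sub>s\<^sub>-\<^sub>a \<and> u) = b\<^sub>s\<^sub>-\<^sub>a \<and> sb a u - b\<^sub>s\<^sub>-\<^sub>a\<^sub>+\<^sub>1 \<and> sb (a-1) u\<close>.\<close>

lemma sb_recurrence:
  assumes "length ns < m" "m \<le> s"
  shows "(\<Sum>a\<le>m. sb a (bV (s - a) * prod_list (map bV ns))) = 0"
proof -
  let ?u = "prod_list (map bV ns)"
  have "(\<Sum>a\<le>n. sb a (bV (s - a) * ?u)) = bV (s - n) * sb n ?u" if "n \<le> s" for n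
    using that
  proof (induction n)
    case (Suc n)
    then have "Suc (s - Suc n) = s - n" by simp
    then show ?case using Suc by (simp add: sb_bV_mult)
  qed simp
  from this[OF assms(2)] show ?thesis using sb_beyond_degree[OF assms(1)] by simp
qed

section \<open>The action of polynomials in the e_i on the exterior algebra\<close>

lemma sigma_bar_eq_sb: "sigma_bar i u = (- 1) ^ i *\<^sub>Q sb i u"
  by (simp add: sigma_bar_def sb_def)

lemma sigma_bar_linear:
  "sigma_bar i (u + v) = sigma_bar i u + sigma_bar i v"
  "sigma_bar i (c *\<^sub>Q u) = c *\<^sub>Q sigma_bar i u"
  by (simp_all add: sigma_bar_eq_sb sb_add sb_scaleQ scaleQ_add_right mult.commute)

lemma sigma_bar_commute: "sigma_bar i (sigma_bar j u) = sigma_bar j (sigma_bar i u)"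
  by (simp add: sigma_bar_eq_sb sb_scaleQ sb_commute[of i j] mult.commute)

lemma funpow_commute: "(\<And>u. f (g u) = g (f u)) \<Longrightarrow> (f ^^ n) (g u) = g ((f ^^ n) u)"
  by (induction n arbitrary: u) simp_all

lemma foldr_funpow_commute:
  assumes "\<And>i u. f i (g u) = g (f i u)"
  shows "foldr (\<lambda>i. f i ^^ p i) xs (g u) = g (foldr (\<lambda>i. f i ^^ p i) xs u)"
proof (induction xs)
  case (Cons x xs)
  have "(f x ^^ n) (g v) = g ((f x ^^ n) v)" for n v
    by (rule funpow_commute) (rule assms)
  then show ?case by (simp add: Cons)
qed simp

lemma foldr_funpow_add:
  assumes "\<And>i j u. f i (f j u) = f j (f i u)"
  shows "foldr (\<lambda>i. f i ^^ (p i + q i)) xs u =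
    foldr (\<lambda>i. f i ^^ p i) xs (foldr (\<lambda>i. f i ^^ q i) xs u)"
proof (induction xs)
  case (Cons x xs)
  have c: "f i ((f x ^^ n) v) = (f x ^^ n) (f i v)" for i n v
    by (rule funpow_commute[symmetric]) (rule assms)
  have "foldr (\<lambda>i. f i ^^ p i) xs ((f x ^^ n) v) = (f x ^^ n) (foldr (\<lambda>i. f i ^^ p i) xs v)" for n v
    by (rule foldr_funpow_commute) (rule c)
  then show ?case using Cons.IH by (simp add: funpow_add comp_def)
qed simp

lemma foldr_funpow_linear:
  fixes f :: "nat \<Rightarrow> ext \<Rightarrow> ext"
  assumes "\<And>i u v. f i (u + v) = f i u + f i v" "\<And>i c u. f i (c *\<^sub>Q u) = c *\<^sub>Q f i u"
  shows "foldr (\<lambda>i. f i ^^ p i) xs (u + v) = foldr (\<lambda>i. f i ^^ p i) xs u + foldr (\<lambda>i. f i ^^ p i) xs v"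
    "foldr (\<lambda>i. f i ^^ p i) xs (c *\<^sub>Q u) = c *\<^sub>Q foldr (\<lambda>i. f i ^^ p i) xs u"
proof -
  have "(f i ^^ n) (u + v) = (f i ^^ n) u + (f i ^^ n) v" for i n u v
    by (induction n) (simp_all add: assms)
  then show "foldr (\<lambda>i. f i ^^ p i) xs (u + v) =
      foldr (\<lambda>i. f i ^^ p i) xs u + foldr (\<lambda>i. f i ^^ p i) xs v"
    by (induction xs) simp_all
  have "(f i ^^ n) (c *\<^sub>Q u) = c *\<^sub>Q (f i ^^ n) u" for i n u
    by (induction n) (simp_all add: assms)
  then show "foldr (\<lambda>i. f i ^^ p i) xs (c *\<^sub>Q u) = c *\<^sub>Q foldr (\<lambda>i. f i ^^ p i) xs u"
    by (induction xs) simp_all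
qed

lemma B_act_mono_add: "B_act_mono m (a + b) u = B_act_mono m a (B_act_mono m b u)"
  unfolding B_act_mono_def lookup_add by (rule foldr_funpow_add) (rule sigma_bar_commute)

lemma B_act_mono_linear:
  "B_act_mono m a (u + v) = B_act_mono m a u + B_act_mono m a v"
  "B_act_mono m a (c *\<^sub>Q u) = c *\<^sub>Q B_act_mono m a u"
  unfolding B_act_mono_def by (rule foldr_funpow_linear; rule sigma_bar_linear)+

lemma B_act_mono_zero [simp]: "B_act_mono m 0 u = u"
proof -
  have "foldr (\<lambda>i::nat. f i ^^ 0) xs u = u" for f :: "nat \<Rightarrow> ext \<Rightarrow> ext" and xs
    by (induction xs) simp_all
  then show ?thesis by (simp add: B_act_mono_def)
qed

lemma B_act_mono_single:
  assumes "i \<in> {1..m}"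
  shows "B_act_mono m (Poly_Mapping.single i 1) u = sigma_bar i u"
proof -
  have "foldr (\<lambda>j. sigma_bar j ^^ Poly_Mapping.lookup (Poly_Mapping.single i 1) j) xs u =
      (if i \<in> set xs then sigma_bar i u else u)" if "distinct xs" for xs
    using that by (induction xs) (auto simp: lookup_single when_def)
  then show ?thesis using assms by (simp add: B_act_mono_def del: upt_Suc)
qed

lemma B_act_superset:
  assumes "finite K" "Poly_Mapping.keys p \<subseteq> K"
  shows "B_act m p u = (\<Sum>a\<in>K. Poly_Mapping.lookup p a *\<^sub>Q B_act_mono m a u)"
  unfolding B_act_def
  by (rule sum.mono_neutral_left) (use assms in \<open>auto simp: in_keys_iff\<close>)

lemma B_act_add: "B_act m (p + q) u = B_act m p u + B_act m q u"
proof -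
  let ?K = "Poly_Mapping.keys p \<union> Poly_Mapping.keys q"
  have K: "finite ?K" by simp
  show ?thesis
    by (subst (1 2 3) B_act_superset[OF K])
       (use Poly_Mapping.keys_add[of p q] in \<open>auto simp: lookup_add scaleQ_add_left sum.distrib\<close>)
qed

lemma B_act_single: "B_act m (Poly_Mapping.single a c) u = c *\<^sub>Q B_act_mono m a u"
  by (subst B_act_superset[of "{a}"]) (auto split: if_splits)

lemma B_act_zero [simp]: "B_act m 0 u = 0"
  by (simp add: B_act_def)

lemma B_act_one [simp]: "B_act m 1 u = u"
  using B_act_single[of m 0 1 u] by simp

lemma B_act_sum: "B_act m (sum f A) u = (\<Sum>a\<in>A. B_act m (f a) u)"
  by (induction A rule: infinite_finite_induct) (simp_all add: B_act_add)

lemma B_act_uminus: "B_act m (- p) u = - B_act m p u"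
  using B_act_add[of m p "- p" u] by (simp add: eq_neg_iff_add_eq_0 add.commute)

lemma B_act_linear:
  "B_act m p (u + v) = B_act m p u + B_act m p v"
  "B_act m p (c *\<^sub>Q u) = c *\<^sub>Q B_act m p u"
  by (simp_all add: B_act_def B_act_mono_linear scaleQ_add_right sum.distrib scaleQ_sum_right mult.commute)

lemma poly_mapping_sum_single: "p = (\<Sum>a\<in>Poly_Mapping.keys p. Poly_Mapping.single a (Poly_Mapping.lookup p a))"
  by (rule poly_mapping_eqI) (auto simp: lookup_sum lookup_single when_def in_keys_iff)

lemma B_act_mult: "B_act m (p * q) u = B_act m p (B_act m q u)"
proof -
  let ?s = "\<lambda>p a. Poly_Mapping.single a (Poly_Mapping.lookup p a)"
  have "p * q = (\<Sum>a\<in>Poly_Mapping.keys p. \<Sum>b\<in>Poly_Mapping.keys q. ?s p a * ?s q b)"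
    by (subst (1) poly_mapping_sum_single[of p], subst (1) poly_mapping_sum_single[of q])
       (rule sum_product)
  then have "B_act m (p * q) u = (\<Sum>a\<in>Poly_Mapping.keys p. \<Sum>b\<in>Poly_Mapping.keys q. B_act m (?s p a * ?s q b) u)"
    by (simp only: B_act_sum)
  also have "\<dots> = (\<Sum>a\<in>Poly_Mapping.keys p. Poly_Mapping.lookup p a *\<^sub>Q B_act_mono m a (B_act m q u))"
  proof (rule sum.cong[OF refl])
    fix a
    have 0: "B_act_mono m a 0 = 0" using B_act_mono_linear(2)[of m a 0 0] by simp
    have "B_act_mono m a (sum f A) = (\<Sum>b\<in>A. B_act_mono m a (f b))" for f :: "(nat \<Rightarrow>\<^sub>0 nat) \<Rightarrow> ext" and A
      by (induction A rule: infinite_finite_induct) (simp_all add: B_act_mono_linear 0)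
    then show "(\<Sum>b\<in>Poly_Mapping.keys q. B_act m (?s p a * ?s q b) u) =
        Poly_Mapping.lookup p a *\<^sub>Q B_act_mono m a (B_act m q u)"
      unfolding B_act_def[of m q u]
      by (simp add: mult_single B_act_single B_act_mono_add B_act_mono_linear scaleQ_sum_right)
  qed
  also have "\<dots> = B_act m p (B_act m q u)" by (simp add: B_act_def)
  finally show ?thesis .
qed

lemma B_act_sg_mult: "B_act m (sg S T * p) u = sg S T *\<^sub>Q B_act m p u"
proof -
  have "B_act m ((- 1) ^ n * p) u = (- 1) ^ n *\<^sub>Q B_act m p u" for n
    by (cases "even n") (simp_all add: B_act_uminus)
  then show ?thesis by (simp add: sg_def)
qed

text \<open>The signs in \<open>E_ser\<close> and in \<open>sigma_bar\<close> cancel.\<close>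

lemma B_act_E_ser: "B_act m (fps_nth (E_ser m) i) u = (if i \<le> m then sb i u else 0)"
proof (cases "i \<le> m")
  case True
  have "B_act m (e_var i) u = (- 1) ^ i *\<^sub>Q sb i u"
  proof (cases "i = 0")
    case False
    then show ?thesis
      using True B_act_mono_single[of i m u] by (simp add: e_var_def B_act_single sigma_bar_eq_sb)
  qed (simp add: e_var_def)
  then have "B_act m ((- 1) ^ i * e_var i) u = sb i u"
    by (cases "even i") (simp_all add: B_act_uminus)
  then show ?thesis using True by (simp add: E_ser_def)
qed (simp add: E_ser_def)

definition H_ser :: "nat \<Rightarrow> bpoly fps" where
  "H_ser m = Abs_fps (\<lambda>j. H_seq m (int j))"

lemma E_ser_mult_H_ser: "E_ser m * H_ser m = 1"
  unfolding H_ser_def by (rule E_ser_inverse)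

lemma E_ser_nth_0 [simp]: "fps_nth (E_ser m) 0 = 1"
  by (simp add: E_ser_def e_var_def)

lemma E_ser_beyond: "m < n \<Longrightarrow> fps_nth (E_ser m) n = 0"
  by (simp add: E_ser_def)

lemma H_ser_nth_0 [simp]: "fps_nth (H_ser m) 0 = 1"
  using arg_cong[OF E_ser_mult_H_ser[of m], of "\<lambda>f. fps_nth f 0"] by simp

lemma rho_eq_shift: "rho G a t = fps_nth (fps_X ^ a * G) t"
  by (simp add: rho_def fps_X_power_mult_nth)

text \<open>Both sides obey the recurrence of \<open>sb_recurrence\<close> in the largest element of S, which
  reduces the claim to sets with a smaller sum.\<close>

lemma giambelli:
  assumes "finite S" "card S = m"
  shows "B_act m (jt (H_ser m) m S) (egen_set {0..<m}) = egen_set S"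
  using assms
proof (induction "\<Sum>S" arbitrary: S rule: less_induct)
  case less
  show ?case
  proof (cases "S \<subseteq> {0..<m}")
    case True
    then have "S = {0..<m}" using less.prems by (simp add: card_subset_eq)
    then show ?thesis by (simp add: jt_initial)
  next
    case False
    define s where "s = Max S"
    have "S \<noteq> {}" using False by auto
    then have sS: "s \<in> S" "\<And>t. t \<in> S \<Longrightarrow> t \<le> s"
      using less.prems by (auto simp: s_def)
    have sm: "m \<le> s" using False sS by (metis atLeastLessThan_iff le_less_trans linorder_not_le subsetI zero_le)
    define S' where "S' = S - {s}"
    have S': "finite S'" "s \<notin> S'" "insert s S' = S" "Suc (card S') = m"
      using less.prems sS card_Suc_Diff1[of S s] by (auto simp: S'_def simp del: card_Diff_insert)
    define b where "b = egen_set {0..<m}"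
    define R where "R = map (rho (H_ser m)) (rev [0..<m])"
    let ?c = "\<lambda>t. B_act m (wdc R S' t) b"
    \<comment> \<open>Replacing s by s - a lowers the sum of the set, so the induction hypothesis
      applies; if s - a already lies in S', both sides are 0.\<close>
    have c: "?c (s - a) = bV (s - a) * egen_set S'" if "1 \<le> a" "a \<le> m" for a
    proof (cases "s - a \<in> S'")
      case True
      then show ?thesis using S' by (simp add: wdc_def bV_mult_egen_set)
    next
      case False
      have "\<Sum>S = s + \<Sum>S'" using S'(1,2) by (subst S'(3)[symmetric]) simp
      then have "\<Sum>(insert (s - a) S') < \<Sum>S" using S'(1) False that sm by simp
      then have "B_act m (jt (H_ser m) m (insert (s - a) S')) b = egen_set (insert (s - a) S')"
        unfolding b_def using S' False by (intro less.hyps) auto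
      then show ?thesis
        using S' False by (simp add: wdc_def B_act_sg_mult bV_mult_egen_set jt_def R_def)
    qed
    \<comment> \<open>The row is X^i H_m, so the sum is the coefficient of X^s in X^i E_m H_m = X^i,
      which vanishes as i < m \<le> s.\<close>
    have "(\<Sum>a\<le>m. fps_nth (E_ser m) a * f (s - a)) = 0" if f: "f \<in> set R" for f
    proof -
      obtain i where i: "i < m" "f = rho (H_ser m) i" using f by (auto simp: R_def)
      have "(\<Sum>a\<le>m. fps_nth (E_ser m) a * f (s - a)) =
          (\<Sum>a=0..s. fps_nth (E_ser m) a * fps_nth (fps_X ^ i * H_ser m) (s - a))"
        using sm by (intro sum.mono_neutral_cong_left) (auto simp: E_ser_beyond i rho_eq_shift)
      also have "\<dots> = fps_nth (fps_X ^ i * (E_ser m * H_ser m)) s"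
        by (simp add: fps_mult_nth[symmetric] mult_ac)
      also have "\<dots> = 0" using i sm by (simp add: E_ser_mult_H_ser)
      finally show ?thesis .
    qed
    then have "(\<Sum>a\<le>m. fps_nth (E_ser m) a * wdc R S' (s - a)) = 0"
      by (rule wdc_linear_relation[OF S'(1)])
    then have "0 = B_act m (\<Sum>a\<le>m. fps_nth (E_ser m) a * wdc R S' (s - a)) b" by simp
    \<comment> \<open>Applied to b, the coefficients of the relation act as the operators
      \<open>sb a\<close>, and every term but a = 0 is known.\<close>
    also have "\<dots> = (\<Sum>a\<le>m. sb a (?c (s - a)))"
      unfolding B_act_sum by (intro sum.cong refl) (simp add: B_act_mult B_act_E_ser)
    also have "\<dots> = ?c s + (\<Sum>a=1..m. sb a (?c (s - a)))"
      by (simp add: sum.atMost_shift sum.atLeast1_atMost_eq)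
    also have "(\<Sum>a=1..m. sb a (?c (s - a))) = (\<Sum>a=1..m. sb a (bV (s - a) * egen_set S'))"
      by (intro sum.cong refl) (simp add: c)
    \<comment> \<open>The wedge products obey the same relation, so the terms a = 0 agree as
      well.\<close>
    also have "(\<Sum>a=1..m. sb a (bV (s - a) * egen_set S')) = - (bV s * egen_set S')"
    proof -
      have "(\<Sum>a\<le>m. sb a (bV (s - a) * egen_set S')) = 0"
        unfolding egen_set_def by (rule sb_recurrence) (use S' sm in auto)
      then show ?thesis
        by (simp add: sum.atMost_shift sum.atLeast1_atMost_eq eq_neg_iff_add_eq_0 add.commute)
    qed
    finally have "?c s = bV s * egen_set S'" by simp
    moreover have "sg {s} S' = (1::rat)" "sg {s} S' = (1::bpoly)"
      by (rule sg_one; use sS S'_def in auto)+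
    ultimately show ?thesis
      using S' by (simp add: wdc_def bV_mult_egen_set jt_def R_def b_def)
  qed
qed

section \<open>Partitions, Schur polynomials and contractions\<close>

lemma B_ring_add: "p \<in> B_ring m \<Longrightarrow> q \<in> B_ring m \<Longrightarrow> p + q \<in> B_ring m"
  using Poly_Mapping.keys_add[of p q] by (auto simp: B_ring_def)

lemma B_ring_single: "Poly_Mapping.keys a \<subseteq> {1..m} \<Longrightarrow> Poly_Mapping.single a c \<in> B_ring m"
  by (auto simp: B_ring_def split: if_splits)

lemma B_ring_const: "Poly_Mapping.single 0 c \<in> B_ring m"
  by (rule B_ring_single) simp

lemma B_ring_0_1 [simp]: "0 \<in> B_ring m" "1 \<in> B_ring m"
  by (auto simp: B_ring_def)

lemma B_ring_mult: "p \<in> B_ring m \<Longrightarrow> q \<in> B_ring m \<Longrightarrow> p * q \<in> B_ring m"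
  unfolding B_ring_def
proof (safe)
  fix c i
  assume p: "\<forall>a\<in>Poly_Mapping.keys p. Poly_Mapping.keys a \<subseteq> {1..m}"
    and q: "\<forall>a\<in>Poly_Mapping.keys q. Poly_Mapping.keys a \<subseteq> {1..m}"
    and c: "c \<in> Poly_Mapping.keys (p * q)" "i \<in> Poly_Mapping.keys c"
  then obtain a b where "a \<in> Poly_Mapping.keys p" "b \<in> Poly_Mapping.keys q" "c = a + b"
    using keys_mult[of p q] by blast
  then show "i \<in> {1..m}" using p q c Poly_Mapping.keys_add[of a b] by blast
qed

lemma B_ring_uminus: "p \<in> B_ring m \<Longrightarrow> - p \<in> B_ring m"
  by (auto simp: B_ring_def in_keys_iff)

lemma B_ring_sum: "(\<And>i. i \<in> A \<Longrightarrow> f i \<in> B_ring m) \<Longrightarrow> sum f A \<in> B_ring m"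
  by (induction A rule: infinite_finite_induct) (auto intro: B_ring_add)

lemma B_ring_neg_one_power: "(- 1) ^ n \<in> B_ring m"
  by (induction n) (auto intro: B_ring_mult B_ring_uminus)

lemma B_ring_E_ser: "fps_nth (E_ser m) i \<in> B_ring m"
proof -
  have "e_var i \<in> B_ring m" if "i \<le> m"
    using that by (auto simp: e_var_def intro!: B_ring_single)
  then show ?thesis by (auto simp: E_ser_def intro!: B_ring_mult B_ring_neg_one_power)
qed

lemma B_ring_H_ser: "fps_nth (H_ser m) n \<in> B_ring m"
proof (induction n rule: less_induct)
  case (less n)
  show ?case
  proof (cases n)
    case (Suc l)
    have "0 = fps_nth (E_ser m * H_ser m) n" using Suc by (simp add: E_ser_mult_H_ser)
    also have "\<dots> = fps_nth (H_ser m) n + (\<Sum>i=1..n. fps_nth (E_ser m) i * fps_nth (H_ser m) (n - i))"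
      by (simp add: fps_mult_nth sum.atLeast_Suc_atMost)
    finally have "fps_nth (H_ser m) n = - (\<Sum>i=1..n. fps_nth (E_ser m) i * fps_nth (H_ser m) (n - i))"
      by (simp add: eq_neg_iff_add_eq_0)
    also have "\<dots> \<in> B_ring m"
      by (intro B_ring_uminus B_ring_sum B_ring_mult B_ring_E_ser less.IH) auto
    finally show ?thesis .
  qed simp
qed

lemma B_ring_wd: "(\<And>f t. f \<in> set fs \<Longrightarrow> f t \<in> B_ring m) \<Longrightarrow> wd fs T \<in> B_ring m"
  by (induction fs arbitrary: T)
     (auto simp: sg_def intro!: B_ring_sum B_ring_mult B_ring_neg_one_power)

lemma B_ring_jt: "jt (H_ser m) m T \<in> B_ring m"
  unfolding jt_def by (rule B_ring_wd) (auto simp: rho_def B_ring_H_ser)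

text \<open>\<open>E_B\<close> chooses a preimage by \<open>inv_into\<close>; acting with it returns
  the given element once a preimage in \<open>B_ring m\<close> exists. Giambelli's formula provides
  one on each basis vector.\<close>

lemma B_act_surj:
  assumes "u \<in> ext_deg m"
  shows "u \<in> (\<lambda>q. B_act m q (egen_set {0..<m})) ` B_ring m"
proof -
  let ?K = "{S. ecoeff u S \<noteq> 0}"
  define q where "q = (\<Sum>S\<in>?K. Poly_Mapping.single 0 (ecoeff u S) * jt (H_ser m) m S)"
  have K: "finite ?K" "\<And>S. S \<in> ?K \<Longrightarrow> finite S \<and> card S = m"
    using assms finite_ecoeff ecoeff_infinite by (auto simp: ext_deg_def)
  have "B_act m q (egen_set {0..<m}) = (\<Sum>S\<in>?K. ecoeff u S *\<^sub>Q egen_set S)"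
    unfolding q_def B_act_sum
    by (intro sum.cong refl) (use K in \<open>simp add: B_act_mult B_act_single giambelli\<close>)
  also have "\<dots> = u"
    using K by (intro ext_expansion[symmetric]) auto
  finally have "u = B_act m q (egen_set {0..<m})" ..
  moreover have "q \<in> B_ring m"
    unfolding q_def by (intro B_ring_sum B_ring_mult B_ring_const B_ring_jt)
  ultimately show ?thesis by blast
qed

section \<open>Partitions and their index sets\<close>

lemma desc_list_par_set:
  assumes "lam \<in> Par r"
  shows "desc_list (par_set r lam) = map (\<lambda>i. r - 1 - i + lam i) [0..<r]"
proof -
  have "sorted_wrt (>) (map (\<lambda>i. r - 1 - i + lam i) [0..<r])"
    unfolding sorted_wrt_iff_nth_less
  proof (intro allI impI)
    fix i j assume "i < j" "j < length (map (\<lambda>i. r - 1 - i + lam i) [0..<r])"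
    moreover have "lam j \<le> lam i" using assms \<open>i < j\<close> by (simp add: Par_def)
    ultimately show "map (\<lambda>i. r - 1 - i + lam i) [0..<r] ! i > map (\<lambda>i. r - 1 - i + lam i) [0..<r] ! j"
      by simp
  qed
  from desc_list_unique[OF this] show ?thesis by (simp add: par_set_def)
qed

lemma finite_par_set [simp]: "finite (par_set r lam)"
  by (simp add: par_set_def)

lemma card_par_set: "lam \<in> Par r \<Longrightarrow> card (par_set r lam) = r"
  using desc_list_length[of "par_set r lam"] by (simp add: desc_list_par_set)

lemma par_set_inj:
  assumes "lam \<in> Par r" "mu \<in> Par r" "par_set r lam = par_set r mu"
  shows "lam = mu"
proof
  fix i
  show "lam i = mu i"
  proof (cases "i < r")
    case True
    have "map (\<lambda>i. r - 1 - i + lam i) [0..<r] ! i = map (\<lambda>i. r - 1 - i + mu i) [0..<r] ! i"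
      using assms desc_list_par_set by metis
    then show ?thesis using True by simp
  qed (use assms in \<open>simp add: Par_def\<close>)
qed

text \<open>The inverse of \<open>par_set r\<close> on sets of size r. There the truncated
  subtraction is exact, as r - 1 - i elements lie below the one at position i.\<close>

definition par_of :: "nat \<Rightarrow> nat set \<Rightarrow> nat \<Rightarrow> nat" where
  "par_of r S i = (if i < r then desc_list S ! i - (r - 1 - i) else 0)"

lemma par_of:
  assumes "finite S" "card S = r"
  shows "par_of r S \<in> Par r" "par_set r (par_of r S) = S"
proof -
  let ?d = "desc_list S"
  have gap: "?d ! (i + l) + l \<le> ?d ! i" if "i + l < r" for i l
    using that
  proof (induction l)
    case (Suc l)
    then have "?d ! (i + Suc l) < ?d ! (i + l)"
      using assms by (intro desc_list_nth_less) auto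
    then show ?case using Suc by simp
  qed simp
  have ge: "r - 1 - i \<le> ?d ! i" if "i < r" for i
    using gap[of i "r - 1 - i"] that by simp
  have "par_of r S j \<le> par_of r S i" if "i \<le> j" for i j
  proof (cases "j < r")
    case True
    then show ?thesis using gap[of i "j - i"] ge[of j] that by (simp add: par_of_def)
  qed (simp add: par_of_def)
  then show "par_of r S \<in> Par r" by (simp add: Par_def par_of_def)
  have "par_set r (par_of r S) = (!) ?d ` {0..<r}"
    unfolding par_set_def
  proof (rule image_cong[OF refl])
    fix i assume "i \<in> {0..<r}"
    then show "r - 1 - i + par_of r S i = ?d ! i" using ge[of i] by (simp add: par_of_def)
  qed
  also have "\<dots> = set ?d" using assms by (auto simp: set_conv_nth)
  finally show "par_set r (par_of r S) = S" using assms by simp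
qed

lemma par_of_par_set: "lam \<in> Par r \<Longrightarrow> par_of r (par_set r lam) = lam"
  by (rule par_set_inj[of _ r]) (simp_all add: par_of card_par_set)

lemma empty_par_Par [simp]: "empty_par \<in> Par r"
  by (simp add: Par_def)

lemma par_set_empty_par: "par_set r empty_par = {0..<r}"
proof -
  have "x \<in> (\<lambda>i. r - 1 - i) ` {0..<r}" if "x < r" for x
    using that by (intro image_eqI[of _ _ "r - 1 - x"]) auto
  then show ?thesis by (auto simp: par_set_def)
qed

text \<open>Row r - 1 - i and column r - 1 - j + lam j differ by lam j - j + i, the index in
  \<open>Delta\<close>; negative indices match the zero case of \<open>rho\<close>.\<close>

lemma Delta_eq_jt:
  assumes "lam \<in> Par r" "\<And>n. A n = (if n < 0 then 0 else fps_nth G (nat n))"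
  shows "Delta r lam A = jt G r (par_set r lam)"
proof -
  have "jt G r (par_set r lam) = det (mat r r (\<lambda>(i, j). rho G (r - 1 - i) (r - 1 - j + lam j)))"
    unfolding jt_def using card_par_set[OF assms(1)]
    by (subst wd_det) (auto simp: desc_list_par_set[OF assms(1)] rev_nth intro!: arg_cong[of _ _ det] eq_matI)
  also have "mat r r (\<lambda>(i, j). rho G (r - 1 - i) (r - 1 - j + lam j)) =
      mat r r (\<lambda>(i, j). A (int (lam j) - int j + int i))"
    by (rule eq_matI) (auto simp: rho_def assms(2) intro!: arg_cong[of _ _ "fps_nth G"])
  finally show ?thesis by (simp add: Delta_def)
qed

lemma B_act_Delta:
  assumes "lam \<in> Par r"
  shows "B_act r (Delta r lam (H_seq r)) (b_par r empty_par) = b_par r lam"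
proof -
  have "Delta r lam (H_seq r) = jt (H_ser r) r (par_set r lam)"
    by (rule Delta_eq_jt[OF assms]) (simp add: H_ser_def, simp add: H_seq_def)
  then show ?thesis
    using assms by (simp add: b_par_eq_egen_set par_set_empty_par giambelli card_par_set)
qed

lemma B_act_series_E_B:
  assumes "lam \<in> Par r" "\<And>e. E_ext k r (b_par r lam) e \<in> ext_deg r"
  shows "B_act_series r (E_B k r (Delta r lam (H_seq r))) (b_par r empty_par) = E_ext k r (b_par r lam)"
proof
  fix e
  have "E_ext k r (b_par r lam) e \<in> (\<lambda>q. B_act r q (b_par r empty_par)) ` B_ring r"
    using B_act_surj[OF assms(2)] by (simp add: b_par_eq_egen_set par_set_empty_par)
  then show "B_act_series r (E_B k r (Delta r lam (H_seq r))) (b_par r empty_par) e = E_ext k r (b_par r lam) e"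
    unfolding B_act_series_def E_B_def B_act_Delta[OF assms(1)] by (rule f_inv_into_f)
qed

section \<open>Bialternants, Schur polynomials and contractions\<close>

lemma det_reverse:
  assumes A: "A \<in> carrier_mat n n"
  shows "det (mat n n (\<lambda>(i, j). A $$ (n - 1 - i, n - 1 - j))) = (det A :: 'a::comm_ring_1)"
proof -
  define p where "p i = (if i < n then n - 1 - i else i)" for i
  have p: "p permutes {0..<n}"
  proof (rule bij_imp_permutes)
    show "bij_betw p {0..<n} {0..<n}"
      by (rule bij_betw_byWitness[of _ p]) (auto simp: p_def)
  qed (auto simp: p_def)
  have s: "signof p * (signof p * x) = (x :: 'a)" for x
    by (simp add: sign_def)
  define B where "B = mat n n (\<lambda>(i, j). A $$ (p i, j))"
  have B: "B \<in> carrier_mat n n" by (simp add: B_def)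
  have "det B = signof p * det A" unfolding B_def by (rule det_permute_rows[OF A p])
  moreover have "det (mat n n (\<lambda>(i, j). B\<^sup>T $$ (p i, j))) = signof p * det B\<^sup>T"
    by (rule det_permute_rows) (use B p in auto)
  moreover have "det (mat n n (\<lambda>(i, j). A $$ (n - 1 - i, n - 1 - j))) =
      det ((mat n n (\<lambda>(i, j). B\<^sup>T $$ (p i, j)))\<^sup>T)"
    by (rule arg_cong[of _ _ det], rule eq_matI) (auto simp: B_def p_def)
  moreover have "det ((mat n n (\<lambda>(i, j). B\<^sup>T $$ (p i, j)))\<^sup>T) = det (mat n n (\<lambda>(i, j). B\<^sup>T $$ (p i, j)))"
    by (rule det_transpose[of _ n]) simp
  ultimately show ?thesis using det_transpose[OF B] s by simp
qed

text \<open>\<open>schur_poly\<close> has increasing exponents as rows and variables as columns,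
  \<open>wd\<close> has variables as rows and everything decreasing. Transposing and reversing both
  directions leaves the determinant unchanged.\<close>

lemma bialternant_wd:
  fixes x :: "nat \<Rightarrow> 'a::comm_ring_1"
  assumes "mu \<in> Par k"
  shows "det (mat k k (\<lambda>(i, j). x (Suc j) ^ (mu (k - 1 - i) + i))) =
    wd (map (\<lambda>j n. x j ^ n) (rev [1..<Suc k])) (par_set k mu)"
proof -
  let ?A = "mat k k (\<lambda>(i, j). x (k - i) ^ (k - 1 - j + mu j))"
  let ?R = "mat k k (\<lambda>(i, j). ?A $$ (k - 1 - i, k - 1 - j))"
  have "wd (map (\<lambda>j n. x j ^ n) (rev [1..<Suc k])) (par_set k mu) = det ?A"
    using card_par_set[OF assms]
    by (subst wd_det) (auto simp: desc_list_par_set[OF assms] rev_nth Suc_diff_Suc simp del: upt_Suc intro!: arg_cong[of _ _ det] eq_matI)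
  also have "\<dots> = det ?R" by (rule det_reverse[of _ k, symmetric]) simp
  also have "\<dots> = det ?R\<^sup>T" by (rule det_transpose[of _ k, symmetric]) simp
  also have "?R\<^sup>T = mat k k (\<lambda>(i, j). x (Suc j) ^ (mu (k - 1 - i) + i))"
    by (rule eq_matI) (auto simp: Suc_diff_Suc add.commute)
  finally show ?thesis ..
qed

text \<open>An arbitrary linear order on the variables makes the Laurent polynomials an integral domain.\<close>

instantiation var :: linorder
begin

primrec var_code :: "var \<Rightarrow> nat" where
  "var_code (Zv i) = 2 * i"
| "var_code (Wv i) = 2 * i + 1"

definition "less_eq_var x y \<longleftrightarrow> var_code x \<le> var_code y"

definition "less_var x y \<longleftrightarrow> var_code x < var_code y"

instance
proof
  fix x y :: var
  assume "x \<le> y" "y \<le> x"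
  then have "var_code x = var_code y" by (simp add: less_eq_var_def)
  then show "x = y" by (cases x; cases y) (simp_all, presburger+)
qed (auto simp: less_eq_var_def less_var_def)

end

lemma vand_nonzero:
  fixes x :: "nat \<Rightarrow> 'a::idom"
  assumes "\<And>i j. i < j \<Longrightarrow> x j \<noteq> x i"
  shows "vand k x \<noteq> 0"
  using assms by (simp add: vand_def)

text \<open>Jacobi-Trudi exhibits the quotient, and a nonzero Vandermonde factor in an integral
  domain makes it unique, so \<open>THE\<close> denotes it.\<close>

lemma schur_poly_eq_jt:
  assumes "mu \<in> Par k" "\<And>i j. i < j \<Longrightarrow> x j \<noteq> x i"
  shows "schur_poly k mu x = jt (\<Prod>j\<in>{1..k}. geo (x j)) k (par_set k mu)"
proof -
  have "s * vand k x = det (mat k k (\<lambda>(i, j). x (Suc j) ^ (mu (k - 1 - i) + i))) \<longleftrightarrow>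
      s = jt (\<Prod>j\<in>{1..k}. geo (x j)) k (par_set k mu)" for s
    unfolding bialternant_wd[OF assms(1)] jacobi_trudi
    using vand_nonzero[of x k] assms(2) by (simp add: mult.commute[of s])
  then show ?thesis unfolding schur_poly_def vand_def[symmetric] by simp
qed

lemma beta_par_eq_egen_set: "nu \<in> Par k \<Longrightarrow> beta_par k nu = egen_set (par_set k nu)"
  using b_par_eq_egen_set[of nu k] by (simp add: beta_par_def b_par_def)

lemma epair_egen_set_right: "finite N \<Longrightarrow> epair \<eta> (c *\<^sub>Q egen_set N) = c * ecoeff \<eta> N"
  by (subst epair_eq[of "{N}"]) (auto simp: ecoeff_egen_set)

text \<open>Pairing with the basis vector of L reads off the coefficient of L in
  \<open>egen_set A * \<eta>\<close>, to which only the splitting of L into A and its complement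
  contributes.\<close>

lemma contract_egen_set:
  assumes "finite A" "finite L" "card L = r" "card A = k"
  shows "contract k r (egen_set A) (egen_set L) =
    (if A \<subseteq> L then sg A (L - A) *\<^sub>Q egen_set (L - A) else 0)"
proof (cases "k \<le> r")
  case False
  then have "\<not> A \<subseteq> L" using assms card_mono[of L A] by auto
  then show ?thesis using False by (simp add: contract_def)
next
  case True
  let ?x = "if A \<subseteq> L then sg A (L - A) *\<^sub>Q egen_set (L - A) else 0"
  have "?x \<in> ext_deg (r - k)"
    using assms by (auto simp: ext_deg_def ecoeff_egen_set card_Diff_subset split: if_splits)
  moreover have "epair \<eta> ?x = epair (egen_set A * \<eta>) (egen_set L)" for \<eta>
  proof -
    have "epair (egen_set A * \<eta>) (egen_set L) = ecoeff (egen_set A * \<eta>) L"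
      using epair_egen_set_right[OF assms(2), of _ 1] by simp
    also have "\<dots> = (\<Sum>S\<in>Pow L. if S = A then sg A (L - A) * ecoeff \<eta> (L - A) else 0)"
      unfolding times_ext.rep_eq
      by (rule sum.cong) (auto simp: ecoeff_egen_set assms esgn_eq_sg)
    also have "\<dots> = epair \<eta> ?x"
      using assms epair_egen_set_right[of "{}" \<eta> 0] by (simp add: epair_egen_set_right sum.delta)
    finally show ?thesis ..
  qed
  ultimately have *: "?x \<in> ext_deg (r - k) \<and>
      (\<forall>\<eta>\<in>ext_deg (r - k). epair \<eta> ?x = epair (egen_set A * \<eta>) (egen_set L))" by blast
  have "contract k r (egen_set A) (egen_set L) = (THE x. x \<in> ext_deg (r - k) \<and>
      (\<forall>\<eta>\<in>ext_deg (r - k). epair \<eta> x = epair (egen_set A * \<eta>) (egen_set L)))"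
    using True by (simp add: contract_def)
  also have "\<dots> = ?x"
    by (rule the1_equality[OF contract_ex1 *])
  finally show ?thesis .
qed

section \<open>The operator \<open>\<Gamma>\<^sup>*\<close>\<close>

definition map_fps :: "('a \<Rightarrow> 'b) \<Rightarrow> 'a fps \<Rightarrow> 'b fps" where
  "map_fps h F = Abs_fps (\<lambda>n. h (fps_nth F n))"

lemma map_fps_nth [simp]: "fps_nth (map_fps h F) n = h (fps_nth F n)"
  by (simp add: map_fps_def)

context comm_ring_hom
begin

lemma hom_sg: "hom (sg S T) = sg S T"
  by (simp add: sg_def hom_power hom_uminus)

lemma wd_hom: "wd (map (\<lambda>f t. hom (f t)) fs) T = hom (wd fs T)"
  by (induction fs arbitrary: T) (simp_all add: hom_sum hom_mult hom_sg)

lemma jt_hom: "jt (map_fps hom G) r T = hom (jt G r T)"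
proof -
  have "map (rho (map_fps hom G)) (rev [0..<r]) = map (\<lambda>f t. hom (f t)) (map (rho G) (rev [0..<r]))"
    by (simp add: rho_def fun_eq_iff)
  then show ?thesis unfolding jt_def by (simp only: wd_hom)
qed

lemma map_fps_mult: "map_fps hom (F * G) = map_fps hom F * map_fps hom G"
  by (rule fps_ext) (simp add: fps_mult_nth hom_sum hom_mult)

lemma map_fps_one: "map_fps hom 1 = 1"
  by (rule fps_ext) simp

lemma map_fps_prod: "map_fps hom (\<Prod>j\<in>A. F j) = (\<Prod>j\<in>A. map_fps hom (F j))"
  by (induction A rule: infinite_finite_induct) (simp_all add: map_fps_one map_fps_mult)

lemma map_fps_geo: "map_fps hom (geo x) = geo (hom x)"
  by (rule fps_ext) (simp add: hom_power)

end

abbreviation cb :: "bpoly \<Rightarrow> blaurent" where "cb \<equiv> Poly_Mapping.single 0"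

interpretation cb: comm_ring_hom cb
  by unfold_locales (simp_all add: single_add mult_single)

text \<open>Rational coefficients become constant polynomials, so that the Schur polynomials in the
  1/w_j and the determinants of the h_n, embedded by \<open>cb\<close>, meet in one ring.\<close>

definition emb :: "laurent \<Rightarrow> blaurent" where
  "emb p = Poly_Mapping.map (Poly_Mapping.single 0) p"

lemma lookup_emb: "Poly_Mapping.lookup (emb p) a = Poly_Mapping.single 0 (Poly_Mapping.lookup p a)"
  by (simp add: emb_def Poly_Mapping.map.rep_eq when_def)

lemma emb_add: "emb (p + q) = emb p + emb q"
  by (rule poly_mapping_eqI) (simp add: lookup_emb lookup_add single_add)

lemma emb_single: "emb (Poly_Mapping.single a c) = Poly_Mapping.single a (Poly_Mapping.single 0 c)"
  by (rule poly_mapping_eqI) (simp add: lookup_emb lookup_single when_def)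

lemma emb_zero [simp]: "emb 0 = 0"
  by (rule poly_mapping_eqI) (simp add: lookup_emb)

lemma emb_sum: "emb (sum f A) = (\<Sum>a\<in>A. emb (f a))"
  by (induction A rule: infinite_finite_induct) (simp_all add: emb_add)

lemma emb_mult: "emb (p * q) = emb p * emb q"
proof -
  let ?s = "\<lambda>p a. Poly_Mapping.single a (Poly_Mapping.lookup p a) :: laurent"
  have e: "p = (\<Sum>a\<in>Poly_Mapping.keys p. ?s p a)" for p by (rule poly_mapping_sum_single)
  have "emb (?s p a * ?s q b) = emb (?s p a) * emb (?s q b)" for a b
    by (simp add: mult_single emb_single)
  then have "emb ((\<Sum>a\<in>Poly_Mapping.keys p. ?s p a) * (\<Sum>b\<in>Poly_Mapping.keys q. ?s q b)) =
      emb (\<Sum>a\<in>Poly_Mapping.keys p. ?s p a) * emb (\<Sum>b\<in>Poly_Mapping.keys q. ?s q b)"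
    unfolding sum_product emb_sum by simp
  then show ?thesis by (simp only: e[symmetric])
qed

interpretation emb: comm_ring_hom emb
proof
  show "emb 1 = 1" using emb_single[of 0 1] by simp
qed (simp_all add: emb_add emb_mult)

section \<open>The determinant of Gamma-star over the joint alphabet\<close>

abbreviation xw :: "nat \<Rightarrow> blaurent" where
  "xw j \<equiv> Poly_Mapping.single (Poly_Mapping.single (Wv j) (- 1)) 1"

abbreviation yw :: "nat \<Rightarrow> blaurent" where
  "yw j \<equiv> Poly_Mapping.single (Poly_Mapping.single (Wv j) 1) 1"

lemma single_power_int:
  "(Poly_Mapping.single (Poly_Mapping.single x s) 1 :: expo \<Rightarrow>\<^sub>0 'a::comm_ring_1) ^ n =
    Poly_Mapping.single (Poly_Mapping.single x (s * int n)) 1"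
  by (induction n) (simp_all add: mult_single single_add[symmetric] distrib_left add.commute)

lemma yw_mult_xw: "yw j * xw j = 1"
  by (simp add: mult_single single_add[symmetric])

definition H_bl :: "nat \<Rightarrow> blaurent fps" where
  "H_bl m = map_fps cb (H_ser m)"

definition E_bl :: "nat \<Rightarrow> blaurent fps" where
  "E_bl m = map_fps cb (E_ser m)"

lemma E_bl_mult_H_bl: "E_bl m * H_bl m = 1"
  by (simp add: E_bl_def H_bl_def cb.map_fps_mult[symmetric] E_ser_mult_H_ser cb.map_fps_one)

text \<open>On generating series the substitution is multiplication by 1/(1 - X/w), which adds 1/w
  to the alphabet of the h_n.\<close>

lemma sigma_minus_seq_eq:
  assumes "\<And>n. A n = (if n < 0 then 0 else fps_nth F (nat n))"
  shows "sigma_minus_seq l A n = (if n < 0 then 0 else fps_nth (geo (xw l) * F) (nat n))"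
proof -
  let ?t = "\<lambda>i. Poly_Mapping.single (Poly_Mapping.single (Wv l) (- int i)) 1 * A (n - int i)"
  have t: "?t i = 0" if "n < int i" for i using that assms[of "n - int i"] by simp
  show ?thesis
  proof (cases "n < 0")
    case True
    then have *: "?t i = 0" for i by (intro t) simp
    show ?thesis unfolding sigma_minus_seq_def * using True by simp
  next
    case False
    have "sigma_minus_seq l A n = (\<Sum>i=0..nat n. ?t i)"
      unfolding sigma_minus_seq_def
    proof (rule Sum_any.expand_superset)
      show "{i. ?t i \<noteq> 0} \<subseteq> {0..nat n}"
      proof
        fix i assume "i \<in> {i. ?t i \<noteq> 0}"
        then have "\<not> n < int i" using t[of i] by blast
        then show "i \<in> {0..nat n}" by simp
      qed
    qed simp
    also have "\<dots> = fps_nth (geo (xw l) * F) (nat n)"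
      unfolding fps_mult_nth
    proof (rule sum.cong[OF refl])
      fix i assume "i \<in> {0..nat n}"
      then have "A (n - int i) = fps_nth F (nat n - i)"
        using False assms[of "n - int i"] by (auto simp: nat_diff_distrib)
      then show "?t i = fps_nth (geo (xw l)) i * fps_nth F (nat n - i)"
        by (simp add: single_power_int)
    qed
    finally show ?thesis using False by simp
  qed
qed

lemma foldr_sigma_minus_seq:
  "foldr sigma_minus_seq ls (H_const m) n =
    (if n < 0 then 0 else fps_nth (prod_list (map (\<lambda>l. geo (xw l)) ls) * H_bl m) (nat n))"
proof (induction ls arbitrary: n)
  case Nil
  then show ?case by (simp add: H_const_def H_bl_def H_ser_def) (simp add: H_seq_def)
next
  case (Cons l ls)
  show ?case using sigma_minus_seq_eq[OF Cons, of l n] by (simp add: mult.assoc)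
qed

lemma Gamma_star_poly_eq_jt:
  assumes "lam \<in> Par r"
  shows "Gamma_star_poly k r lam = (\<Prod>j\<in>{1..k}. E_at_w (r - k) j) *
    jt ((\<Prod>j\<in>{1..k}. geo (xw j)) * H_bl (r - k)) r (par_set r lam)"
proof -
  have "prod_list (map (\<lambda>l. geo (xw l)) [1..<Suc k]) = (\<Prod>j\<in>{1..k}. geo (xw j))"
    by (simp only: prod.distinct_set_conv_list[symmetric] distinct_upt set_upt atLeastLessThanSuc_atLeastAtMost)
  then show ?thesis
    unfolding Gamma_star_poly_def
    by (subst Delta_eq_jt[OF assms foldr_sigma_minus_seq]) simp
qed

lemma wd_delta_rows:
  assumes "finite S"
  shows "wd (map (\<lambda>a t. if t = a then 1 else 0) (desc_list S)) T = (if T = S then 1 else (0::'a::comm_ring_1))"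
  using assms
proof (induction S arbitrary: T rule: finite_linorder_max_induct)
  case empty
  then show ?case by simp
next
  case (insert m A)
  have "m \<notin> A" using insert.hyps by blast
  have s: "sg {m} A = (1::'a)" by (rule sg_one) (use insert.hyps in \<open>auto intro: less_imp_le\<close>)
  show ?case
  proof (cases "finite T")
    case True
    have "wd (map (\<lambda>a t. if t = a then 1 else 0) (desc_list (insert m A))) T =
        (\<Sum>t\<in>T. if t = m then (if T - {m} = A then 1 else 0) else (0::'a))"
      unfolding desc_list_insert_max[OF insert.hyps(1,2)] list.map wd.simps insert.IH
      by (rule sum.cong[OF refl]) (use s in auto)
    also have "\<dots> = (if m \<in> T \<and> T - {m} = A then 1 else 0)" using True by simp
    also have "m \<in> T \<and> T - {m} = A \<longleftrightarrow> T = insert m A" using \<open>m \<notin> A\<close> by auto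
    finally show ?thesis by simp
  next
    case False
    then show ?thesis using insert.hyps wd_card by (metis finite_insert)
  qed
qed

text \<open>The reversed polynomial of E_m at x_j = 1/w_j. With formal roots, E_m(w) is the product
  of the 1 - y_i w and this is the product of the x_j - y_i, a factor of the resultant.\<close>

lemma E_at_w_eq: "xw j ^ m * E_at_w m j = (\<Sum>a\<le>m. xw j ^ (m - a) * fps_nth (E_bl m) a)"
proof -
  have "xw j ^ m * Poly_Mapping.single (Poly_Mapping.single (Wv j) (int a)) (fps_nth (E_ser m) a) =
      xw j ^ (m - a) * fps_nth (E_bl m) a" if "a \<le> m" for a
    using that by (simp add: E_bl_def single_power_int mult_single single_add[symmetric])
  then show ?thesis unfolding E_at_w_def sum_distrib_left by (intro sum.cong) auto
qed

text \<open>The value at the first r integers is a resultant: multiplying all rows by \<open>E_bl m\<close> turns the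
  last m rows into unit vectors, and the other ones into multiples of geometric progressions
  from index m on.\<close>

lemma wd_resultant:
  "wd (map fps_nth (map (\<lambda>j. geo (xw j)) (rev [1..<Suc k]) @
      map (\<lambda>a. fps_X ^ a * H_bl m) (rev [0..<m]))) {0..<k + m} =
    (\<Prod>j\<in>{1..k}. xw j ^ m * E_at_w m j) * vand k xw"
proof -
  let ?X = "map (\<lambda>j. geo (xw j)) (rev [1..<Suc k])"
  let ?Y = "map (\<lambda>a. fps_X ^ a * H_bl m) (rev [0..<m])"
  let ?XE = "map (\<lambda>F. fps_nth (F * E_bl m)) ?X"
  let ?D = "map (\<lambda>a t. if t = a then 1 else 0) (desc_list {0..<m})"
  let ?T = "{0..<k + m}"
  have E0: "fps_nth (E_bl m) 0 = 1" by (simp add: E_bl_def)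
  have "wd (map fps_nth (?X @ ?Y)) ?T = wd (map (\<lambda>F. fps_nth (F * E_bl m)) (?X @ ?Y)) ?T"
    using wd_fps_mult_initial[OF E0, of "?X @ ?Y"] by (simp del: upt_Suc)
  also have "map (\<lambda>F. fps_nth (F * E_bl m)) (?X @ ?Y) = ?XE @ ?D"
  proof -
    have *: "fps_X ^ a * H_bl m * E_bl m = fps_X ^ a" for a
      using E_bl_mult_H_bl[of m] by (simp add: mult.assoc mult.commute)
    show ?thesis by (simp add: * desc_list_atLeast0LessThan comp_def fun_eq_iff del: upt_Suc)
  qed
  \<comment> \<open>In the Laplace expansion the m unit rows admit only the columns below m, which
    leaves m, ..., m + k - 1 to the other rows.\<close>
  also have "wd (?XE @ ?D) ?T = (\<Sum>A\<in>Pow ?T. if A = {m..<m + k} then wd ?XE {m..<m + k} else 0)"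
    unfolding wd_append[OF finite_atLeastLessThan]
  proof (rule sum.cong[OF refl])
    fix A assume A: "A \<in> Pow ?T"
    have "?T - A = {0..<m} \<longleftrightarrow> A = {m..<m + k}"
    proof
      assume "?T - A = {0..<m}"
      then have "?T - (?T - A) = ?T - {0..<m}" by simp
      then show "A = {m..<m + k}" using A by (auto simp: double_diff)
    qed auto
    moreover have "sg {m..<m + k} {0..<m} = (1::blaurent)" by (rule sg_one) auto
    ultimately show "sg A (?T - A) * wd ?XE A * wd ?D (?T - A) =
        (if A = {m..<m + k} then wd ?XE {m..<m + k} else 0)"
      unfolding wd_delta_rows[OF finite_atLeastLessThan] by (cases "A = {m..<m + k}") simp_all
  qed
  also have "\<dots> = wd ?XE {m..<m + k}" by (subst sum.delta) auto
  also have "{m..<m + k} = (+) m ` {0..<k}" by auto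
  also have "wd ?XE ((+) m ` {0..<k}) =
      wd (map (\<lambda>j n. (xw j ^ m * E_at_w m j) * xw j ^ n) (rev [1..<Suc k])) {0..<k}"
    unfolding wd_shift
  proof (rule arg_cong[of _ _ "\<lambda>fs. wd fs {0..<k}"])
    \<comment> \<open>E_m has degree at most m, so from index m on all its coefficients enter and
      the value is a multiple of x_j^n.\<close>
    have "fps_nth (geo (xw j) * E_bl m) (m + n) = (xw j ^ m * E_at_w m j) * xw j ^ n" for j n
    proof -
      have "fps_nth (geo (xw j) * E_bl m) (m + n) =
          (\<Sum>a=0..m + n. fps_nth (E_bl m) a * xw j ^ (m + n - a))"
        by (subst mult.commute) (simp add: fps_mult_nth)
      also have "\<dots> = (\<Sum>a\<le>m. fps_nth (E_bl m) a * xw j ^ (m + n - a))"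
        by (rule sum.mono_neutral_right) (auto simp: E_bl_def E_ser_beyond)
      also have "\<dots> = (\<Sum>a\<le>m. xw j ^ (m - a) * fps_nth (E_bl m) a) * xw j ^ n"
        unfolding sum_distrib_right
      proof (rule sum.cong[OF refl])
        fix a assume "a \<in> {..m}"
        then have "m + n - a = (m - a) + n" by simp
        then show "fps_nth (E_bl m) a * xw j ^ (m + n - a) =
            xw j ^ (m - a) * fps_nth (E_bl m) a * xw j ^ n"
          by (simp only: power_add mult_ac)
      qed
      finally show ?thesis unfolding E_at_w_eq .
    qed
    then show "map (\<lambda>f n. f (m + n)) ?XE =
        map (\<lambda>j n. (xw j ^ m * E_at_w m j) * xw j ^ n) (rev [1..<Suc k])"
      by (simp add: comp_def del: upt_Suc)
  qed
  also have "\<dots> = prod_list (map (\<lambda>j. xw j ^ m * E_at_w m j) (rev [1..<Suc k])) * vand k xw"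
    unfolding wd_scale wd_vandermonde ..
  also have "prod_list (map (\<lambda>j. xw j ^ m * E_at_w m j) (rev [1..<Suc k])) =
      (\<Prod>j\<in>{1..k}. xw j ^ m * E_at_w m j)"
    by (simp only: prod.distinct_set_conv_list[symmetric] distinct_rev distinct_upt set_rev set_upt
        atLeastLessThanSuc_atLeastAtMost)
  finally show ?thesis .
qed

lemma xw_distinct: "i < j \<Longrightarrow> xw j \<noteq> xw i"
proof
  assume "i < j" "xw j = xw i"
  then have "Poly_Mapping.lookup (xw i) (Poly_Mapping.single (Wv j) (- 1)) = 1"
    by (metis lookup_single_eq)
  then have "Poly_Mapping.single (Wv i) (- 1 :: int) = Poly_Mapping.single (Wv j) (- 1)"
    by (simp add: lookup_single when_def split: if_splits)
  then have "Poly_Mapping.lookup (Poly_Mapping.single (Wv i) (- 1 :: int)) (Wv j) = - 1" by simp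
  then show False using \<open>i < j\<close> by (simp add: lookup_single when_def split: if_splits)
qed

text \<open>The determinant with k geometric rows and m rows of H_m is computed twice: by the
  recurrence, as its initial value times \<open>jt\<close> of the joint alphabet, and by Laplace
  expansion. The Vandermonde factor common to both is cancelled.\<close>

lemma jt_mixed_alphabet:
  assumes "finite T"
  shows "(\<Prod>j\<in>{1..k}. xw j ^ m * E_at_w m j) * jt ((\<Prod>j\<in>{1..k}. geo (xw j)) * H_bl m) (k + m) T =
    (\<Sum>A\<in>Pow T. sg A (T - A) * jt (\<Prod>j\<in>{1..k}. geo (xw j)) k A * jt (H_bl m) m (T - A))"
proof -
  let ?X = "map (\<lambda>j. geo (xw j)) (rev [1..<Suc k])"
  let ?Y = "map (\<lambda>a. fps_X ^ a * H_bl m) (rev [0..<m])"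
  let ?E = "(\<Prod>j\<in>{1..k}. lin (xw j)) * E_bl m"
  let ?G = "(\<Prod>j\<in>{1..k}. geo (xw j)) * H_bl m"
  have EG: "?E * ?G = 1"
    using prod_lin_mult_prod_geo[of xw "{1..k}"] E_bl_mult_H_bl[of m]
    by (metis (no_types, lifting) mult.assoc mult.commute mult.left_neutral)
  have "wd (map fps_nth (?X @ ?Y)) T = wd (map fps_nth (?X @ ?Y)) {0..<k + m} * jt ?G (k + m) T"
  proof (rule wd_recurrent[OF _ EG])
    show "fps_nth ?E 0 = 1" by (simp add: fps_prod_nth_0 E_bl_def)
    show "length (?X @ ?Y) = k + m" by (simp del: upt_Suc)
    fix F n assume F: "F \<in> set (?X @ ?Y)" and n: "k + m \<le> n"
    have Ed: "fps_nth (E_bl m) n = 0" if "m < n" for n using that by (simp add: E_bl_def E_ser_beyond)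
    consider j where "j \<in> {1..k}" "F = geo (xw j)" | a where "a < m" "F = fps_X ^ a * H_bl m"
      using F by force
    \<comment> \<open>The inverse factor of ?E cancels and leaves a polynomial of degree at most k -
      1 + m, respectively a + k with a < m.\<close>
    then show "fps_nth (F * ?E) n = 0"
    proof cases
      case 1
      have "F * ?E = (geo (xw j) * lin (xw j)) * ((\<Prod>j\<in>{1..k} - {j}. lin (xw j)) * E_bl m)"
        using 1 by (subst prod.remove[of _ j]) (auto simp: mult_ac)
      also have "\<dots> = (\<Prod>j\<in>{1..k} - {j}. lin (xw j)) * E_bl m" by (simp add: geo_mult_lin)
      finally show ?thesis
        using 1 n Ed by (simp only:) (rule fps_mult_nth_beyond[of "k - 1" _ m], auto simp: prod_lin_nth_beyond)
    next
      case 2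
      have "F * ?E = fps_X ^ a * (\<Prod>j\<in>{1..k}. lin (xw j)) * (E_bl m * H_bl m)"
        using 2 by (simp add: mult_ac)
      also have "\<dots> = fps_X ^ a * (\<Prod>j\<in>{1..k}. lin (xw j))" by (simp add: E_bl_mult_H_bl)
      finally show ?thesis
        using 2 n by (simp only:) (rule fps_mult_nth_beyond[of a _ k], auto simp: prod_lin_nth_beyond)
    qed
  qed
  also have "wd (map fps_nth (?X @ ?Y)) {0..<k + m} = (\<Prod>j\<in>{1..k}. xw j ^ m * E_at_w m j) * vand k xw"
    by (rule wd_resultant)
  also have "wd (map fps_nth (?X @ ?Y)) T =
      (\<Sum>A\<in>Pow T. sg A (T - A) * (vand k xw * jt (\<Prod>j\<in>{1..k}. geo (xw j)) k A) * jt (H_bl m) m (T - A))"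
  proof -
    have X: "map fps_nth ?X = map (\<lambda>j n. xw j ^ n) (rev [1..<Suc k])"
      by (simp only: map_map comp_def) (rule map_cong[OF refl], simp add: fun_eq_iff)
    have Y: "map fps_nth ?Y = map (rho (H_bl m)) (rev [0..<m])"
      by (simp add: fun_eq_iff rho_eq_shift)
    show ?thesis
      unfolding map_append wd_append[OF assms] X Y jacobi_trudi jt_def[of "H_bl m" m] ..
  qed
  finally have "vand k xw * (\<Sum>A\<in>Pow T. sg A (T - A) * jt (\<Prod>j\<in>{1..k}. geo (xw j)) k A * jt (H_bl m) m (T - A)) =
      vand k xw * ((\<Prod>j\<in>{1..k}. xw j ^ m * E_at_w m j) * jt ?G (k + m) T)"
    by (simp add: sum_distrib_left mult_ac)
  moreover have "vand k xw \<noteq> 0" by (rule vand_nonzero) (rule xw_distinct)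
  ultimately have "(\<Sum>A\<in>Pow T. sg A (T - A) * jt (\<Prod>j\<in>{1..k}. geo (xw j)) k A * jt (H_bl m) m (T - A)) =
      (\<Prod>j\<in>{1..k}. xw j ^ m * E_at_w m j) * jt ?G (k + m) T"
    by (rule mult_left_cancel[THEN iffD1, rotated])
  then show ?thesis ..
qed

text \<open>The Schur polynomial in the 1/w_j of the partition with index set A, see
  \<open>schur_poly_w\<close>; it is 0 unless A has k elements.\<close>

definition s_w :: "nat \<Rightarrow> nat set \<Rightarrow> laurent" where
  "s_w k A = jt (\<Prod>j\<in>{1..k}. geo (w_pow j (- 1))) k A"

definition w_prod :: "nat \<Rightarrow> int \<Rightarrow> laurent" where
  "w_prod k n = (\<Prod>j\<in>{1..k}. w_pow j n)"

text \<open>The product of the E_m(w_j) in Gamma-star becomes the resultant after multiplication by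
  the w_j^(-m); this is the origin of the powers of the w_j.\<close>

lemma Gamma_star_poly_eq:
  assumes "lam \<in> Par r" "k \<le> r"
  defines "L \<equiv> par_set r lam"
  shows "Gamma_star_poly k r lam = (\<Sum>A\<in>Pow L. sg A (L - A) *
    emb (w_prod k (int (r - k)) * s_w k A) * cb (jt (H_ser (r - k)) (r - k) (L - A)))"
proof -
  define m where "m = r - k"
  have fin: "finite L" by (simp add: L_def)
  have y: "(\<Prod>j\<in>{1..k}. yw j ^ m) * (\<Prod>j\<in>{1..k}. xw j ^ m * E_at_w m j) = (\<Prod>j\<in>{1..k}. E_at_w m j)"
  proof -
    have "yw j ^ m * xw j ^ m = 1" for j
      by (simp only: power_mult_distrib[symmetric] yw_mult_xw power_one)
    then have "yw j ^ m * (xw j ^ m * c) = c" for j c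
      by (simp only: mult.assoc[symmetric] mult_1_left)
    then show ?thesis by (simp only: prod.distrib[symmetric])
  qed
  have w: "(\<Prod>j\<in>{1..k}. yw j ^ m) = emb (w_prod k (int m))"
    by (simp add: w_prod_def emb.hom_prod w_pow_def emb_single single_power_int)
  have s: "jt (\<Prod>j\<in>{1..k}. geo (xw j)) k A = emb (s_w k A)" for A
    by (simp add: s_w_def emb.jt_hom[symmetric] emb.map_fps_prod emb.map_fps_geo w_pow_def emb_single)
  have "Gamma_star_poly k r lam = (\<Prod>j\<in>{1..k}. yw j ^ m) * ((\<Prod>j\<in>{1..k}. xw j ^ m * E_at_w m j) *
      jt ((\<Prod>j\<in>{1..k}. geo (xw j)) * H_bl m) (k + m) L)"
    unfolding Gamma_star_poly_eq_jt[OF assms(1)] mult.assoc[symmetric] y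
    by (simp add: L_def m_def assms(2))
  also have "\<dots> = (\<Sum>A\<in>Pow L. sg A (L - A) *
      emb (w_prod k (int m) * s_w k A) * cb (jt (H_ser m) m (L - A)))"
    unfolding jt_mixed_alphabet[OF fin] w s sum_distrib_left
    by (simp add: H_bl_def cb.jt_hom emb_mult mult_ac)
  finally show ?thesis unfolding m_def .
qed

lemma lookup_mult_const:
  fixes p :: "'a::comm_monoid_add \<Rightarrow>\<^sub>0 'b::comm_ring_1"
  shows "Poly_Mapping.lookup (p * Poly_Mapping.single 0 c) a = Poly_Mapping.lookup p a * c"
proof -
  have "p * Poly_Mapping.single 0 c =
      (\<Sum>x\<in>Poly_Mapping.keys p. Poly_Mapping.single x (Poly_Mapping.lookup p x) * Poly_Mapping.single 0 c)"
    by (subst (1) poly_mapping_sum_single[of p]) (rule sum_distrib_right)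
  then show ?thesis
    by (auto simp: mult_single lookup_sum lookup_single when_def in_keys_iff)
qed

lemma lookup_sg_mult: "Poly_Mapping.lookup (sg S T * p) a = sg S T * Poly_Mapping.lookup p a"
proof -
  have "Poly_Mapping.lookup ((- 1) ^ n * p) a = (- 1) ^ n * Poly_Mapping.lookup p a" for n
    by (cases "even n") simp_all
  then show ?thesis by (simp add: sg_def)
qed

text \<open>Giambelli's formula turns the determinants in the h_n into basis vectors. By
  \<open>contract_egen_set\<close>, each summand is a multiple of the contraction of b_L with
  beta_A, sign included.\<close>

lemma Gamma_star_basis_eq:
  assumes "lam \<in> Par r" "k \<le> r"
  defines "L \<equiv> par_set r lam"
  shows "Gamma_star_basis k r lam a = (\<Sum>A | A \<subseteq> L \<and> card A = k.
    (sg A (L - A) * Poly_Mapping.lookup (w_prod k (int (r - k)) * s_w k A) a) *\<^sub>Q egen_set (L - A))"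
proof -
  let ?m = "r - k" and ?b = "egen_set {0..<r - k}"
  let ?t = "\<lambda>A. (sg A (L - A) * Poly_Mapping.lookup (w_prod k (int (r - k)) * s_w k A) a) *\<^sub>Q
    B_act ?m (jt (H_ser ?m) ?m (L - A)) ?b"
  have L: "finite L" "card L = r" using assms card_par_set by (simp_all add: L_def)
  have "Gamma_star_basis k r lam a = B_act ?m (Poly_Mapping.lookup (Gamma_star_poly k r lam) a) ?b"
    using assms(2) by (simp add: Gamma_star_basis_def B_act_series_def b_par_eq_egen_set par_set_empty_par)
  also have "\<dots> = (\<Sum>A\<in>Pow L. ?t A)"
    unfolding Gamma_star_poly_eq[OF assms(1,2)] L_def[symmetric] lookup_sum B_act_sum
  proof (rule sum.cong[OF refl])
    fix A
    have "Poly_Mapping.lookup (sg A (L - A) * emb (w_prod k (int ?m) * s_w k A) *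
        cb (jt (H_ser ?m) ?m (L - A))) a = sg A (L - A) *
        (Poly_Mapping.single 0 (Poly_Mapping.lookup (w_prod k (int ?m) * s_w k A) a) *
          jt (H_ser ?m) ?m (L - A))"
      by (simp only: lookup_mult_const lookup_sg_mult lookup_emb mult.assoc)
    then show "B_act ?m (Poly_Mapping.lookup (sg A (L - A) * emb (w_prod k (int ?m) * s_w k A) *
        cb (jt (H_ser ?m) ?m (L - A))) a) ?b = ?t A"
      by (simp only: B_act_sg_mult) (simp add: B_act_mult B_act_single)
  qed
  also have "\<dots> = (\<Sum>A | A \<subseteq> L \<and> card A = k. ?t A)"
  proof (rule sum.mono_neutral_right)
    show "\<forall>A\<in>Pow L - {A. A \<subseteq> L \<and> card A = k}. ?t A = 0"
    proof
      fix A assume A: "A \<in> Pow L - {A. A \<subseteq> L \<and> card A = k}"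
      then have "card (L - A) = r - card A" "card A \<le> r" "card A \<noteq> k"
        using L card_mono[of L A] by (auto simp: card_Diff_subset finite_subset)
      then have "card (L - A) \<noteq> ?m" using assms(2) by linarith
      then have "jt (H_ser ?m) ?m (L - A) = 0" using jt_card by blast
      then show "?t A = 0" by simp
    qed
  qed (use L in auto)
  also have "\<dots> = (\<Sum>A | A \<subseteq> L \<and> card A = k.
      (sg A (L - A) * Poly_Mapping.lookup (w_prod k (int (r - k)) * s_w k A) a) *\<^sub>Q egen_set (L - A))"
    by (intro sum.cong refl) (use L in \<open>auto simp: giambelli card_Diff_subset finite_subset\<close>)
  finally show ?thesis .
qed

section \<open>The operator \<open>\<Gamma>\<close>\<close>

interpretation cl: comm_ring_hom "Poly_Mapping.single 0 :: rat \<Rightarrow> laurent"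
  by unfold_locales (simp_all add: single_add mult_single)

text \<open>\<open>rep F fs\<close>: the series F is the wedge product of the vectors \<open>\<Sum>\<^sub>t f t b\<^sub>t\<close>, f in fs.\<close>

definition rep :: "ext series \<Rightarrow> (nat \<Rightarrow> laurent) list \<Rightarrow> bool" where
  "rep F fs \<longleftrightarrow> (\<forall>e T. ecoeff (F e) T = Poly_Mapping.lookup (wd fs T) e)"

lemma rep_const_series:
  "rep (const_series (prod_list (map bV ns))) (map (\<lambda>n t. if t = n then 1 else 0) ns)"
proof -
  have "wd (map (\<lambda>n t. if t = n then 1 else 0) ns) T =
      (Poly_Mapping.single 0 (ecoeff (prod_list (map bV ns)) T) :: laurent)" for T
  proof (induction ns arbitrary: T)
    case Nil
    then show ?case by simp
  next
    case (Cons n ns)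
    show ?case
    proof (cases "finite T")
      case True
      have "wd (map (\<lambda>n t. if t = n then 1 else 0) (n # ns)) T = (\<Sum>s\<in>T. if s = n then
          sg {n} (T - {n}) * (Poly_Mapping.single 0 (ecoeff (prod_list (map bV ns)) (T - {n})) :: laurent) else 0)"
        unfolding list.map wd.simps Cons by (rule sum.cong) auto
      also have "\<dots> = Poly_Mapping.single 0 (ecoeff (prod_list (map bV (n # ns))) T)"
        using True by (simp add: ecoeff_egen_times esgn_eq_sg cl.hom_mult cl.hom_sg)
      finally show ?thesis .
    next
      case False
      then show ?thesis by (simp add: ecoeff_infinite)
    qed
  qed
  then show ?thesis by (simp add: rep_def const_series_def lookup_single when_def)
qed

section \<open>Coefficients of products\<close>

lemma lookup_single_mult:
  fixes g :: "'a::ab_group_add \<Rightarrow>\<^sub>0 'b::comm_ring_1"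
  shows "Poly_Mapping.lookup (Poly_Mapping.single a c * g) e = c * Poly_Mapping.lookup g (e - a)"
proof -
  have "Poly_Mapping.single a c * g =
      (\<Sum>b\<in>Poly_Mapping.keys g. Poly_Mapping.single a c * Poly_Mapping.single b (Poly_Mapping.lookup g b))"
    by (subst (1) poly_mapping_sum_single[of g]) (rule sum_distrib_left)
  also have "Poly_Mapping.lookup \<dots> e =
      (\<Sum>b\<in>Poly_Mapping.keys g. if b = e - a then c * Poly_Mapping.lookup g (e - a) else 0)"
    unfolding lookup_sum by (intro sum.cong refl) (auto simp: mult_single lookup_single when_def)
  finally show ?thesis by (auto simp: in_keys_iff)
qed

lemma lookup_mult_superset:
  fixes f g :: "'a::ab_group_add \<Rightarrow>\<^sub>0 'b::comm_ring_1"
  assumes "finite K" "Poly_Mapping.keys f \<subseteq> K"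
  shows "Poly_Mapping.lookup (f * g) e =
    (\<Sum>a\<in>K. Poly_Mapping.lookup f a * Poly_Mapping.lookup g (e - a))"
proof -
  have "f * g = (\<Sum>a\<in>Poly_Mapping.keys f. Poly_Mapping.single a (Poly_Mapping.lookup f a) * g)"
    by (subst (1) poly_mapping_sum_single[of f]) (rule sum_distrib_right)
  then have "Poly_Mapping.lookup (f * g) e =
      (\<Sum>a\<in>Poly_Mapping.keys f. Poly_Mapping.lookup f a * Poly_Mapping.lookup g (e - a))"
    by (simp add: lookup_sum lookup_single_mult)
  also have "\<dots> = (\<Sum>a\<in>K. Poly_Mapping.lookup f a * Poly_Mapping.lookup g (e - a))"
    by (rule sum.mono_neutral_left) (use assms in \<open>auto simp: in_keys_iff\<close>)
  finally show ?thesis .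
qed

lemma keys_wd_subset:
  fixes fs :: "(nat \<Rightarrow> laurent) list" and R :: "expo set"
  assumes "0 \<in> R" "\<And>a b. a \<in> R \<Longrightarrow> b \<in> R \<Longrightarrow> a + b \<in> R"
    "\<And>f t. f \<in> set fs \<Longrightarrow> Poly_Mapping.keys (f t) \<subseteq> R"
  shows "Poly_Mapping.keys (wd fs T) \<subseteq> R"
  using assms(3)
proof (induction fs arbitrary: T)
  case Nil
  then show ?case using assms(1) by simp
next
  case (Cons f fs)
  have m: "Poly_Mapping.keys (p * q) \<subseteq> R"
    if "Poly_Mapping.keys p \<subseteq> R" "Poly_Mapping.keys q \<subseteq> R" for p q :: laurent
    using keys_mult[of p q] that assms(2) by blast
  have s: "Poly_Mapping.keys (sg A B :: laurent) \<subseteq> R" for A B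
    unfolding cl.hom_sg[symmetric] using assms(1) by (auto split: if_splits)
  show ?case
    unfolding wd.simps
  proof (rule order_trans[OF Poly_Mapping.keys_sum], rule UN_least)
    fix t
    show "Poly_Mapping.keys (sg {t} (T - {t}) * f t * wd fs (T - {t})) \<subseteq> R"
      using Cons by (intro m s) auto
  qed
qed

lemma ecoeff_vector_times:
  assumes "finite T" "\<And>S. ecoeff v S \<noteq> 0 \<Longrightarrow> card S = 1"
  shows "ecoeff (v * u) T = (\<Sum>s\<in>T. sg {s} (T - {s}) * ecoeff v {s} * ecoeff u (T - {s}))"
proof -
  have "ecoeff (v * u) T = (\<Sum>S\<in>(\<lambda>s. {s}) ` T. esgn S (T - S) * ecoeff v S * ecoeff u (T - S))"
    unfolding times_ext.rep_eq
  proof (rule sum.mono_neutral_right)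
    show "\<forall>S\<in>Pow T - (\<lambda>s. {s}) ` T. esgn S (T - S) * ecoeff v S * ecoeff u (T - S) = 0"
    proof
      fix S assume S: "S \<in> Pow T - (\<lambda>s. {s}) ` T"
      then have "card S \<noteq> 1" by (auto simp: card_1_singleton_iff)
      then have "ecoeff v S = 0" using assms(2) by blast
      then show "esgn S (T - S) * ecoeff v S * ecoeff u (T - S) = 0" by simp
    qed
  qed (use assms(1) in auto)
  also have "\<dots> = (\<Sum>s\<in>T. sg {s} (T - {s}) * ecoeff v {s} * ecoeff u (T - {s}))"
    by (subst sum.reindex) (auto simp: esgn_eq_sg)
  finally show ?thesis .
qed

lemma wd_zero_row: "f \<in> set fs \<Longrightarrow> (\<And>t. t \<in> T \<Longrightarrow> f t = 0) \<Longrightarrow> wd fs T = 0"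
proof (induction fs arbitrary: T)
  case (Cons g fs)
  have "g s * wd fs (T - {s}) = 0" if "s \<in> T" for s
  proof (cases "f = g")
    case False
    then have "wd fs (T - {s}) = 0" using Cons by (intro Cons.IH) auto
    then show ?thesis by simp
  qed (use Cons.prems(2) that in simp)
  then show ?case by (simp add: mult.assoc)
qed simp

text \<open>The common frame of \<open>sigma_plus\<close> and \<open>sigma_bar_minus\<close>:
  \<open>D a t\<close> collects the coefficients of b_t in the image of b_a over all powers of x^s.
  \<open>D_beyond\<close> leaves finitely many a for each t, with \<open>Suc t\<close> because
  \<open>sigma_bar_minus\<close> lowers an index by one.\<close>

locale vector_op =
  fixes d :: "nat \<Rightarrow> ext fps" and D :: "nat \<Rightarrow> nat \<Rightarrow> laurent" and x :: var and s :: int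
  assumes s: "s \<noteq> 0"
    and vector: "ecoeff (fps_nth (d a) i) S \<noteq> 0 \<Longrightarrow> card S = 1"
    and D: "Poly_Mapping.lookup (D a t) (Poly_Mapping.single x (s * int i)) = ecoeff (fps_nth (d a) i) {t}"
    and keys_D: "Poly_Mapping.keys (D a t) \<subseteq> range (\<lambda>i. Poly_Mapping.single x (s * int i))"
    and D_beyond: "Suc t < a \<Longrightarrow> D a t = 0"
begin

definition xi :: "nat \<Rightarrow> expo" where
  "xi i = Poly_Mapping.single x (s * int i)"

lemma xi_inj: "inj xi"
proof (rule injI)
  fix i j assume "xi i = xi j"
  then have "Poly_Mapping.lookup (xi i) x = Poly_Mapping.lookup (xi j) x" by simp
  then show "i = j" using s by (simp add: xi_def)
qed

lemma xi_add: "xi i + xi j = xi (i + j)"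
  by (simp add: xi_def single_add[symmetric] distrib_left)

lemma xi_eq_iff: "xi i = xi j \<longleftrightarrow> i = j"
  using xi_inj by (auto simp: inj_on_def)

lemma xi_0 [simp]: "xi 0 = 0"
  by (simp add: xi_def)

lemma lookup_D: "Poly_Mapping.lookup (D a t) (xi i) = ecoeff (fps_nth (d a) i) {t}"
  unfolding xi_def by (rule D)

lemma keys_D_xi: "Poly_Mapping.keys (D a t) \<subseteq> range xi"
  using keys_D unfolding xi_def[abs_def] .

lemma keys_wd_D: "Poly_Mapping.keys (wd (map D as) T) \<subseteq> range xi"
proof (rule keys_wd_subset)
  show "0 \<in> range xi" using xi_0 by (metis rangeI)
  show "a + b \<in> range xi" if "a \<in> range xi" "b \<in> range xi" for a b
    using that by (auto simp: xi_add)
qed (use keys_D_xi in auto)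

text \<open>On nonnegative powers of x^s the Laurent product is the Cauchy product of series in one
  variable.\<close>

lemma lookup_mult_xi:
  assumes f: "Poly_Mapping.keys f \<subseteq> range xi" and g: "Poly_Mapping.keys g \<subseteq> range xi"
  shows "Poly_Mapping.lookup (f * g) (xi n) =
    (\<Sum>p=0..n. Poly_Mapping.lookup f (xi p) * (Poly_Mapping.lookup g (xi (n - p)) :: rat))"
proof -
  define J where "J = {p. xi p \<in> Poly_Mapping.keys f} \<union> {0..n}"
  have "finite {p. xi p \<in> Poly_Mapping.keys f}"
    using finite_vimageI[OF finite_keys xi_inj, of f] by (simp add: vimage_def)
  then have J: "finite J" "{0..n} \<subseteq> J" by (auto simp: J_def)
  have "Poly_Mapping.lookup (f * g) (xi n) =
      (\<Sum>a\<in>xi ` J. Poly_Mapping.lookup f a * Poly_Mapping.lookup g (xi n - a))"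
    by (rule lookup_mult_superset) (use J f in \<open>auto simp: J_def\<close>)
  also have "\<dots> = (\<Sum>p\<in>J. Poly_Mapping.lookup f (xi p) * Poly_Mapping.lookup g (xi n - xi p))"
    by (subst sum.reindex) (auto intro: inj_on_subset[OF xi_inj])
  also have "\<dots> = (\<Sum>p=0..n. Poly_Mapping.lookup f (xi p) * Poly_Mapping.lookup g (xi (n - p)))"
  proof (rule sum.mono_neutral_cong_right)
    show "\<forall>p\<in>J - {0..n}. Poly_Mapping.lookup f (xi p) * Poly_Mapping.lookup g (xi n - xi p) = 0"
    proof
      fix p assume p: "p \<in> J - {0..n}"
      have "xi n - xi p \<notin> range xi"
      proof
        assume "xi n - xi p \<in> range xi"
        then obtain q where "xi n - xi p = xi q" by auto
        then have "xi n = xi (q + p)" by (simp add: xi_add[symmetric] algebra_simps)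
        then show False using p by (simp add: xi_eq_iff)
      qed
      then have "Poly_Mapping.lookup g (xi n - xi p) = 0" using g by (auto simp: in_keys_iff)
      then show "Poly_Mapping.lookup f (xi p) * Poly_Mapping.lookup g (xi n - xi p) = 0" by simp
    qed
    fix p assume "p \<in> {0..n}"
    then have "xi n = xi (n - p) + xi p" by (simp add: xi_add)
    then show "Poly_Mapping.lookup f (xi p) * Poly_Mapping.lookup g (xi n - xi p) =
        Poly_Mapping.lookup f (xi p) * Poly_Mapping.lookup g (xi (n - p))"
      by simp
  qed (use J in auto)
  finally show ?thesis .
qed

lemma ecoeff_prod_list:
  "ecoeff (fps_nth (prod_list (map d as)) i) T = Poly_Mapping.lookup (wd (map D as) T) (xi i)"
proof (induction as arbitrary: i T)
  case Nil
  have "xi i = 0 \<longleftrightarrow> i = 0" using xi_eq_iff[of i 0] by simp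
  then show ?case by (simp add: lookup_one when_def)
next
  case (Cons a as)
  show ?case
  proof (cases "finite T")
    case False
    then show ?thesis by (simp add: ecoeff_infinite)
  next
    case True
    have "ecoeff (fps_nth (prod_list (map d (a # as))) i) T =
        (\<Sum>p=0..i. \<Sum>t\<in>T. sg {t} (T - {t}) * (Poly_Mapping.lookup (D a t) (xi p) *
          Poly_Mapping.lookup (wd (map D as) (T - {t})) (xi (i - p))))"
      using True vector
      by (simp add: fps_mult_nth ecoeff_sum ecoeff_vector_times Cons lookup_D mult.assoc)
    also have "\<dots> = (\<Sum>t\<in>T. sg {t} (T - {t}) *
        Poly_Mapping.lookup (D a t * wd (map D as) (T - {t})) (xi i))"
      by (subst sum.swap) (simp add: lookup_mult_xi[OF keys_D_xi keys_wd_D] sum_distrib_left)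
    also have "\<dots> = Poly_Mapping.lookup (wd (map D (a # as)) T) (xi i)"
      by (simp add: lookup_sum mult.assoc lookup_sg_mult)
    finally show ?thesis .
  qed
qed

text \<open>The extended map sends a wedge product of vectors to that of their images; on
  coefficients this is Cauchy-Binet for D. \<open>fin\<close> ensures that \<open>Sum_any\<close> is
  a genuine sum and not the default 0.\<close>

lemma rep_series_op:
  assumes F: "rep F fs" and fin: "\<And>e. finite {i. fps_nth (mult_ext d (F (e - xi i))) i \<noteq> 0}"
  shows "rep (series_op (mult_ext d) x s F) (map (\<lambda>f t. \<Sum>a\<le>Suc t. f a * D a t) fs)"
  unfolding rep_def
proof (intro allI)
  fix e T
  let ?g = "\<lambda>f t. \<Sum>a\<le>Suc t. f a * D a t"
  show "ecoeff (series_op (mult_ext d) x s F e) T = Poly_Mapping.lookup (wd (map ?g fs) T) e"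
  proof (cases "finite T")
    case False
    then have "wd (map ?g fs) T = 0" using wd_card by blast
    then show ?thesis using False by (simp add: ecoeff_infinite)
  next
    case T: True
    \<comment> \<open>By \<open>D_beyond\<close>, only indices in N reach the columns in T, so the
      infinite matrix D may be cut down to these rows.\<close>
    define N where "N = {..Suc (Max (insert 0 T))}"
    have N: "finite N" "\<And>t. t \<in> T \<Longrightarrow> {..Suc t} \<subseteq> N"
      using T by (auto simp: N_def intro: le_trans)
    let ?W = "\<lambda>S. wd (map D (desc_list S)) T"
    have W: "?W S = 0" if S: "finite S" "\<not> S \<subseteq> N" for S
    proof -
      obtain a where a: "a \<in> S" "a \<notin> N" using S by auto
      have "Suc t < a" if "t \<in> T" for t
        using a N(2)[OF that] by (auto simp: not_less[symmetric])
      then show ?thesis using a S by (intro wd_zero_row[of "D a"]) (auto intro: D_beyond)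
    qed
    have me: "ecoeff (fps_nth (mult_ext d u) i) T =
        (\<Sum>S\<in>Pow N. ecoeff u S * Poly_Mapping.lookup (?W S) (xi i))" for u i
    proof -
      have "ecoeff (fps_nth (mult_ext d u) i) T =
          (\<Sum>S | ecoeff u S \<noteq> 0. ecoeff u S * Poly_Mapping.lookup (?W S) (xi i))"
        by (simp add: mult_ext_def fps_sum_nth ecoeff_sum ecoeff_prod_list)
      also have "\<dots> = (\<Sum>S\<in>Pow N \<union> {S. ecoeff u S \<noteq> 0}. ecoeff u S * Poly_Mapping.lookup (?W S) (xi i))"
        by (rule sum.mono_neutral_left) (use N in \<open>auto simp: finite_ecoeff\<close>)
      also have "\<dots> = (\<Sum>S\<in>Pow N. ecoeff u S * Poly_Mapping.lookup (?W S) (xi i))"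
      proof (rule sum.mono_neutral_right)
        show "\<forall>S\<in>Pow N \<union> {S. ecoeff u S \<noteq> 0} - Pow N. ecoeff u S * Poly_Mapping.lookup (?W S) (xi i) = 0"
        proof
          fix S assume "S \<in> Pow N \<union> {S. ecoeff u S \<noteq> 0} - Pow N"
          then have "\<not> S \<subseteq> N" "finite S" using ecoeff_infinite by auto
          then show "ecoeff u S * Poly_Mapping.lookup (?W S) (xi i) = 0" using W by simp
        qed
      qed (use N in \<open>auto simp: finite_ecoeff\<close>)
      finally show ?thesis .
    qed
    \<comment> \<open>Outside J neither the operator nor the minors of D contribute at e.\<close>
    define J where "J = {i. fps_nth (mult_ext d (F (e - xi i))) i \<noteq> 0} \<union>
      (\<Union>S\<in>Pow N. {i. xi i \<in> Poly_Mapping.keys (?W S)})"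
    have "finite {i. xi i \<in> Poly_Mapping.keys (?W S)}" for S
      using finite_vimageI[OF finite_keys xi_inj] by (simp add: vimage_def)
    then have J: "finite J" using fin N(1) by (auto simp: J_def)
    have "series_op (mult_ext d) x s F e = (\<Sum>i\<in>J. fps_nth (mult_ext d (F (e - xi i))) i)"
      unfolding series_op_def xi_def[symmetric]
      by (rule Sum_any.expand_superset) (use J in \<open>auto simp: J_def\<close>)
    then have "ecoeff (series_op (mult_ext d) x s F e) T =
        (\<Sum>i\<in>J. \<Sum>S\<in>Pow N. Poly_Mapping.lookup (wd fs S) (e - xi i) * Poly_Mapping.lookup (?W S) (xi i))"
      using F by (simp add: ecoeff_sum me rep_def)
    also have "\<dots> = (\<Sum>S\<in>Pow N. Poly_Mapping.lookup (wd fs S * ?W S) e)"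
    proof (subst sum.swap, rule sum.cong[OF refl])
      fix S assume S: "S \<in> Pow N"
      have "Poly_Mapping.lookup (?W S * wd fs S) e =
          (\<Sum>b\<in>xi ` J. Poly_Mapping.lookup (?W S) b * Poly_Mapping.lookup (wd fs S) (e - b))"
      proof (rule lookup_mult_superset)
        show "Poly_Mapping.keys (?W S) \<subseteq> xi ` J"
        proof
          fix b assume b: "b \<in> Poly_Mapping.keys (?W S)"
          then obtain i where "b = xi i" using keys_wd_D by blast
          then show "b \<in> xi ` J" using b S by (auto simp: J_def)
        qed
      qed (use J in simp)
      also have "\<dots> = (\<Sum>i\<in>J. Poly_Mapping.lookup (wd fs S) (e - xi i) * Poly_Mapping.lookup (?W S) (xi i))"
        by (subst sum.reindex) (auto intro: inj_on_subset[OF xi_inj] simp: mult.commute)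
      finally show "(\<Sum>i\<in>J. Poly_Mapping.lookup (wd fs S) (e - xi i) * Poly_Mapping.lookup (?W S) (xi i)) =
          Poly_Mapping.lookup (wd fs S * ?W S) e"
        by (simp add: mult.commute)
    qed
    also have "\<dots> = Poly_Mapping.lookup (wd (map (\<lambda>f t. \<Sum>a\<in>N. f a * D a t) fs) T) e"
      by (simp add: wd_cauchy_binet[OF N(1)] lookup_sum)
    also have "wd (map (\<lambda>f t. \<Sum>a\<in>N. f a * D a t) fs) T = wd (map ?g fs) T"
    proof (rule wd_row_cong)
      fix i t assume i: "i < length (map (\<lambda>f t. \<Sum>a\<in>N. f a * D a t) fs)" and t: "t \<in> T"
      have "(\<Sum>a\<in>N. (fs ! i) a * D a t) = ?g (fs ! i) t"
        by (rule sum.mono_neutral_right) (use N t D_beyond in \<open>auto simp: not_le\<close>)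
      then show "(map (\<lambda>f t. \<Sum>a\<in>N. f a * D a t) fs ! i) t = (map ?g fs ! i) t"
        using i by simp
    qed simp
    finally show ?thesis .
  qed
qed

end

section \<open>The two Schubert derivations occurring in Gamma\<close>

abbreviation zz :: "nat \<Rightarrow> laurent" where "zz j \<equiv> z_pow j 1"

abbreviation zi :: "nat \<Rightarrow> laurent" where "zi j \<equiv> z_pow j (- 1)"

lemma zi_mult_zz: "zi j * zz j = 1"
  by (simp add: z_pow_def mult_single single_add[symmetric])

lemma single_int_eq_iff:
  "s \<noteq> 0 \<Longrightarrow> Poly_Mapping.single x (s * int i) = Poly_Mapping.single x (s * int j) \<longleftrightarrow> i = j" for x :: var
proof
  assume "s \<noteq> 0" "Poly_Mapping.single x (s * int i) = Poly_Mapping.single x (s * int j)"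
  then show "i = j" by (metis lookup_single_eq mult_left_cancel of_nat_eq_iff)
qed simp

definition D_plus :: "nat \<Rightarrow> nat \<Rightarrow> nat \<Rightarrow> laurent" where
  "D_plus j a t = (if a \<le> t then zz j ^ (t - a) else 0)"

text \<open>The convention b_(-1) = 0 is built in: \<open>Suc t = a\<close> fails for a = 0.\<close>

definition D_minus :: "nat \<Rightarrow> nat \<Rightarrow> nat \<Rightarrow> laurent" where
  "D_minus j a t = (if t = a then 1 else 0) - (if Suc t = a then zi j else 0)"

interpretation plus: vector_op "\<lambda>j. Abs_fps (\<lambda>i. bZ (int j + int i))" "D_plus j" "Zv j" 1 for j
proof
  have b: "bZ (int a + int i) = bV (a + i)" for a i by (simp add: bZ_def nat_add_distrib)
  show "ecoeff (fps_nth (Abs_fps (\<lambda>i. bZ (int a + int i))) i) S \<noteq> 0 \<Longrightarrow> card S = 1" for a i S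
    by (simp add: b ecoeff_egen split: if_splits)
  show "Poly_Mapping.lookup (D_plus j a t) (Poly_Mapping.single (Zv j) (1 * int i)) =
      ecoeff (fps_nth (Abs_fps (\<lambda>i. bZ (int a + int i))) i) {t}" for a t i
    using single_int_eq_iff[of 1 "Zv j" "t - a" i]
    by (auto simp: b ecoeff_egen D_plus_def z_pow_def single_power_int lookup_single when_def)
  show "Poly_Mapping.keys (D_plus j a t) \<subseteq> range (\<lambda>i. Poly_Mapping.single (Zv j) (1 * int i))" for a t
    by (auto simp: D_plus_def z_pow_def single_power_int simp del: of_nat_diff)
qed (auto simp: D_plus_def)

interpretation minus: vector_op "\<lambda>j. fps_const (bZ (int j)) - fps_const (bZ (int j - 1)) * fps_X"
  "D_minus j" "Zv j" "- 1" for j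
proof
  let ?d = "\<lambda>a. fps_const (bZ (int a)) - fps_const (bZ (int a - 1)) * fps_X"
  have b: "fps_nth (?d a) i = (if i = 0 then bV a else if i = 1 \<and> a \<noteq> 0 then - bV (a - 1) else 0)" for a i
    by (cases i) (auto simp: bZ_def nat_diff_distrib)
  show "ecoeff (fps_nth (?d a) i) S \<noteq> 0 \<Longrightarrow> card S = 1" for a i S
    unfolding b by (auto simp: ecoeff_egen split: if_splits)
  have x: "Poly_Mapping.lookup (zi j) (Poly_Mapping.single (Zv j) (- 1 * int i)) = (if i = 1 then 1 else 0)" for i
    using single_int_eq_iff[of "-1" "Zv j" 1 i] by (auto simp: z_pow_def lookup_single when_def)
  have y: "Poly_Mapping.lookup (1::laurent) (Poly_Mapping.single (Zv j) (- 1 * int i)) = (if i = 0 then 1 else 0)" for i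
    using single_int_eq_iff[of "-1" "Zv j" 0 i] by (auto simp: lookup_one when_def)
  show "Poly_Mapping.lookup (D_minus j a t) (Poly_Mapping.single (Zv j) (- 1 * int i)) =
      ecoeff (fps_nth (?d a) i) {t}" for a t i
    unfolding b D_minus_def lookup_minus using x[of i] y[of i] by (auto simp: ecoeff_egen)
  have "0 \<in> range (\<lambda>i. Poly_Mapping.single (Zv j) (- 1 * int i))"
    by (rule image_eqI[of _ _ 0]) simp_all
  moreover have "Poly_Mapping.single (Zv j) (- 1) \<in> range (\<lambda>i. Poly_Mapping.single (Zv j) (- 1 * int i))"
    by (rule image_eqI[of _ _ 1]) simp_all
  ultimately show "Poly_Mapping.keys (D_minus j a t) \<subseteq> range (\<lambda>i. Poly_Mapping.single (Zv j) (- 1 * int i))" for a t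
    by (auto simp: D_minus_def z_pow_def)
qed (auto simp: D_minus_def)

text \<open>Each of the r factors is linear in 1/z.\<close>

lemma sigma_bar_minus_beyond:
  assumes "u \<in> ext_deg r" "r < i"
  shows "fps_nth (sigma_bar_minus u) i = 0"
proof -
  let ?d = "\<lambda>j. fps_const (bZ (int j)) - fps_const (bZ (int j - 1)) * fps_X"
  have d: "fps_nth (?d a) n = 0" if "1 < n" for a n using that by (cases n) auto
  have "fps_nth (prod_list (map ?d as)) n = 0" if "length as < n" for as n
    using that
  proof (induction as arbitrary: n)
    case (Cons a as)
    show ?case unfolding list.map prod_list.Cons
      by (rule fps_mult_nth_beyond[of 1 _ "length as"]) (use Cons d in auto)
  qed simp
  then show ?thesis
    using assms by (auto simp: sigma_bar_minus_def mult_ext_def fps_sum_nth ext_deg_def intro!: sum.neutral)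
qed

text \<open>\<open>sigma_plus\<close> at exponent e reads F at arbitrarily lower exponents of one
  variable; the bound leaves finitely many, so that \<open>Sum_any\<close> does not default to
  0.\<close>

definition bounded_below :: "ext series \<Rightarrow> bool" where
  "bounded_below F \<longleftrightarrow> (\<forall>v. \<exists>c. \<forall>e. F e \<noteq> 0 \<longrightarrow> c \<le> Poly_Mapping.lookup e v)"

lemma series_op_nonzero:
  assumes "series_op D x s F e \<noteq> 0"
  obtains i where "fps_nth (D (F (e - Poly_Mapping.single x (s * int i)))) i \<noteq> 0"
  using assms that unfolding series_op_def by (rule Sum_any.not_neutral_obtains_not_neutral)

lemma series_op_plus:
  fixes j :: nat
  assumes F: "rep F (map fps_nth Gs)" "bounded_below F"
  defines "F' \<equiv> series_op sigma_plus (Zv j) 1 F"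
  shows "rep F' (map fps_nth (map (\<lambda>G. G * geo (zz j)) Gs))" "bounded_below F'"
proof -
  have "rep F' (map (\<lambda>f t. \<Sum>a\<le>Suc t. f a * D_plus j a t) (map fps_nth Gs))"
    unfolding F'_def sigma_plus_def
  proof (rule plus.rep_series_op[OF F(1)])
    fix e
    obtain c where c: "\<And>e. F e \<noteq> 0 \<Longrightarrow> c \<le> Poly_Mapping.lookup e (Zv j)"
      using F(2) unfolding bounded_below_def by blast
    show "finite {i. fps_nth (mult_ext (\<lambda>j. Abs_fps (\<lambda>i. bZ (int j + int i))) (F (e - plus.xi j i))) i \<noteq> 0}"
    proof (rule finite_subset)
      show "{i. fps_nth (mult_ext (\<lambda>j. Abs_fps (\<lambda>i. bZ (int j + int i))) (F (e - plus.xi j i))) i \<noteq> 0}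
          \<subseteq> {..nat (Poly_Mapping.lookup e (Zv j) - c)}"
      proof
        fix i assume "i \<in> {i. fps_nth (mult_ext (\<lambda>j. Abs_fps (\<lambda>i. bZ (int j + int i))) (F (e - plus.xi j i))) i \<noteq> 0}"
        then have "F (e - plus.xi j i) \<noteq> 0" by auto
        from c[OF this] show "i \<in> {..nat (Poly_Mapping.lookup e (Zv j) - c)}"
          by (simp add: lookup_minus plus.xi_def)
      qed
    qed simp
  qed
  moreover have "(\<Sum>a\<le>Suc t. fps_nth G a * D_plus j a t) = fps_nth (G * geo (zz j)) t" for G t
    by (simp add: fps_mult_nth D_plus_def atLeast0AtMost)
  ultimately show "rep F' (map fps_nth (map (\<lambda>G. G * geo (zz j)) Gs))" by (simp add: comp_def)
  show "bounded_below F'"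
    unfolding bounded_below_def
  proof
    fix v
    obtain c where c: "\<And>e. F e \<noteq> 0 \<Longrightarrow> c \<le> Poly_Mapping.lookup e v"
      using F(2) unfolding bounded_below_def by blast
    have "c \<le> Poly_Mapping.lookup e v" if ne: "F' e \<noteq> 0" for e
    proof -
      obtain i where "fps_nth (sigma_plus (F (e - Poly_Mapping.single (Zv j) (1 * int i)))) i \<noteq> 0"
        using ne unfolding F'_def by (rule series_op_nonzero)
      then have "F (e - Poly_Mapping.single (Zv j) (1 * int i)) \<noteq> 0"
        by (auto simp: sigma_plus_def)
      from c[OF this] show ?thesis
        by (simp add: lookup_minus lookup_single when_def split: if_splits)
    qed
    then show "\<exists>c. \<forall>e. F' e \<noteq> 0 \<longrightarrow> c \<le> Poly_Mapping.lookup e v" by blast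
  qed
qed

text \<open>The operators act on the vector \<open>\<Sum>\<^sub>t f t b\<^sub>t\<close>, seen as a power series, as multiplication by the
  geometric series (\<open>sigma_plus\<close>) and as \<open>nop\<close> (\<open>sigma_bar_minus\<close>).\<close>

definition nop :: "nat \<Rightarrow> laurent fps \<Rightarrow> laurent fps" where
  "nop j G = Abs_fps (\<lambda>t. fps_nth G t - zi j * fps_nth G (Suc t))"

lemma series_op_minus:
  fixes j :: nat
  assumes F: "rep F (map fps_nth Gs)" "bounded_below F"
  defines "F' \<equiv> series_op sigma_bar_minus (Zv j) (- 1) F"
  shows "rep F' (map fps_nth (map (nop j) Gs))" "bounded_below F'"
proof -
  \<comment> \<open>The degree of the wedge product bounds the powers of 1/z that
    \<open>sigma_bar_minus\<close> can produce.\<close>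
  have deg: "F e \<in> ext_deg (length Gs)" for e
  proof -
    have "card T = length Gs" if T: "ecoeff (F e) T \<noteq> 0" for T
    proof -
      have "wd (map fps_nth Gs) T \<noteq> 0" using T F(1) by (auto simp: rep_def)
      then show ?thesis using wd_card by fastforce
    qed
    then show ?thesis by (simp add: ext_deg_def)
  qed
  have i: "i \<le> length Gs" if "fps_nth (sigma_bar_minus (F e)) i \<noteq> 0" for e i
    using sigma_bar_minus_beyond[OF deg, of i e] that by (meson not_le)
  have "rep F' (map (\<lambda>f t. \<Sum>a\<le>Suc t. f a * D_minus j a t) (map fps_nth Gs))"
    unfolding F'_def sigma_bar_minus_def
  proof (rule minus.rep_series_op[OF F(1)])
    fix e
    show "finite {i. fps_nth (mult_ext (\<lambda>j. fps_const (bZ (int j)) - fps_const (bZ (int j - 1)) * fps_X)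
        (F (e - minus.xi j i))) i \<noteq> 0}"
      by (rule finite_subset[of _ "{..length Gs}"]) (use i in \<open>auto simp: sigma_bar_minus_def\<close>)
  qed
  moreover have "(\<Sum>a\<le>Suc t. fps_nth G a * D_minus j a t) = fps_nth (nop j G) t" for G t
  proof -
    have "(\<Sum>a\<le>Suc t. fps_nth G a * D_minus j a t) =
        (\<Sum>a\<le>Suc t. if a = t then fps_nth G t else 0) - (\<Sum>a\<le>Suc t. if a = Suc t then zi j * fps_nth G (Suc t) else 0)"
      unfolding sum_subtractf[symmetric] by (rule sum.cong) (auto simp: D_minus_def)
    then show ?thesis by (simp add: nop_def)
  qed
  ultimately show "rep F' (map fps_nth (map (nop j) Gs))" by (simp add: comp_def)
  show "bounded_below F'"
    unfolding bounded_below_def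
  proof
    fix v
    obtain c where c: "\<And>e. F e \<noteq> 0 \<Longrightarrow> c \<le> Poly_Mapping.lookup e v"
      using F(2) unfolding bounded_below_def by blast
    have "c - int (length Gs) \<le> Poly_Mapping.lookup e v" if ne: "F' e \<noteq> 0" for e
    proof -
      obtain l where l: "fps_nth (sigma_bar_minus (F (e - Poly_Mapping.single (Zv j) (- 1 * int l)))) l \<noteq> 0"
        using ne unfolding F'_def by (rule series_op_nonzero)
      then have "F (e - Poly_Mapping.single (Zv j) (- 1 * int l)) \<noteq> 0"
        by (auto simp: sigma_bar_minus_def)
      from c[OF this] i[OF l] show ?thesis
        by (simp add: lookup_minus lookup_single when_def split: if_splits)
    qed
    then show "\<exists>c. \<forall>e. F' e \<noteq> 0 \<longrightarrow> c \<le> Poly_Mapping.lookup e v" by blast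
  qed
qed

section \<open>Iterated operators and their effect on powers of X\<close>

lemma foldr_series_op_plus:
  fixes js :: "nat list"
  assumes "rep F (map fps_nth Gs)" "bounded_below F"
  defines "F' \<equiv> foldr (\<lambda>j. series_op sigma_plus (Zv j) 1) js F"
  shows "rep F' (map fps_nth (map (\<lambda>G. G * prod_list (map (\<lambda>j. geo (zz j)) js)) Gs)) \<and> bounded_below F'"
  unfolding F'_def
proof (induction js)
  case Nil
  then show ?case using assms by simp
next
  case (Cons j js)
  show ?case
    using series_op_plus[OF Cons[THEN conjunct1] Cons[THEN conjunct2], of j]
    by (simp add: comp_def mult_ac)
qed

lemma foldr_series_op_minus:
  fixes js :: "nat list"
  assumes "rep F (map fps_nth Gs)" "bounded_below F"
  defines "F' \<equiv> foldr (\<lambda>j. series_op sigma_bar_minus (Zv j) (- 1)) js F"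
  shows "rep F' (map fps_nth (map (foldr nop js) Gs)) \<and> bounded_below F'"
  unfolding F'_def
proof (induction js)
  case Nil
  then show ?case using assms by simp
next
  case (Cons j js)
  show ?case
    using series_op_minus[OF Cons[THEN conjunct1] Cons[THEN conjunct2], of j]
    by (simp add: comp_def)
qed

text \<open>Lowering the indices drops the constant term, so \<open>nop\<close> is a multiplication
  only on multiples of X: it sends X Q to X Q - Q/z = - (1 - z X) Q/z.\<close>

lemma nop_X_mult: "nop j (fps_X * Q) = fps_const (- zi j) * (Q * lin (zz j))"
proof (rule fps_ext)
  fix t
  have *: "zi j * (zz j * q) = q" for q by (simp only: mult.assoc[symmetric] zi_mult_zz mult_1_left)
  show "fps_nth (nop j (fps_X * Q)) t = fps_nth (fps_const (- zi j) * (Q * lin (zz j))) t"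
    by (cases t) (simp_all add: nop_def mult_lin_nth right_diff_distrib *)
qed

text \<open>Each operator consumes one of the factors X.\<close>

lemma foldr_nop_shift:
  "foldr nop js (fps_X ^ length js * G) =
    fps_const (prod_list (map (\<lambda>j. - zi j) js)) * (prod_list (map (\<lambda>j. lin (zz j)) js) * G)"
proof (induction js arbitrary: G)
  case (Cons j js)
  let ?c = "fps_const (prod_list (map (\<lambda>j. - zi j) js))" and ?P = "prod_list (map (\<lambda>j. lin (zz j)) js)"
  have "foldr nop (j # js) (fps_X ^ length (j # js) * G) =
      nop j (foldr nop js (fps_X ^ length js * (fps_X * G)))"
    by (simp add: mult_ac)
  also have "\<dots> = nop j (fps_X * (?c * (?P * G)))"
    unfolding Cons by (simp add: mult_ac)
  also have "\<dots> = fps_const (- zi j * prod_list (map (\<lambda>j. - zi j) js)) * (lin (zz j) * ?P * G)"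
    unfolding nop_X_mult fps_const_mult[symmetric] by (simp only: mult_ac)
  finally show ?case by simp
qed simp

text \<open>\<open>nop\<close> subtracts only a lowered copy, so degree and leading coefficient
  stay; this handles the powers below X^k.\<close>

lemma foldr_nop_unitriangular:
  "fps_nth (foldr nop js (fps_X ^ n)) n = 1 \<and> (\<forall>t>n. fps_nth (foldr nop js (fps_X ^ n)) t = 0)"
  by (induction js) (simp_all add: nop_def)

lemma wd_unitriangular':
  assumes "\<And>a. a < r \<Longrightarrow> D a a = 1" "\<And>a t. a < t \<Longrightarrow> t < r \<Longrightarrow> D a t = 0"
  shows "wd (map D (rev [0..<r])) {0..<r} = 1"
proof -
  let ?M = "mat r r (\<lambda>(i, j). D (r - 1 - i) (r - 1 - j))"
  have "wd (map D (rev [0..<r])) {0..<r} = det ?M"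
    by (subst wd_det) (auto simp: desc_list_atLeast0LessThan rev_nth intro!: arg_cong[of _ _ det] eq_matI)
  also have "\<dots> = prod_list (diag_mat ?M)"
    by (rule det_upper_triangular[of _ r]) (auto simp: upper_triangular_def intro!: assms(2))
  also have "\<dots> = 1"
    using assms(1) by (simp add: prod_list_diag_prod)
  finally show ?thesis .
qed

definition s_z :: "nat \<Rightarrow> nat set \<Rightarrow> laurent" where
  "s_z k A = jt (\<Prod>j\<in>{1..k}. geo (zz j)) k A"

definition z_prod :: "nat \<Rightarrow> int \<Rightarrow> laurent" where
  "z_prod k n = (\<Prod>j\<in>{1..k}. z_pow j n)"

lemma prod_list_upt: "prod_list (map f [1..<Suc k]) = (\<Prod>j\<in>{1..k}. f j)"
  by (simp only: prod.distinct_set_conv_list[symmetric] distinct_upt set_upt atLeastLessThanSuc_atLeastAtMost)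

text \<open>In other words, Gamma sends b_N to the product of the z_j^(-m) times the sum of s_M(z)
  b_M wedge b_N.\<close>

lemma ecoeff_Gamma_basis:
  fixes m :: nat
  assumes kap: "kap \<in> Par m"
  defines "N \<equiv> par_set m kap"
  shows "ecoeff (Gamma_basis k m kap e) T =
    (if N \<subseteq> T then sg (T - N) N * Poly_Mapping.lookup (z_prod k (- int m) * s_z k (T - N)) e else 0)"
proof -
  let ?js = "[1..<Suc k]" and ?ns = "map (\<lambda>i. m + k - 1 - i + kap i) [0..<m + k]"
  let ?G = "\<Prod>j\<in>{1..k}. geo (zz j)"
  define c where "c = (\<Prod>j\<in>{1..k}. - zi j)"
  define p where "p a = foldr nop ?js (fps_X ^ a)" for a
  have "kap \<in> Par (m + k)" using kap by (simp add: Par_def)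
  have X: "fps_nth (fps_X ^ n) = (\<lambda>t. if t = n then 1 else 0 :: laurent)" for n
    by (simp add: fun_eq_iff)
  have "rep (const_series (prod_list (map bV ?ns))) (map fps_nth (map (\<lambda>n. fps_X ^ n) ?ns))"
    using rep_const_series[of ?ns] by (simp only: map_map comp_def X)
  moreover have "bounded_below (const_series u)" for u
    by (auto simp: bounded_below_def const_series_def intro!: exI[of _ 0])
  ultimately have "rep (sigma_bar_minus_z k (const_series (prod_list (map bV ?ns))))
      (map fps_nth (map (foldr nop ?js) (map (\<lambda>n. fps_X ^ n) ?ns))) \<and>
      bounded_below (sigma_bar_minus_z k (const_series (prod_list (map bV ?ns))))"
    unfolding sigma_bar_minus_z_def by (intro foldr_series_op_minus) auto
  then have "rep (sigma_plus_z k (sigma_bar_minus_z k (const_series (prod_list (map bV ?ns)))))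
      (map fps_nth (map (\<lambda>G. G * prod_list (map (\<lambda>j. geo (zz j)) ?js)) (map (foldr nop ?js) (map (\<lambda>n. fps_X ^ n) ?ns))))"
    unfolding sigma_plus_z_def by (intro foldr_series_op_plus[THEN conjunct1]) auto
  moreover have "prod_list (map bV ?ns) = b_par (m + k) kap"
    by (simp add: b_par_def comp_def)
  ultimately have rep: "rep (Gamma_basis k m kap) (map (\<lambda>n. fps_nth (p n * ?G)) ?ns)"
    unfolding Gamma_basis_def prod_list_upt by (simp add: p_def comp_def)
  \<comment> \<open>The first m indices are the elements of N raised by k; the k padding zeros
    contribute k - 1, ..., 0.\<close>
  have ns: "?ns = map (\<lambda>n. k + n) (desc_list N) @ rev [0..<k]"
  proof (rule nth_equalityI)
    show "length ?ns = length (map (\<lambda>n. k + n) (desc_list N) @ rev [0..<k])"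
      by (simp add: N_def desc_list_par_set[OF kap] del: desc_list_length)
    fix i assume "i < length ?ns"
    then show "?ns ! i = (map (\<lambda>n. k + n) (desc_list N) @ rev [0..<k]) ! i"
      using kap by (auto simp: N_def desc_list_par_set[OF kap] nth_append rev_nth Par_def simp del: desc_list_length)
  qed
  \<comment> \<open>The k operators use up X^k and leave the product of the
    \<open>lin (zz j)\<close>, which cancels against ?G.\<close>
  have upper: "p (k + n) * ?G = fps_const c * fps_X ^ n" for n
  proof -
    have "p (k + n) = fps_const c * ((\<Prod>j\<in>{1..k}. lin (zz j)) * fps_X ^ n)"
      using foldr_nop_shift[of ?js "fps_X ^ n"] unfolding prod_list_upt p_def c_def
      by (simp add: power_add del: upt_Suc)
    then have "p (k + n) * ?G = fps_const c * fps_X ^ n * ((\<Prod>j\<in>{1..k}. lin (zz j)) * ?G)"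
      by (simp only: mult_ac)
    then show ?thesis by (simp only: prod_lin_mult_prod_geo mult_1_right)
  qed
  \<comment> \<open>For a < k the series \<open>p a\<close> is a polynomial of degree a with leading
    coefficient 1, so these rows are a unitriangular combination of the rows of
    \<open>jt ?G k\<close>.\<close>
  have lower: "wd (map (\<lambda>a. fps_nth (p a * ?G)) (rev [0..<k])) B = s_z k B" for B
  proof -
    have "wd (map (\<lambda>a. fps_nth (p a * ?G)) (rev [0..<k])) B =
        wd (map (\<lambda>f t. \<Sum>a\<in>{0..<k}. f a * rho ?G a t) (map (\<lambda>a. fps_nth (p a)) (rev [0..<k]))) B"
    proof (rule wd_row_cong)
      fix i t assume "i < length (map (\<lambda>a. fps_nth (p a * ?G)) (rev [0..<k]))"
      then have i: "i < k" by simp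
      have "fps_nth (p (k - Suc i) * ?G) t = (\<Sum>a\<in>{0..<k}. fps_nth (p (k - Suc i)) a * rho ?G a t)"
        by (rule fps_mult_nth_rho) (use i foldr_nop_unitriangular[of ?js "k - Suc i"] in \<open>auto simp: p_def simp del: upt_Suc\<close>)
      then show "(map (\<lambda>a. fps_nth (p a * ?G)) (rev [0..<k]) ! i) t =
          (map (\<lambda>f t. \<Sum>a\<in>{0..<k}. f a * rho ?G a t) (map (\<lambda>a. fps_nth (p a)) (rev [0..<k])) ! i) t"
        using i by (simp add: rev_nth)
    qed simp
    also have "\<dots> = wd (map (\<lambda>a. fps_nth (p a)) (rev [0..<k])) {0..<k} * jt ?G k B"
      by (subst wd_square) (simp_all add: desc_list_atLeast0LessThan jt_def)
    also have "wd (map (\<lambda>a. fps_nth (p a)) (rev [0..<k])) {0..<k} = 1"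
      by (rule wd_unitriangular') (use foldr_nop_unitriangular[of ?js] in \<open>auto simp: p_def simp del: upt_Suc\<close>)
    finally show ?thesis by (simp add: s_z_def)
  qed
  have Nfin: "finite N" "card N = m" using card_par_set[OF kap] by (simp_all add: N_def)
  have first: "wd (map (\<lambda>n. fps_nth (p (k + n) * ?G)) (desc_list N)) A = (if A = N then c ^ m else 0)" for A
  proof -
    have eq: "map (\<lambda>n. fps_nth (p (k + n) * ?G)) (desc_list N) =
        map (\<lambda>n t. c * (if t = n then 1 else 0)) (desc_list N)"
      unfolding upper by (simp add: fun_eq_iff)
    show ?thesis
      unfolding eq wd_scale[of "\<lambda>_. c"] using Nfin by (simp add: wd_delta_rows map_replicate_const)
  qed
  have "wd (map (\<lambda>n. fps_nth (p n * ?G)) ?ns) T =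
      (if N \<subseteq> T then sg (T - N) N * (z_prod k (- int m) * s_z k (T - N)) else 0)"
  proof (cases "finite T \<and> card T = m + k")
    case True
    have "wd (map (\<lambda>n. fps_nth (p n * ?G)) ?ns) T =
        (\<Sum>A\<in>Pow T. if A = N then sg N (T - N) * c ^ m * s_z k (T - N) else 0)"
      unfolding ns map_append wd_append[OF True[THEN conjunct1]] map_map comp_def first lower
      by (rule sum.cong) auto
    also have "\<dots> = (if N \<subseteq> T then sg N (T - N) * c ^ m * s_z k (T - N) else 0)"
      using True by simp
    also have "\<dots> = (if N \<subseteq> T then sg (T - N) N * (z_prod k (- int m) * s_z k (T - N)) else 0)"
    proof (cases "N \<subseteq> T")
      case NT: True
      have "card (T - N) = k" using True NT Nfin by (simp add: card_Diff_subset)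
      \<comment> \<open>Moving m vectors past k vectors costs (-1)^(mk), the same sign as in
        \<open>c ^ m\<close>.\<close>
      then have s: "sg N (T - N) = (- 1) ^ (m * k) * (sg (T - N) N :: laurent)"
        using sg_commute[of N "T - N"] Nfin True by simp
      have "c ^ m = (- 1) ^ (m * k) * z_prod k (- int m)"
      proof -
        have "(- zi j) ^ m = (- 1) ^ m * z_pow j (- int m)" for j
          by (subst power_minus) (simp add: z_pow_def single_power_int)
        then show ?thesis
          by (simp add: c_def z_prod_def prod_power_distrib prod.distrib power_mult)
      qed
      then show ?thesis
        using NT s by (simp add: mult_ac)
    qed simp
    finally show ?thesis .
  next
    case False
    then have "wd (map (\<lambda>n. fps_nth (p n * ?G)) ?ns) T = 0"
      using wd_card[of "map (\<lambda>n. fps_nth (p n * ?G)) ?ns" T] by fastforce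
    moreover have "s_z k (T - N) = 0" if NT: "N \<subseteq> T"
    proof (rule ccontr)
      assume "s_z k (T - N) \<noteq> 0"
      then have "finite (T - N)" "card (T - N) = k" using jt_card unfolding s_z_def by blast+
      moreover have "T = N \<union> (T - N)" using NT by auto
      ultimately have "finite T" "card T = m + k"
        using Nfin card_Un_disjoint[of N "T - N"] by (auto dest: finite_Diff2[THEN iffD1])
      then show False using False by simp
    qed
    ultimately show ?thesis by simp
  qed
  then show ?thesis using rep by (simp add: rep_def lookup_sg_mult)
qed

section \<open>Comparison of coefficients\<close>

lemma z_pow_distinct: "i < j \<Longrightarrow> z_pow j 1 \<noteq> z_pow i 1"
proof
  assume "i < j" "z_pow j 1 = z_pow i 1"
  then have "Poly_Mapping.single (Zv i) (1 :: int) = Poly_Mapping.single (Zv j) 1"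
    by (metis lookup_single_eq lookup_single_not_eq z_pow_def zero_neq_one)
  then have "Poly_Mapping.lookup (Poly_Mapping.single (Zv i) (1 :: int)) (Zv j) = 1" by simp
  then show False using \<open>i < j\<close> by (simp add: lookup_single when_def split: if_splits)
qed

lemma w_pow_distinct: "i < j \<Longrightarrow> w_pow j (- 1) \<noteq> w_pow i (- 1)"
  using xw_distinct[of i j] by (metis emb_single single_one w_pow_def)

lemma schur_poly_z: "mu \<in> Par k \<Longrightarrow> schur_poly k mu (\<lambda>j. z_pow j 1) = s_z k (par_set k mu)"
  unfolding s_z_def by (rule schur_poly_eq_jt) (auto dest: z_pow_distinct)

lemma schur_poly_w: "nu \<in> Par k \<Longrightarrow> schur_poly k nu (\<lambda>j. w_pow j (- 1)) = s_w k (par_set k nu)"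
  unfolding s_w_def by (rule schur_poly_eq_jt) (auto dest: w_pow_distinct)

lemma z_prod_w_prod_cancel:
  "z_prod k n * w_prod k (- n) * (w_prod k n * p * (z_prod k (- n) * q)) = q * p"
proof -
  have z: "z_prod k n * z_prod k (- n) = 1"
    by (simp add: z_prod_def z_pow_def prod.distrib[symmetric] mult_single single_add[symmetric])
  have w: "w_prod k n * w_prod k (- n) = 1"
    by (simp add: w_prod_def w_pow_def prod.distrib[symmetric] mult_single single_add[symmetric])
  have "z_prod k n * w_prod k (- n) * (w_prod k n * p * (z_prod k (- n) * q)) =
      (z_prod k n * z_prod k (- n)) * (w_prod k n * w_prod k (- n)) * (q * p)"
    by (simp only: mult_ac)
  then show ?thesis by (simp only: z w mult_1_left)
qed

text \<open>In degree 0 these numbers are the coefficients of Gamma applied to 1, and an element of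
  the exterior algebra has finite support.\<close>

lemma finite_s_z_support: "finite {M. Poly_Mapping.lookup (s_z k M) e \<noteq> 0}"
proof -
  have "ecoeff (Gamma_basis k 0 empty_par e) M = Poly_Mapping.lookup (s_z k M) e" for M
    by (simp add: ecoeff_Gamma_basis par_set_empty_par z_prod_def z_pow_def)
  then show ?thesis using finite_ecoeff[of "Gamma_basis k 0 empty_par e"] by simp
qed

text \<open>The common value of both sides: the coefficient of \<open>egen_set T\<close> at the exponent e.\<close>

definition E_coeff :: "nat \<Rightarrow> nat set \<Rightarrow> nat set \<Rightarrow> expo \<Rightarrow> rat" where
  "E_coeff k L T e = (\<Sum>A | A \<subseteq> L \<and> card A = k \<and> L - A \<subseteq> T.
     sg A (L - A) * sg (T - (L - A)) (L - A) * Poly_Mapping.lookup (s_z k (T - (L - A)) * s_w k A) e)"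

lemma ecoeff_E_ext:
  assumes L: "finite L" "card L = r"
  shows "ecoeff (E_ext k r (egen_set L) e) T = E_coeff k L T e"
proof -
  let ?c = "\<lambda>M A. Poly_Mapping.lookup (s_z k M * s_w k A) e"
  let ?t = "\<lambda>(\<mu>, \<nu>). if \<mu> \<in> Par k \<and> \<nu> \<in> Par k
     then Poly_Mapping.lookup (schur_poly k \<mu> (\<lambda>j. z_pow j 1) * schur_poly k \<nu> (\<lambda>j. w_pow j (- 1))) e *\<^sub>Q
       (b_par k \<mu> * contract k r (beta_par k \<nu>) (egen_set L)) else 0"
  define I where "I = {A. A \<subseteq> L \<and> card A = k}"
  have fin: "finite A" if "A \<subseteq> L" for A using that L finite_subset by blast
  have I: "finite I" using L by (simp add: I_def)
  \<comment> \<open>The sets M that can meet A at exponent e: a runs over the finitely many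
    exponents of \<open>s_w k A\<close>. This keeps the sum finite although there are infinitely
    many partitions \<mu>.\<close>
  define Ms where "Ms A = {M. \<exists>a\<in>Poly_Mapping.keys (s_w k A). Poly_Mapping.lookup (s_z k M) (e - a) \<noteq> 0}" for A
  have Ms_fin: "finite (Ms A)" for A
  proof -
    have "Ms A = (\<Union>a\<in>Poly_Mapping.keys (s_w k A). {M. Poly_Mapping.lookup (s_z k M) (e - a) \<noteq> 0})"
      by (auto simp: Ms_def)
    then show ?thesis by (simp add: finite_s_z_support)
  qed
  have Ms_card: "finite M" "card M = k" if M: "M \<in> Ms A" for M A
  proof -
    have "s_z k M \<noteq> 0" using M by (auto simp: Ms_def)
    then show "finite M" "card M = k" using jt_card unfolding s_z_def by blast+
  qed
  have c0: "?c M A = 0" if M: "M \<notin> Ms A" for M A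
  proof -
    have "?c M A = (\<Sum>a\<in>Poly_Mapping.keys (s_w k A).
        Poly_Mapping.lookup (s_w k A) a * Poly_Mapping.lookup (s_z k M) (e - a))"
      by (subst mult.commute) (rule lookup_mult_superset; simp)
    then show ?thesis using M by (simp add: Ms_def)
  qed
  define P where "P = (SIGMA A:I. Ms A)"
  have P: "finite P" using I Ms_fin by (simp add: P_def)
  define \<phi> where "\<phi> = (\<lambda>(A, M). (par_of k M, par_of k A))"
  let ?u = "\<lambda>(A, M). ?c M A *\<^sub>Q (egen_set M * (sg A (L - A) *\<^sub>Q egen_set (L - A)))"
  have par: "par_of k A \<in> Par k" "par_set k (par_of k A) = A" if "A \<in> I" for A
    using par_of[of A k] fin that by (auto simp: I_def)
  have parM: "par_of k M \<in> Par k" "par_set k (par_of k M) = M" if "M \<in> Ms A" for M A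
    using par_of[of M k] Ms_card[OF that] by auto
  have inj: "inj_on \<phi> P"
    unfolding inj_on_def \<phi>_def P_def
    by clarsimp (metis par(2) parM(2))
  have t: "?t (\<phi> p) = ?u p" if p: "p \<in> P" for p
  proof -
    obtain A M where AM: "p = (A, M)" "A \<in> I" "M \<in> Ms A" using p by (auto simp: P_def)
    then have "A \<subseteq> L" "card A = k" by (auto simp: I_def)
    then show ?thesis
      using AM L fin par[OF AM(2)] parM[OF AM(3)]
      by (simp add: \<phi>_def schur_poly_z schur_poly_w b_par_eq_egen_set beta_par_eq_egen_set contract_egen_set)
  qed
  have "E_ext k r (egen_set L) e = sum ?t (\<phi> ` P)"
    unfolding E_ext_def
  proof (rule Sum_any.expand_superset)
    show "{p. ?t p \<noteq> 0} \<subseteq> \<phi> ` P"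
    proof
      fix p assume p: "p \<in> {p. ?t p \<noteq> 0}"
      obtain \<mu> \<nu> where pp: "p = (\<mu>, \<nu>)" by (cases p)
      then have mn: "\<mu> \<in> Par k" "\<nu> \<in> Par k" using p by (auto split: if_splits)
      define M where "M = par_set k \<mu>"
      define A where "A = par_set k \<nu>"
      have A: "finite A" "card A = k" using card_par_set[OF mn(2)] by (simp_all add: A_def)
      have "?c M A *\<^sub>Q (egen_set M * contract k r (egen_set A) (egen_set L)) \<noteq> 0"
        using p mn by (simp add: pp schur_poly_z schur_poly_w b_par_eq_egen_set beta_par_eq_egen_set M_def A_def)
      then have "?c M A \<noteq> 0" "contract k r (egen_set A) (egen_set L) \<noteq> 0" by auto
      then have "M \<in> Ms A" "A \<in> I"
        using c0[of M A] contract_egen_set[OF A(1) L A(2)] A by (auto simp: I_def split: if_splits)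
      then have "(A, M) \<in> P" by (simp add: P_def)
      moreover have "p = \<phi> (A, M)"
        using mn by (simp add: pp \<phi>_def M_def A_def par_of_par_set)
      ultimately show "p \<in> \<phi> ` P" by blast
    qed
  qed (use P in simp)
  also have "\<dots> = (\<Sum>p\<in>P. ?u p)"
    unfolding sum.reindex[OF inj] by (rule sum.cong[OF refl]) (simp only: comp_def t)
  finally have "ecoeff (E_ext k r (egen_set L) e) T = (\<Sum>p\<in>P. ecoeff (?u p) T)"
    by (simp add: ecoeff_sum)
  also have "\<dots> = (\<Sum>A\<in>I. \<Sum>M\<in>Ms A. ecoeff (?u (A, M)) T)"
    unfolding P_def by (subst sum.Sigma) (use I Ms_fin in \<open>auto simp: case_prod_beta\<close>)
  also have "\<dots> = (\<Sum>A\<in>I. if L - A \<subseteq> T then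
      sg A (L - A) * sg (T - (L - A)) (L - A) * ?c (T - (L - A)) A else 0)"
  proof (rule sum.cong[OF refl])
    fix A assume A: "A \<in> I"
    let ?N = "L - A"
    have "ecoeff (?u (A, M)) T = (if M = T - ?N then
        (if ?N \<subseteq> T then sg A ?N * sg (T - ?N) ?N * ?c (T - ?N) A else 0) else 0)" if M: "M \<in> Ms A" for M
    proof -
      \<comment> \<open>The wedge product reaches T for a single M, which collapses the sum over
        M.\<close>
      have "M \<inter> ?N = {} \<and> T = M \<union> ?N \<longleftrightarrow> M = T - ?N \<and> ?N \<subseteq> T" by blast
      moreover have "ecoeff (?u (A, M)) T = (if M \<inter> ?N = {} \<and> T = M \<union> ?N then
          sg A ?N * sg M ?N * ?c M A else 0)"
        using Ms_card[OF M] L by (simp add: egen_set_times ecoeff_egen_set esgn_eq_sg)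
      ultimately show ?thesis by (cases "M = T - ?N \<and> ?N \<subseteq> T") auto
    qed
    then have "(\<Sum>M\<in>Ms A. ecoeff (?u (A, M)) T) = (\<Sum>M\<in>Ms A. if M = T - ?N then
        (if ?N \<subseteq> T then sg A ?N * sg (T - ?N) ?N * ?c (T - ?N) A else 0) else 0)"
      by (rule sum.cong[OF refl])
    also have "\<dots> = (if ?N \<subseteq> T then sg A ?N * sg (T - ?N) ?N * ?c (T - ?N) A else 0)"
      using Ms_fin c0[of "T - ?N" A] by (auto simp: sum.delta)
    finally show "(\<Sum>M\<in>Ms A. ecoeff (?u (A, M)) T) =
      (if ?N \<subseteq> T then sg A ?N * sg (T - ?N) ?N * ?c (T - ?N) A else 0)" .
  qed
  also have "\<dots> = E_coeff k L T e"
    unfolding E_coeff_def sum.If_cases[OF I] by (auto simp: I_def intro!: sum.cong)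
  finally show ?thesis .
qed

text \<open>Places the values in the range of the action of B_r, so that \<open>E_B\<close> picks
  genuine preimages.\<close>

lemma E_ext_in_ext_deg:
  assumes L: "finite L" "card L = r"
  shows "E_ext k r (egen_set L) e \<in> ext_deg r"
  unfolding ext_deg_def
proof (safe)
  fix T assume T: "ecoeff (E_ext k r (egen_set L) e) T \<noteq> 0"
  then have "E_coeff k L T e \<noteq> 0" using ecoeff_E_ext[OF L] by simp
  then obtain A where A: "A \<subseteq> L" "card A = k" "L - A \<subseteq> T"
    "Poly_Mapping.lookup (s_z k (T - (L - A)) * s_w k A) e \<noteq> 0"
    unfolding E_coeff_def by (force elim: sum.not_neutral_contains_not_neutral)
  then have "s_z k (T - (L - A)) \<noteq> 0" by auto
  then have "card (T - (L - A)) = k" unfolding s_z_def using jt_card by blast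
  moreover have "card (L - A) = r - k" "k \<le> r" "finite (L - A)"
    using A(1,2) L card_mono[of L A] by (auto simp: card_Diff_subset finite_subset)
  moreover have "card T = card (T - (L - A)) + card (L - A)"
    using A(3) T ecoeff_infinite calculation(4) by (metis card_Diff_subset card_mono le_add_diff_inverse2)
  ultimately show "card T = r" by simp
qed

lemma lin_par_sum:
  assumes "finite I" "\<And>A. A \<in> I \<Longrightarrow> finite (N A) \<and> card (N A) = m"
  shows "lin_par m f (\<Sum>A\<in>I. c A *\<^sub>Q egen_set (N A)) e = (\<Sum>A\<in>I. c A *\<^sub>Q f (par_of m (N A)) e)"
proof -
  let ?u = "\<Sum>A\<in>I. c A *\<^sub>Q egen_set (N A)"
  define K where "K = (\<lambda>A. par_of m (N A)) ` I"
  have K: "finite K" "K \<subseteq> Par m" using assms par_of(1) by (auto simp: K_def)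
  have co: "ecoeff ?u S = (\<Sum>A\<in>I. if S = N A then c A else 0)" for S
    unfolding ecoeff_sum by (rule sum.cong[OF refl]) (use assms in \<open>simp add: ecoeff_egen_set\<close>)
  have "lin_par m f ?u e = (\<Sum>\<kappa>\<in>K. if \<kappa> \<in> Par m then ecoeff ?u (par_set m \<kappa>) *\<^sub>Q f \<kappa> e else 0)"
    unfolding lin_par_def
  proof (rule Sum_any.expand_superset)
    show "{\<kappa>. (if \<kappa> \<in> Par m then ecoeff ?u (par_set m \<kappa>) *\<^sub>Q f \<kappa> e else 0) \<noteq> 0} \<subseteq> K"
    proof
      fix \<kappa> assume "\<kappa> \<in> {\<kappa>. (if \<kappa> \<in> Par m then ecoeff ?u (par_set m \<kappa>) *\<^sub>Q f \<kappa> e else 0) \<noteq> 0}"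
      then have \<kappa>: "\<kappa> \<in> Par m" "ecoeff ?u (par_set m \<kappa>) \<noteq> 0" by (auto split: if_splits)
      have "\<exists>A\<in>I. par_set m \<kappa> = N A"
      proof (rule ccontr)
        assume "\<not> (\<exists>A\<in>I. par_set m \<kappa> = N A)"
        then have "ecoeff ?u (par_set m \<kappa>) = 0" unfolding co by (intro sum.neutral) auto
        then show False using \<kappa> by blast
      qed
      then show "\<kappa> \<in> K" using par_of_par_set[OF \<kappa>(1)] by (auto simp: K_def)
    qed
  qed (rule K)
  also have "\<dots> = (\<Sum>\<kappa>\<in>K. \<Sum>A\<in>I. if \<kappa> = par_of m (N A) then c A *\<^sub>Q f (par_of m (N A)) e else 0)"
  proof (rule sum.cong[OF refl])
    fix \<kappa> assume "\<kappa> \<in> K"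
    then have \<kappa>: "\<kappa> \<in> Par m" using K by blast
    have "par_set m \<kappa> = N A \<longleftrightarrow> \<kappa> = par_of m (N A)" if "A \<in> I" for A
      using par_of_par_set[OF \<kappa>] par_of(2)[of "N A" m] assms(2)[OF that] by auto
    then show "(if \<kappa> \<in> Par m then ecoeff ?u (par_set m \<kappa>) *\<^sub>Q f \<kappa> e else 0) =
        (\<Sum>A\<in>I. if \<kappa> = par_of m (N A) then c A *\<^sub>Q f (par_of m (N A)) e else 0)"
      using \<kappa> by (simp add: co scaleQ_sum_left) (auto intro!: sum.cong)
  qed
  also have "\<dots> = (\<Sum>A\<in>I. c A *\<^sub>Q f (par_of m (N A)) e)"
    by (subst sum.swap) (use K in \<open>auto simp: K_def sum.delta intro!: sum.cong\<close>)
  finally show ?thesis .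
qed

lemma Gamma_star_op_b_par:
  assumes "lam \<in> Par r"
  shows "Gamma_star_op k r (b_par r lam) = Gamma_star_basis k r lam"
proof
  fix e
  show "Gamma_star_op k r (b_par r lam) e = Gamma_star_basis k r lam e"
    using lin_par_sum[of "{()}" "\<lambda>_. par_set r lam" r "Gamma_star_basis k r" "\<lambda>_. 1" e]
      card_par_set[OF assms]
    by (simp add: Gamma_star_op_def b_par_eq_egen_set[OF assms] par_of_par_set[OF assms])
qed

text \<open>Gamma acts on each summand of Gamma-star through the m-set \<open>L - A\<close>. The
  exponents convolve, so the coefficient is one of a product of Laurent polynomials, in which the
  prefactor cancels the powers in \<open>W A\<close> and \<open>Z A\<close>.\<close>

lemma ecoeff_Gamma_Gamma_star:
  assumes lam: "lam \<in> Par r" and k: "k \<le> r"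
  shows "ecoeff (laurent_mult (z_prod k (int (r - k)) * w_prod k (- int (r - k)))
      (Gamma_op k (r - k) (Gamma_star_op k r (b_par r lam))) e) T =
    E_coeff k (par_set r lam) T e"
proof -
  define m where "m = r - k"
  define L where "L = par_set r lam"
  have L: "finite L" "card L = r" using card_par_set[OF lam] by (simp_all add: L_def)
  define I where "I = {A. A \<subseteq> L \<and> card A = k}"
  have I: "finite I" using L by (simp add: I_def)
  have N: "finite (L - A) \<and> card (L - A) = m" if "A \<in> I" for A
    using that L by (auto simp: I_def m_def card_Diff_subset finite_subset)
  define W where "W A = w_prod k (int m) * s_w k A" for A
  define Z where "Z A = z_prod k (- int m) * s_z k (T - (L - A))" for A
  define q where "q A = (sg A (L - A) * sg (T - (L - A)) (L - A) :: rat)" for A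
  let ?F = "Gamma_star_op k r (b_par r lam)"
  let ?P = "z_prod k (int m) * w_prod k (- int m)"
  let ?I = "{A \<in> I. L - A \<subseteq> T}"
  have F: "?F a = (\<Sum>A\<in>I. (sg A (L - A) * Poly_Mapping.lookup (W A) a) *\<^sub>Q egen_set (L - A))" for a
    unfolding Gamma_star_op_b_par[OF lam] Gamma_star_basis_eq[OF lam k] I_def W_def L_def m_def ..
  have op: "ecoeff (Gamma_op k m ?F e) T = (\<Sum>A\<in>?I. q A * Poly_Mapping.lookup (W A * Z A) e)" for e
  proof -
    define K where "K = (\<Union>A\<in>I. Poly_Mapping.keys (W A))"
    have K: "finite K" using I by (simp add: K_def)
    let ?g = "\<lambda>a. \<Sum>A\<in>I. (sg A (L - A) * Poly_Mapping.lookup (W A) a) *\<^sub>Q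
      Gamma_basis k m (par_of m (L - A)) (e - a)"
    have "Gamma_op k m ?F e = Sum_any ?g"
      unfolding Gamma_op_def F by (subst lin_par_sum[OF I N]) auto
    also have "\<dots> = (\<Sum>a\<in>K. ?g a)"
    proof (rule Sum_any.expand_superset[OF K])
      show "{a. ?g a \<noteq> 0} \<subseteq> K"
      proof
        fix a assume a: "a \<in> {a. ?g a \<noteq> 0}"
        show "a \<in> K"
        proof (rule ccontr)
          assume "a \<notin> K"
          then have "Poly_Mapping.lookup (W A) a = 0" if "A \<in> I" for A
            using that by (auto simp: K_def in_keys_iff)
          then have "?g a = 0" by simp
          then show False using a by simp
        qed
      qed
    qed
    also have "ecoeff \<dots> T = (\<Sum>a\<in>K. \<Sum>A\<in>I.
        if L - A \<subseteq> T then q A * (Poly_Mapping.lookup (W A) a * Poly_Mapping.lookup (Z A) (e - a)) else 0)"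
      unfolding ecoeff_sum
    proof (intro sum.cong refl)
      fix a A assume A: "A \<in> I"
      have p: "par_of m (L - A) \<in> Par m" "par_set m (par_of m (L - A)) = L - A"
        using par_of[of "L - A" m] N[OF A] by auto
      show "ecoeff ((sg A (L - A) * Poly_Mapping.lookup (W A) a) *\<^sub>Q
          Gamma_basis k m (par_of m (L - A)) (e - a)) T =
        (if L - A \<subseteq> T then q A * (Poly_Mapping.lookup (W A) a * Poly_Mapping.lookup (Z A) (e - a)) else 0)"
        using ecoeff_Gamma_basis[OF p(1), of k "e - a" T] by (simp add: p(2) q_def Z_def mult_ac)
    qed
    also have "\<dots> = (\<Sum>A\<in>I. if L - A \<subseteq> T then q A * Poly_Mapping.lookup (W A * Z A) e else 0)"
    proof (subst sum.swap, rule sum.cong[OF refl])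
      fix A assume "A \<in> I"
      then have "Poly_Mapping.lookup (W A * Z A) e =
          (\<Sum>a\<in>K. Poly_Mapping.lookup (W A) a * Poly_Mapping.lookup (Z A) (e - a))"
        by (intro lookup_mult_superset[OF K]) (auto simp: K_def)
      then show "(\<Sum>a\<in>K. if L - A \<subseteq> T then q A * (Poly_Mapping.lookup (W A) a * Poly_Mapping.lookup (Z A) (e - a)) else 0) =
          (if L - A \<subseteq> T then q A * Poly_Mapping.lookup (W A * Z A) e else 0)"
        by (simp add: sum_distrib_left)
    qed
    finally show ?thesis using I by (simp add: sum.inter_filter)
  qed
  have "ecoeff (laurent_mult ?P (Gamma_op k m ?F) e) T =
      (\<Sum>a\<in>Poly_Mapping.keys ?P. Poly_Mapping.lookup ?P a * (\<Sum>A\<in>?I. q A * Poly_Mapping.lookup (W A * Z A) (e - a)))"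
    by (simp add: laurent_mult_def ecoeff_sum op)
  also have "\<dots> = (\<Sum>A\<in>?I. q A * (\<Sum>a\<in>Poly_Mapping.keys ?P. Poly_Mapping.lookup ?P a * Poly_Mapping.lookup (W A * Z A) (e - a)))"
    unfolding sum_distrib_left by (subst sum.swap) (simp only: mult_ac)
  also have "\<dots> = (\<Sum>A\<in>?I. q A * Poly_Mapping.lookup (?P * (W A * Z A)) e)"
    by (simp only: lookup_mult_superset[OF finite_keys subset_refl])
  also have "\<dots> = E_coeff k L T e"
    unfolding W_def Z_def z_prod_w_prod_cancel E_coeff_def q_def I_def
    by (rule sum.cong) (auto simp: conj_assoc)
  finally show ?thesis unfolding m_def L_def .
qed

theorem theorem7p5:
  fixes k r :: nat and lam :: "nat \<Rightarrow> nat"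
  assumes "lam \<in> Par r"
  shows "B_act_series r (E_B k r (Delta r lam (H_seq r))) (b_par r empty_par) =
    laurent_mult (\<Prod>j\<in>{1..k}. z_pow j (int r - int k) * w_pow j (- (int r - int k)))
      (Gamma_op k (r - k) (Gamma_star_op k r (b_par r lam)))"
proof -
  let ?L = "par_set r lam"
  have L: "finite ?L" "card ?L = r" using card_par_set[OF assms] by simp_all
  have b: "b_par r lam = egen_set ?L" by (rule b_par_eq_egen_set[OF assms])
  have lhs: "B_act_series r (E_B k r (Delta r lam (H_seq r))) (b_par r empty_par) = E_ext k r (b_par r lam)"
    by (rule B_act_series_E_B[OF assms]) (simp add: b E_ext_in_ext_deg[OF L])
  show ?thesis
  proof (cases "k \<le> r")
    case True
    have P: "(\<Prod>j\<in>{1..k}. z_pow j (int r - int k) * w_pow j (- (int r - int k))) =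
        z_prod k (int (r - k)) * w_prod k (- int (r - k))"
      using True by (simp add: z_prod_def w_prod_def prod.distrib of_nat_diff)
    show ?thesis
      unfolding lhs P
    proof (rule ext, rule ext_eqI)
      fix e T
      show "ecoeff (E_ext k r (b_par r lam) e) T =
          ecoeff (laurent_mult (z_prod k (int (r - k)) * w_prod k (- int (r - k)))
            (Gamma_op k (r - k) (Gamma_star_op k r (b_par r lam))) e) T"
        using ecoeff_Gamma_Gamma_star[OF assms True, of e T] ecoeff_E_ext[OF L, of k e T]
        by (simp only: b)
    qed
  next
    case False
    \<comment> \<open>For k > r the natural number r - k is 0, but contraction and Gamma-star both
      vanish, hence both sides.\<close>
    have "E_ext k r (b_par r lam) e = 0" for e
    proof -
      have "contract k r \<alpha> u = 0" for \<alpha> u using False by (simp add: contract_def)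
      then show ?thesis by (simp add: E_ext_def cong: if_cong)
    qed
    moreover have "Gamma_star_op k r (b_par r lam) = (\<lambda>_. 0)"
      using False by (simp add: Gamma_star_op_b_par[OF assms] Gamma_star_basis_def)
    moreover have "lin_par m f 0 e = 0" for m f e
      by (simp add: lin_par_def cong: if_cong)
    ultimately show ?thesis
      unfolding lhs by (simp add: fun_eq_iff laurent_mult_def Gamma_op_def)
  qed
qed

end
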